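(* Let $Q$, $A$, $B$, $C_Q$, $\mathrm{Aut}^+(Q,\mathbb{Z}^2)$ and $\Phi_m^{c_1,c_2}$ be as in the context. Let $c\in C_Q$ and suppose $\{(m_j,\gamma_j)\}$ is a finite collection where each $m_j$ is a periodic function on $\mathbb{Z}^2$ such that $Q(\nu)\neq 0$ for all $\nu$ in the support of $m_j$, and each $\gamma_j\in\mathrm{Aut}^+(Q,\mathbb{Z}^2)$, such that \begin{equation*} \sum_{j} (m_j -m_j\circ \gamma_j) =0. \end{equation*} Then $F=\sum_j \Phi_{m_j}^{c,\gamma_j c}$ is a weight $0$ Maass form (on some subgroup of $\mathrm{SL}_2(\mathbb{Z})$, with some multiplier system) with eigenvalue $1/4$ of the Laplace operator $\Delta_0=-y^2\left(\frac{\partial^2}{\partial x^2}+\frac{\partial^2}{\partial y^2}\right)$; i.e.\ $\Delta_0F=\frac14F$ and there are a subgroup $\Gamma\subseteq\mathrm{SL}_2(\mathbb{Z})$ and a map $v$ on $\Gamma$ with $F\!\left(\frac{a\tau+b}{c\tau+d}\right)=v\!\begin{pmatrix}a&b\\c&d\end{pmatrix}F(\tau)$ for all $\begin{pmatrix}a&b\\c&d\end{pmatrix}\in\Gamma$. Moreover, $\sum_j \Phi_{m_j}^{c,\gamma_j c}$ is independent of the choice of $c\in C_Q$.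
   Context: $A$ is a symmetric $2\times 2$ integer matrix such that $Q(\nu)=\frac12\nu^tA\nu$ on $\mathbb{R}^2$ has signature $(1,1)$; $B(\nu,\mu)=\nu^tA\mu$. $C_Q$ is a fixed one of the two components of $\{c\in\mathbb{R}^2:Q(c)=-1\}$. Choose $P\in\mathrm{GL}_2(\mathbb{R})$ with $A=P^t\begin{pmatrix}0&1\\1&0\end{pmatrix}P$ and $P^{-1}\binom{1}{-1}\in C_Q$; set $c(t)=P^{-1}\binom{e^t}{-e^{-t}}$, $c^\perp(t)=P^{-1}\binom{e^t}{e^{-t}}$. For $c_i\in C_Q$, $t_i$ is defined by $c(t_i)=c_i$ and $c_i^\perp:=c^\perp(t_i)$. $\mathrm{Aut}^+(Q,\mathbb{Z}^2)$ is the group of $\gamma\in\mathrm{GL}_2(\mathbb{R})$ with $Q\circ\gamma=Q$, $\gamma\mathbb{Z}^2=\mathbb{Z}^2$, $\gamma C_Q=C_Q$ and $\det\gamma=1$. A function $m:\mathbb{Z}^2\to\mathbb{C}$ is periodic if there is $L\in\mathbb{Z}$ with $m(\nu+\mu)=m(\nu)$ for all $\nu\in\mathbb{Z}^2$, $\mu\in L\mathbb{Z}^2$. $K_0$ is the modified Bessel function of the second kind, $\mathrm{sgn}(0)=0$, $\tau=x+iy\in\mathbb{H}$. For $c_1,c_2\in C_Q$ and periodic $m$, \begin{equation*} \begin{split} \Phi_m^{c_1,c_2} (\tau) &= \mathrm{sgn}(t_2-t_1)\ y^{1/2} \sum_{\nu\in \mathbb{Z}^2} \tfrac{1}{2}\bigl[1-\mathrm{sgn}(B(\nu,c_1)B(\nu,c_2))\bigr]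 m(\nu) e^{2\pi iQ(\nu)x} K_0(2\pi Q(\nu) y)\\ &\ + \mathrm{sgn}(t_2-t_1)\ y^{1/2} \sum_{\nu\in\mathbb{Z}^2} \tfrac{1}{2}\bigl[1-\mathrm{sgn}(B(\nu,c_1^\perp)B(\nu,c_2^\perp))\bigr] m(\nu) e^{2\pi iQ(\nu)x} K_0(-2\pi Q(\nu) y). \end{split} \end{equation*} *)

theory Defs
  imports "HOL-Analysis.Analysis" "HOL-Algebra.Coset"
begin

definition bil :: "real^2^2 \<Rightarrow> real^2 \<Rightarrow> real^2 \<Rightarrow> real" where
  "bil A \<nu> \<mu> = \<nu> \<bullet> (A *v \<mu>)"

definition quad :: "real^2^2 \<Rightarrow> real^2 \<Rightarrow> real" where
  "quad A \<nu> = (1/2) * (\<nu> \<bullet> (A *v \<nu>))"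

(* p positive and q negative coefficients after diagonalising by a real change of basis;
   well defined by Sylvester's law of inertia. *)
definition has_signature :: "real^'n^'n \<Rightarrow> nat \<Rightarrow> nat \<Rightarrow> bool" where
  "has_signature A p q \<longleftrightarrow>
     (\<exists>(S :: real^'n^'n) (d :: 'n \<Rightarrow> real). invertible S \<and>
        transpose S ** A ** S = (\<chi> i j. if i = j then d i else 0) \<and>
        card {i. d i > 0} = p \<and> card {i. d i < 0} = q)"

definition lattice_Z2 :: "(real^2) set" where
  "lattice_Z2 = {\<nu>. \<forall>i. \<nu> $ i \<in> \<int>}"

definition hyp_J :: "real^2^2" where
  "hyp_J = vector [vector [0, 1], vector [1, 0]]"

definition c_curve :: "real^2^2 \<Rightarrow> real \<Rightarrow> real^2" where
  "c_curve P t = matrix_inv P *v vector [exp t, - exp (- t)]"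

definition c_perp_curve :: "real^2^2 \<Rightarrow> real \<Rightarrow> real^2" where
  "c_perp_curve P t = matrix_inv P *v vector [exp t, exp (- t)]"

definition t_param :: "real^2^2 \<Rightarrow> real^2 \<Rightarrow> real" where
  "t_param P c = (THE t. c_curve P t = c)"

definition perp :: "real^2^2 \<Rightarrow> real^2 \<Rightarrow> real^2" where
  "perp P c = c_perp_curve P (t_param P c)"

definition Aut_plus :: "real^2^2 \<Rightarrow> (real^2) set \<Rightarrow> (real^2^2) set" where
  "Aut_plus A C = {\<gamma>. invertible \<gamma> \<and> (\<forall>\<nu>. quad A (\<gamma> *v \<nu>) = quad A \<nu>) \<and>
     (\<lambda>\<nu>. \<gamma> *v \<nu>) ` lattice_Z2 = lattice_Z2 \<and>
     (\<lambda>\<nu>. \<gamma> *v \<nu>) ` C = C \<and> det \<gamma> = 1}"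

(* Functions on the lattice are total functions on R^2 whose values off the lattice are ignored.
   The period L must be nonzero: L = 0 would make every function periodic. *)
definition periodic_Z2 :: "(real^2 \<Rightarrow> complex) \<Rightarrow> bool" where
  "periodic_Z2 m \<longleftrightarrow> (\<exists>L::int. L \<noteq> 0 \<and>
     (\<forall>\<nu>\<in>lattice_Z2. \<forall>\<mu>\<in>lattice_Z2. m (\<nu> + of_int L *\<^sub>R \<mu>) = m \<nu>))"

(* Integral representation of the modified Bessel function of the second kind of order 0, valid for
   x > 0. In Phi below the coefficient of every term with argument <= 0 vanishes: either the sign
   factor is 0, or Q(\<nu>) = 0 and m(\<nu>) = 0. *)
definition bessel_K0 :: "real \<Rightarrow> real" where
  "bessel_K0 x = integral {0..} (\<lambda>t. exp (- x * cosh t))"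

definition Phi ::
  "real^2^2 \<Rightarrow> real^2^2 \<Rightarrow> (real^2 \<Rightarrow> complex) \<Rightarrow> real^2 \<Rightarrow> real^2 \<Rightarrow> complex \<Rightarrow> complex" where
  "Phi A P m c1 c2 \<tau> =
     of_real (sgn (t_param P c2 - t_param P c1) * sqrt (Im \<tau>)) *
       (\<Sum>\<^sub>\<infinity>\<nu>\<in>lattice_Z2. of_real ((1/2) * (1 - sgn (bil A \<nu> c1 * bil A \<nu> c2))) * m \<nu> *
          exp (2 * of_real pi * \<i> * of_real (quad A \<nu>) * of_real (Re \<tau>)) *
          of_real (bessel_K0 (2 * pi * quad A \<nu> * Im \<tau>))) +
     of_real (sgn (t_param P c2 - t_param P c1) * sqrt (Im \<tau>)) *
       (\<Sum>\<^sub>\<infinity>\<nu>\<in>lattice_Z2.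
          of_real ((1/2) * (1 - sgn (bil A \<nu> (perp P c1) * bil A \<nu> (perp P c2)))) * m \<nu> *
          exp (2 * of_real pi * \<i> * of_real (quad A \<nu>) * of_real (Re \<tau>)) *
          of_real (bessel_K0 (- 2 * pi * quad A \<nu> * Im \<tau>)))"

definition upper_half_plane :: "complex set" where
  "upper_half_plane = {\<tau>. Im \<tau> > 0}"

definition partial_x :: "(complex \<Rightarrow> complex) \<Rightarrow> complex \<Rightarrow> complex" where
  "partial_x F \<tau> = vector_derivative (\<lambda>s. F (\<tau> + of_real s)) (at 0)"

definition partial_y :: "(complex \<Rightarrow> complex) \<Rightarrow> complex \<Rightarrow> complex" where
  "partial_y F \<tau> = vector_derivative (\<lambda>s. F (\<tau> + \<i> * of_real s)) (at 0)"

(* k times continuously differentiable on the upper half-plane, in the real sense. *)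
fun Ck_upper :: "nat \<Rightarrow> (complex \<Rightarrow> complex) \<Rightarrow> bool" where
  "Ck_upper 0 F \<longleftrightarrow> continuous_on upper_half_plane F"
| "Ck_upper (Suc k) F \<longleftrightarrow> F differentiable_on upper_half_plane \<and>
     Ck_upper k (partial_x F) \<and> Ck_upper k (partial_y F)"

definition laplace0 :: "(complex \<Rightarrow> complex) \<Rightarrow> complex \<Rightarrow> complex" where
  "laplace0 F \<tau> =
     - of_real ((Im \<tau>)\<^sup>2) * (partial_x (partial_x F) \<tau> + partial_y (partial_y F) \<tau>)"

definition SL2Z :: "(int^2^2) monoid" where
  "SL2Z = \<lparr>carrier = {M. det M = 1}, mult = (**), one = mat 1\<rparr>"

lemma group_SL2Z: "group SL2Z"
proof (rule groupI)
  fix M assume "M \<in> carrier SL2Z"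
  then have d: "M$1$1 * M$2$2 - M$1$2 * M$2$1 = 1"
    by (simp add: SL2Z_def det_2)
  define N :: "int^2^2" where "N = vector [vector [M$2$2, - M$1$2], vector [- M$2$1, M$1$1]]"
  have "det N = 1" "N ** M = mat 1"
    using d by (simp_all add: N_def det_2 vec_eq_iff forall_2 matrix_matrix_mult_def mat_def sum_2
        algebra_simps)
  then show "\<exists>N\<in>carrier SL2Z. N \<otimes>\<^bsub>SL2Z\<^esub> M = \<one>\<^bsub>SL2Z\<^esub>"
    by (auto simp: SL2Z_def)
qed (auto simp: SL2Z_def det_mul matrix_mul_assoc)

definition moebius :: "int^2^2 \<Rightarrow> complex \<Rightarrow> complex" where
  "moebius M \<tau> = (of_int (M$1$1) * \<tau> + of_int (M$1$2)) / (of_int (M$2$1) * \<tau> + of_int (M$2$2))"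

(* Twice continuous differentiability is what gives the eigenvalue equation its meaning. *)
definition maass_form_wt0 ::
  "(int^2^2) set \<Rightarrow> (int^2^2 \<Rightarrow> complex) \<Rightarrow> complex \<Rightarrow> (complex \<Rightarrow> complex) \<Rightarrow> bool" where
  "maass_form_wt0 \<Gamma> v ev F \<longleftrightarrow> Ck_upper 2 F \<and>
     (\<forall>\<tau>\<in>upper_half_plane. laplace0 F \<tau> = ev * F \<tau>) \<and>
     (\<forall>M\<in>\<Gamma>. \<forall>\<tau>\<in>upper_half_plane. F (moebius M \<tau>) = v M * F \<tau>)"

end

theory Submission
  imports Defs "HOL-Probability.Probability" "HOL-Complex_Analysis.Conformal_Mappings" "HOL-Real_Asymp.Real_Asymp"
begin

text \<open>
  In coordinates with \<open>Q = \<xi>\<eta>\<close> the curve \<open>C\<close> is \<open>c(t)\<close>, and \<open>\<gamma> \<in> Aut_plus\<close> acts as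
  \<open>(\<xi>, \<eta>) \<mapsto> (e\<^sup>s \<xi>, e\<^sup>-\<^sup>s \<eta>)\<close>, so that \<open>\<gamma> c(t) = c(t + s)\<close>. The sign factors select the \<open>\<nu>\<close> whose parameter
  \<open>t\<^sub>\<nu>\<close> lies between \<open>t\<^sub>1\<close> and \<open>t\<^sub>2\<close>, and \<open>K\<^sub>0(2\<pi>|Q(\<nu>)|y)\<close> is the integral over all \<open>u\<close> of
  \<open>exp(-\<pi>y Q\<^sub>u(\<nu>))\<close>, where \<open>Q\<^sub>u = (\<xi> e\<^sup>-\<^sup>u)\<^sup>2 + (\<eta> e\<^sup>u)\<^sup>2\<close> is the majorant of \<open>2Q\<close> at \<open>c(u)\<close>. Hence \<open>\<Phi>\<close> is \<open>\<surd>y\<close> times the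
  integral of the Siegel theta function over \<open>[t\<^sub>1, t\<^sub>2]\<close>, up to an error \<open>\<phi>(t\<^sub>2) - \<phi>(t\<^sub>1)\<close> that is equivariant under
  automorphisms; the hypothesis on \<open>\<Sum>(m\<^sub>j - m\<^sub>j \<circ> \<gamma>\<^sub>j)\<close> makes the errors cancel in \<open>F\<close>. The theta function of
  signature \<open>(1,1)\<close> has weight 0 after multiplication by \<open>\<surd>y\<close>, and on a principal congruence subgroup Poisson summation
  reduces its transformation to a Gauss sum that does not depend on \<open>u\<close> or \<open>m\<close>. The eigenvalue equation is checked
  on the individual Bessel terms of \<open>\<Phi>\<close>.
\<close>

subsection \<open>Oscillating Laplace integrals\<close>

lemma has_derivative_at_quadratic_remainder:
  fixes f :: "'a::real_normed_vector \<Rightarrow> 'b::real_normed_vector"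
  assumes "bounded_linear f'" and "r > 0"
    and remainder: "\<And>h. norm h < r \<Longrightarrow> norm (f (x + h) - f x - f' h) \<le> B * (norm h)\<^sup>2"
  shows "(f has_derivative f') (at x)"
  unfolding has_derivative_at
proof
  show "(\<lambda>h. norm (f (x + h) - f x - f' h) / norm h) \<midarrow>0\<rightarrow> 0"
  proof (rule Lim_null_comparison)
    have "norm (f (x + h) - f x - f' h) / norm h \<le> B * norm h" if "norm h < r" "h \<noteq> 0" for h
      using remainder[OF that(1)] that(2) by (simp add: power2_eq_square field_simps)
    with \<open>r > 0\<close> show "\<forall>\<^sub>F h in at 0. norm (norm (f (x + h) - f x - f' h) / norm h) \<le> B * norm h"
      unfolding eventually_at by (intro exI[of _ r]) auto
    show "(\<lambda>h. B * norm h) \<midarrow>0\<rightarrow> 0"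
      by (auto intro!: tendsto_eq_intros)
  qed
qed fact

lemma norm_exp_minus_one_minus_le:
  fixes z :: complex
  shows "norm (exp z - (1 + z)) \<le> exp \<bar>Re z\<bar> * (norm z)\<^sup>2"
  using Taylor_exp[of z 1] by (simp add: power2_eq_square)

locale oscillating_laplace =
  fixes M :: "'a measure" and a c :: "'a \<Rightarrow> real"
  assumes measurable_a [measurable]: "a \<in> borel_measurable M"
    and measurable_c [measurable]: "c \<in> borel_measurable M"
    and abs_a_le: "\<bar>a u\<bar> \<le> c u"
begin

definition phase :: "complex \<Rightarrow> 'a \<Rightarrow> complex" where
  "phase \<tau> u = \<i> * of_real (a u * Re \<tau>) - of_real (c u * Im \<tau>)"

definition laplace :: "('a \<Rightarrow> complex) \<Rightarrow> complex \<Rightarrow> complex" where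
  "laplace w \<tau> = (LINT u|M. w u * exp (phase \<tau> u))"

definition admissible :: "('a \<Rightarrow> complex) \<Rightarrow> bool" where
  "admissible w \<longleftrightarrow> w \<in> borel_measurable M \<and>
     (\<forall>y>0. integrable M (\<lambda>u. w u * of_real (exp (- c u * y))))"

abbreviation phase_mult :: "complex \<Rightarrow> ('a \<Rightarrow> complex) \<Rightarrow> 'a \<Rightarrow> complex" where
  "phase_mult h w \<equiv> \<lambda>u. phase h u * w u"

lemma measurable_phase [measurable]: "phase \<tau> \<in> borel_measurable M"
  unfolding phase_def by measurable

lemma c_nonneg: "0 \<le> c u"
  using abs_a_le[of u] by linarith

lemma phase_add: "phase (\<tau> + h) u = phase \<tau> u + phase h u"
  by (simp add: phase_def algebra_simps)

lemma phase_decompose: "phase h u = of_real (Re h) * phase 1 u + of_real (Im h) * phase \<i> u"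
  by (simp add: phase_def)

lemma norm_phase_le: "norm (phase h u) \<le> 2 * norm h * c u"
proof -
  have "norm (phase h u) \<le> \<bar>Re h\<bar> * \<bar>a u\<bar> + \<bar>Im h\<bar> * c u"
    using norm_triangle_ineq4[of "\<i> * of_real (a u * Re h)" "of_real (c u * Im h)"] c_nonneg[of u]
    by (simp add: phase_def norm_mult abs_mult mult.commute)
  also have "\<dots> \<le> norm h * c u + norm h * c u"
    by (intro add_mono mult_mono abs_a_le abs_Re_le_cmod abs_Im_le_cmod) (auto simp: c_nonneg)
  finally show ?thesis
    by simp
qed

lemma admissible_measurable: "admissible w \<Longrightarrow> w \<in> borel_measurable M"
  by (simp add: admissible_def)

lemma admissible_integrable_exp:
  "admissible w \<Longrightarrow> y > 0 \<Longrightarrow> integrable M (\<lambda>u. w u * of_real (exp (- c u * y)))"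
  by (simp add: admissible_def)

lemma admissible_integrable_phase:
  assumes w: "admissible w" and "Im \<tau> > 0"
  shows "integrable M (\<lambda>u. w u * exp (phase \<tau> u))"
proof (rule Bochner_Integration.integrable_bound)
  note [measurable] = admissible_measurable[OF w]
  show "integrable M (\<lambda>u. w u * of_real (exp (- c u * Im \<tau>)))"
    by (rule admissible_integrable_exp) fact+
  show "(\<lambda>u. w u * exp (phase \<tau> u)) \<in> borel_measurable M"
    by measurable
  show "AE u in M. norm (w u * exp (phase \<tau> u)) \<le> norm (w u * of_real (exp (- c u * Im \<tau>)))"
    by (simp add: norm_mult phase_def)
qed

lemma c_times_exp_le:
  assumes "y > 0"
  shows "c u * exp (- c u * y) \<le> 2 / y * exp (- c u * (y / 2))"
proof -
  have "c u * (y / 2) \<le> exp (c u * (y / 2))"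
    using exp_ge_add_one_self[of "c u * (y / 2)"] by linarith
  then have "c u \<le> 2 / y * exp (c u * (y / 2))"
    using assms by (simp add: field_simps)
  then have "c u * exp (- c u * y) \<le> 2 / y * exp (c u * (y / 2)) * exp (- c u * y)"
    by (intro mult_right_mono) auto
  also have "\<dots> = 2 / y * exp (- c u * (y / 2))"
    by (simp add: exp_add [symmetric] mult.assoc)
  finally show ?thesis .
qed

lemma admissible_mult:
  assumes w: "admissible w" and [measurable]: "f \<in> borel_measurable M"
    and f: "\<And>u. norm (f u) \<le> K * c u"
  shows "admissible (\<lambda>u. f u * w u)"
  unfolding admissible_def
proof (intro conjI allI impI)
  note [measurable] = admissible_measurable[OF w]
  show "(\<lambda>u. f u * w u) \<in> borel_measurable M"
    by measurable
  fix y :: real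
  assume y: "y > 0"
  let ?g = "\<lambda>u. of_real (\<bar>K\<bar> * (2 / y)) * (w u * of_real (exp (- c u * (y / 2))))"
  have dominated: "norm (f u * w u * of_real (exp (- c u * y))) \<le> norm (?g u)" for u
  proof -
    have "K * c u \<le> \<bar>K\<bar> * c u"
      by (intro mult_right_mono c_nonneg) simp
    then have "norm (f u) * exp (- c u * y) \<le> \<bar>K\<bar> * (c u * exp (- c u * y))"
      using f[of u] by (simp add: mult.assoc[symmetric])
    also have "\<dots> \<le> \<bar>K\<bar> * (2 / y * exp (- c u * (y / 2)))"
      by (intro mult_left_mono c_times_exp_le y) simp
    finally have "norm (w u) * (norm (f u) * exp (- c u * y))
        \<le> norm (w u) * (\<bar>K\<bar> * (2 / y * exp (- c u * (y / 2))))"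
      by (rule mult_left_mono) simp
    then show ?thesis
      using y by (simp add: norm_mult norm_divide algebra_simps)
  qed
  have "integrable M ?g"
    by (intro integrable_mult_right admissible_integrable_exp[OF w half_gt_zero[OF y]])
  then show "integrable M (\<lambda>u. f u * w u * of_real (exp (- c u * y)))"
    by (rule Bochner_Integration.integrable_bound) (measurable, intro AE_I2 dominated)
qed

lemma admissible_phase_mult: "admissible w \<Longrightarrow> admissible (phase_mult h w)"
  by (rule admissible_mult[where K = "2 * norm h"]) (auto intro: norm_phase_le)

lemma laplace_phase_mult:
  assumes "admissible w" "Im \<tau> > 0"
  shows "laplace (phase_mult h w) \<tau>
    = of_real (Re h) * laplace (phase_mult 1 w) \<tau> + of_real (Im h) * laplace (phase_mult \<i> w) \<tau>"
proof -
  have int: "integrable M (\<lambda>u. phase h u * w u * exp (phase \<tau> u))" for h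
    by (intro admissible_integrable_phase admissible_phase_mult assms)
  have "laplace (phase_mult h w) \<tau>
      = (LINT u|M. of_real (Re h) * (phase 1 u * w u * exp (phase \<tau> u))
          + of_real (Im h) * (phase \<i> u * w u * exp (phase \<tau> u)))"
    unfolding laplace_def by (subst phase_decompose) (simp add: algebra_simps)
  also have "\<dots> = of_real (Re h) * laplace (phase_mult 1 w) \<tau>
      + of_real (Im h) * laplace (phase_mult \<i> w) \<tau>"
    using int[of 1] int[of \<i>] by (simp add: laplace_def)
  finally show ?thesis .
qed

lemma norm_laplace_remainder_le:
  assumes "\<bar>Im h\<bar> \<le> Im \<tau> / 2"
  shows "norm (w u * exp (phase (\<tau> + h) u) - w u * exp (phase \<tau> u) - phase h u * w u * exp (phase \<tau> u))
    \<le> 4 * (norm h)\<^sup>2 * norm (of_real (c u) * (of_real (c u) * w u) * of_real (exp (- c u * (Im \<tau> / 2))))"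
proof -
  define y where "y = Im \<tau>"
  have "\<bar>Re (phase h u)\<bar> \<le> c u * (y / 2)"
    using mult_left_mono[OF assms c_nonneg[of u]] c_nonneg[of u] by (simp add: phase_def abs_mult y_def)
  then have "exp \<bar>Re (phase h u)\<bar> * (norm (phase h u))\<^sup>2 \<le> exp (c u * (y / 2)) * (2 * norm h * c u)\<^sup>2"
    by (intro mult_mono power_mono norm_phase_le) auto
  with norm_exp_minus_one_minus_le[of "phase h u"]
  have remainder: "norm (exp (phase h u) - (1 + phase h u)) \<le> exp (c u * (y / 2)) * (2 * norm h * c u)\<^sup>2"
    by linarith
  have "norm (w u * exp (phase (\<tau> + h) u) - w u * exp (phase \<tau> u) - phase h u * w u * exp (phase \<tau> u))
      = norm (w u * exp (phase \<tau> u) * (exp (phase h u) - (1 + phase h u)))"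
    by (simp add: phase_add exp_add algebra_simps)
  also have "\<dots> = norm (w u) * exp (- c u * y) * norm (exp (phase h u) - (1 + phase h u))"
    by (simp add: norm_mult phase_def y_def)
  also have "\<dots> \<le> norm (w u) * exp (- c u * y) * (exp (c u * (y / 2)) * (2 * norm h * c u)\<^sup>2)"
    by (intro mult_left_mono remainder) simp
  also have "\<dots> = norm (w u) * (exp (- c u * y) * exp (c u * (y / 2))) * (2 * norm h * c u)\<^sup>2"
    by (simp add: algebra_simps)
  also have "exp (- c u * y) * exp (c u * (y / 2)) = exp (- c u * (y / 2))"
    by (simp add: exp_add [symmetric])
  also have "norm (w u) * exp (- c u * (y / 2)) * (2 * norm h * c u)\<^sup>2
      = 4 * (norm h)\<^sup>2 * norm (of_real (c u) * (of_real (c u) * w u) * of_real (exp (- c u * (y / 2))))"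
    using c_nonneg[of u] by (simp add: norm_mult power2_eq_square)
  finally show ?thesis
    unfolding y_def .
qed

lemma has_derivative_laplace:
  assumes w: "admissible w" and \<tau>: "Im \<tau> > 0"
  shows "(laplace w has_derivative (\<lambda>h. laplace (phase_mult h w) \<tau>)) (at \<tau>)"
proof -
  let ?D = "\<lambda>h. laplace (phase_mult h w) \<tau>"
  let ?g = "\<lambda>u. norm (of_real (c u) * (of_real (c u) * w u) * of_real (exp (- c u * (Im \<tau> / 2))))"
  have linear: "bounded_linear ?D"
    by (subst ext[OF laplace_phase_mult[OF assms]])
      (intro bounded_linear_intros bounded_linear_compose[OF bounded_linear_of_real bounded_linear_Re]
        bounded_linear_compose[OF bounded_linear_of_real bounded_linear_Im])
  have "admissible (\<lambda>u. of_real (c u) * (of_real (c u) * w u))"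
    by (intro admissible_mult[where K = 1] w) (auto simp: c_nonneg)
  from admissible_integrable_exp[OF this half_gt_zero[OF \<tau>]]
  have int_g: "integrable M ?g"
    by (rule integrable_norm)
  have remainder: "norm (laplace w (\<tau> + h) - laplace w \<tau> - ?D h) \<le> 4 * (LINT u|M. ?g u) * (norm h)\<^sup>2"
    if "norm h < Im \<tau> / 2" for h
  proof -
    from that abs_Im_le_cmod[of h] have Im_h: "\<bar>Im h\<bar> \<le> Im \<tau> / 2"
      by linarith
    then have "Im (\<tau> + h) > 0"
      using \<tau> by (simp add: abs_le_iff)
    note ints = admissible_integrable_phase[OF w this] admissible_integrable_phase[OF w \<tau>]
      admissible_integrable_phase[OF admissible_phase_mult[OF w] \<tau>]
    let ?r = "\<lambda>u. w u * exp (phase (\<tau> + h) u) - w u * exp (phase \<tau> u) - phase h u * w u * exp (phase \<tau> u)"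
    have int_r: "integrable M ?r"
      by (rule Bochner_Integration.integrable_diff[OF Bochner_Integration.integrable_diff[OF ints(1,2)] ints(3)])
    have "norm (laplace w (\<tau> + h) - laplace w \<tau> - ?D h) = norm (LINT u|M. ?r u)"
      using ints by (simp add: laplace_def)
    also have "\<dots> \<le> (LINT u|M. norm (?r u))"
      by (rule integral_norm_bound)
    also have "\<dots> \<le> (LINT u|M. 4 * (norm h)\<^sup>2 * ?g u)"
      by (rule integral_mono[OF integrable_norm[OF int_r] integrable_mult_right[OF int_g]])
        (rule norm_laplace_remainder_le[OF Im_h])
    also have "\<dots> = 4 * (LINT u|M. ?g u) * (norm h)\<^sup>2"
      by simp
    finally show ?thesis .
  qed
  show ?thesis
    by (rule has_derivative_at_quadratic_remainder[OF linear half_gt_zero[OF \<tau>] remainder])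
qed

end

subsection \<open>Gaussian integrals\<close>

definition complex_gaussian :: "complex \<Rightarrow> complex \<Rightarrow> real \<Rightarrow> complex" where
  "complex_gaussian z \<beta> x = exp (of_real pi * (2 * \<beta> * of_real x - z * (of_real x)\<^sup>2))"

lemma measurable_complex_gaussian [measurable]: "complex_gaussian z \<beta> \<in> borel_measurable borel"
  unfolding complex_gaussian_def by measurable

lemma norm_complex_gaussian: "norm (complex_gaussian z \<beta> x) = exp (pi * (2 * Re \<beta> * x - Re z * x\<^sup>2))"
  by (simp add: complex_gaussian_def Re_power2)

lemma has_bochner_integral_std_normal_fourier:
  "has_bochner_integral lborel (\<lambda>x. std_normal_density x *\<^sub>R exp (\<i> * of_real (u * x))) (of_real (exp (- u\<^sup>2 / 2)))"
proof -
  let ?f = "\<lambda>x. std_normal_density x *\<^sub>R exp (\<i> * of_real (u * x))"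
  have "integrable lborel std_normal_density"
    using integrable_std_normal_moment[of 0] by simp
  then have "integrable lborel ?f"
  proof (rule Bochner_Integration.integrable_bound)
    show "AE x in lborel. norm (?f x) \<le> norm (std_normal_density x)"
      by (auto simp: norm_mult)
  qed measurable
  moreover have "char std_normal_distribution u = (LINT x|lborel. ?f x)"
    unfolding char_def by (subst integral_density) (auto simp: mult_ac)
  ultimately show ?thesis
    by (simp add: has_bochner_integral_iff char_std_normal_distribution)
qed

lemma has_bochner_integral_gaussian_fourier:
  assumes z: "z > 0"
  shows "has_bochner_integral lborel (complex_gaussian (of_real z) (\<i> * of_real y))
    (of_real (exp (- (pi * y\<^sup>2 / z)) / sqrt z))"
proof -
  define s where "s = sqrt (2 * pi * z)"
  define u where "u = 2 * pi * y / s"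
  have s: "s > 0" "s\<^sup>2 = 2 * pi * z" "s = sqrt (2 * pi) * sqrt z"
    using z unfolding s_def by (auto simp del: real_sqrt_mult intro: real_sqrt_mult)
  let ?f = "\<lambda>x. std_normal_density x *\<^sub>R exp (\<i> * of_real (u * x))"
  have "has_bochner_integral lborel (\<lambda>x. ?f (0 + s * x)) (of_real (exp (- u\<^sup>2 / 2)) /\<^sub>R \<bar>s\<bar>)"
    using s(1) has_bochner_integral_std_normal_fourier[of u] lborel_has_bochner_integral_real_affine_iff[of s ?f _ 0] by auto
  then have "has_bochner_integral lborel (\<lambda>x. of_real (sqrt (2 * pi)) * ?f (0 + s * x))
      (of_real (sqrt (2 * pi)) * (of_real (exp (- u\<^sup>2 / 2)) /\<^sub>R \<bar>s\<bar>))"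
    by (rule has_bochner_integral_mult_right)
  moreover have "of_real (sqrt (2 * pi)) * ?f (0 + s * x) = complex_gaussian (of_real z) (\<i> * of_real y) x" for x
  proof -
    have square: "(s * x)\<^sup>2 / 2 = pi * (z * x\<^sup>2)" and angle: "u * (0 + s * x) = 2 * pi * y * x"
      using s(1,2) by (simp_all add: power_mult_distrib u_def)
    have "?f (0 + s * x) = of_real (exp (- (pi * (z * x\<^sup>2))) / sqrt (2 * pi)) * exp (\<i> * of_real (2 * pi * y * x))"
      unfolding angle using square by (simp add: std_normal_density_def scaleR_conv_of_real)
    then show ?thesis
      by (simp add: complex_gaussian_def exp_of_real [symmetric] exp_add [symmetric] algebra_simps)
  qed
  moreover have "of_real (sqrt (2 * pi)) * (of_real (exp (- u\<^sup>2 / 2)) /\<^sub>R \<bar>s\<bar>)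
      = complex_of_real (exp (- (pi * y\<^sup>2 / z)) / sqrt z)"
  proof -
    have "u\<^sup>2 / 2 = pi * y\<^sup>2 / z"
      using s(1,2) z by (simp add: u_def power_divide power_mult_distrib power2_eq_square)
    then show ?thesis
      using s(3) z by (simp add: scaleR_conv_of_real field_simps)
  qed
  ultimately show ?thesis
    by (simp only:)
qed

lemma has_bochner_integral_gaussian_of_real:
  assumes z: "z > 0"
  shows "has_bochner_integral lborel (complex_gaussian (of_real z) \<beta>)
    (exp (of_real pi * \<beta>\<^sup>2 / of_real z) / csqrt (of_real z))"
proof -
  define b y where "b = Re \<beta>" and "y = Im \<beta>"
  define k where "k = exp (of_real (pi * (b\<^sup>2 / z)) + \<i> * of_real (2 * pi * y * b / z))"
  have \<beta>: "\<beta> = of_real b + \<i> * of_real y"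
    by (simp add: b_def y_def complex_eq_iff)
  have "complex_gaussian (of_real z) \<beta> (b / z + 1 * x) = k * complex_gaussian (of_real z) (\<i> * of_real y) x" for x
    unfolding complex_gaussian_def k_def \<beta> exp_add [symmetric]
    using z by (intro arg_cong[where f = exp]) (simp add: field_simps power2_eq_square)
  moreover have "has_bochner_integral lborel (\<lambda>x. k * complex_gaussian (of_real z) (\<i> * of_real y) x)
      (k * of_real (exp (- (pi * y\<^sup>2 / z)) / sqrt z))"
    by (intro has_bochner_integral_mult_right has_bochner_integral_gaussian_fourier z)
  ultimately have "has_bochner_integral lborel (complex_gaussian (of_real z) \<beta>)
      (k * of_real (exp (- (pi * y\<^sup>2 / z)) / sqrt z))"
    using lborel_has_bochner_integral_real_affine_iff[of 1 "complex_gaussian (of_real z) \<beta>" _ "b / z"] by simp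
  moreover have "k * of_real (exp (- (pi * y\<^sup>2 / z))) = exp (of_real pi * \<beta>\<^sup>2 / of_real z)"
    unfolding k_def \<beta> exp_of_real [symmetric] exp_add [symmetric]
    using z by (intro arg_cong[where f = exp]) (simp add: field_simps power2_eq_square)
  ultimately show ?thesis
    using z by simp
qed

lemma integrable_complex_gaussian:
  assumes "Re z > 0"
  shows "integrable lborel (complex_gaussian z \<beta>)"
proof (rule Bochner_Integration.integrable_bound)
  show "integrable lborel (complex_gaussian (of_real (Re z)) \<beta>)"
    using has_bochner_integral_gaussian_of_real[OF assms] by (simp add: has_bochner_integral_iff)
qed (auto simp: norm_complex_gaussian)

lemma holomorphic_eq_on_right_half_plane:
  assumes "f holomorphic_on {z. Re z > 0}" and "g holomorphic_on {z. Re z > 0}"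
    and "\<And>x. x > 0 \<Longrightarrow> f (of_real x) = g (of_real x)"
    and "Re z > 0"
  shows "f z = g z"
proof -
  have "f z - g z = 0"
  proof (rule analytic_continuation[of "\<lambda>z. f z - g z" "{z. Re z > 0}" "of_real ` {0<..}" 1])
    show "connected {z. Re z > 0}"
      by (intro convex_connected convex_halfspace_Re_gt)
    show "(1 :: complex) islimpt of_real ` {0<..}"
      unfolding islimpt_approachable
    proof (intro allI impI)
      fix e :: real
      assume "e > 0"
      then show "\<exists>w\<in>of_real ` {0<..}. w \<noteq> (1 :: complex) \<and> dist w 1 < e"
        by (intro bexI[of _ "of_real (1 + e / 2)"]) (auto simp: dist_norm intro!: image_eqI[of _ _ "1 + e / 2"])
    qed
  qed (use assms in \<open>auto intro!: holomorphic_intros open_halfspace_Re_gt\<close>)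
  then show ?thesis
    by simp
qed

interpretation gaussian: oscillating_laplace lborel "\<lambda>x. pi * x\<^sup>2" "\<lambda>x. pi * x\<^sup>2"
  by standard auto

lemma gaussian_phase: "gaussian.phase \<tau> x = \<i> * \<tau> * of_real (pi * x\<^sup>2)"
  by (simp add: gaussian.phase_def complex_eq_iff)

lemma complex_gaussian_eq_phase: "complex_gaussian z \<beta> x = complex_gaussian 0 \<beta> x * exp (gaussian.phase (\<i> * z) x)"
  by (simp add: complex_gaussian_def gaussian_phase exp_add [symmetric] algebra_simps)

lemma admissible_complex_gaussian: "gaussian.admissible (complex_gaussian 0 \<beta>)"
  unfolding gaussian.admissible_def
proof (intro conjI allI impI)
  fix y :: real
  assume "y > 0"
  then have "integrable lborel (complex_gaussian (of_real y) \<beta>)"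
    by (intro integrable_complex_gaussian) simp
  moreover have "exp (gaussian.phase (\<i> * of_real y) x) = of_real (exp (- (pi * x\<^sup>2) * y))" for x
    by (simp add: gaussian_phase exp_of_real [symmetric] mult_ac)
  ultimately show "integrable lborel (\<lambda>x. complex_gaussian 0 \<beta> x * of_real (exp (- (pi * x\<^sup>2) * y)))"
    by (simp add: complex_gaussian_eq_phase[of "of_real y"] cong: Bochner_Integration.integrable_cong)
qed simp

lemma holomorphic_integral_complex_gaussian:
  "(\<lambda>z. LINT x|lborel. complex_gaussian z \<beta> x) holomorphic_on {z. Re z > 0}"
proof -
  let ?w = "complex_gaussian 0 \<beta>"
  have "gaussian.laplace ?w holomorphic_on {\<tau>. Im \<tau> > 0}"
  proof (rule holomorphic_onI)
    fix \<tau> :: complex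
    assume "\<tau> \<in> {\<tau>. Im \<tau> > 0}"
    then have \<tau>: "Im \<tau> > 0"
      by simp
    have complex_linear: "(\<lambda>h. gaussian.laplace (gaussian.phase_mult h ?w) \<tau>)
        = (*) (gaussian.laplace (gaussian.phase_mult 1 ?w) \<tau>)"
    proof
      fix h
      have "gaussian.phase h x * ?w x * exp (gaussian.phase \<tau> x)
          = gaussian.phase 1 x * ?w x * exp (gaussian.phase \<tau> x) * h" for x
        by (simp add: gaussian_phase)
      then show "gaussian.laplace (gaussian.phase_mult h ?w) \<tau> = gaussian.laplace (gaussian.phase_mult 1 ?w) \<tau> * h"
        unfolding gaussian.laplace_def by (simp only: integral_mult_left_zero)
    qed
    have "(gaussian.laplace ?w has_field_derivative gaussian.laplace (gaussian.phase_mult 1 ?w) \<tau>) (at \<tau>)"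
      using gaussian.has_derivative_laplace[OF admissible_complex_gaussian \<tau>, of \<beta>]
      unfolding complex_linear has_field_derivative_def .
    then show "gaussian.laplace ?w field_differentiable at \<tau> within {\<tau>. Im \<tau> > 0}"
      using field_differentiable_at_within field_differentiable_def by blast
  qed
  then have "(gaussian.laplace ?w \<circ> (\<lambda>z. \<i> * z)) holomorphic_on {z. Re z > 0}"
    by (intro holomorphic_on_compose_gen holomorphic_intros) auto
  then show ?thesis
    by (simp add: o_def gaussian.laplace_def complex_gaussian_eq_phase [symmetric])
qed

lemma integral_complex_gaussian:
  assumes "Re z > 0"
  shows "(LINT x|lborel. complex_gaussian z \<beta> x) = exp (of_real pi * \<beta>\<^sup>2 / z) / csqrt z"
proof (rule holomorphic_eq_on_right_half_plane[OF holomorphic_integral_complex_gaussian _ _ assms])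
  show "(\<lambda>z. exp (of_real pi * \<beta>\<^sup>2 / z) / csqrt z) holomorphic_on {z. Re z > 0}"
    by (intro holomorphic_intros) (auto simp: complex_nonpos_Reals_iff)
  show "(LINT x|lborel. complex_gaussian (of_real r) \<beta> x) = exp (of_real pi * \<beta>\<^sup>2 / of_real r) / csqrt (of_real r)"
    if "r > 0" for r
    using has_bochner_integral_gaussian_of_real[OF that] by (simp add: has_bochner_integral_iff)
qed

subsection \<open>Fourier series\<close>

definition cis_2pi :: "real \<Rightarrow> complex" where
  "cis_2pi x = cis (2 * pi * x)"

lemma cis_2pi_add: "cis_2pi (x + y) = cis_2pi x * cis_2pi y"
  by (simp add: cis_2pi_def distrib_left cis_mult)

lemma cis_2pi_0 [simp]: "cis_2pi 0 = 1"
  by (simp add: cis_2pi_def)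

lemma norm_cis_2pi [simp]: "norm (cis_2pi x) = 1"
  by (simp add: cis_2pi_def)

lemma cis_2pi_conv_exp: "cis_2pi x = exp (\<i> * of_real (2 * pi * x))"
  by (simp add: cis_2pi_def cis_conv_exp)

lemma cis_2pi_eq_1_iff: "cis_2pi x = 1 \<longleftrightarrow> x \<in> \<int>"
proof
  assume "cis_2pi x = 1"
  then obtain n :: int where "2 * pi * x = of_int (2 * n) * pi"
    unfolding cis_2pi_conv_exp exp_eq_1 by auto
  then have "x = of_int n"
    by simp
  then show "x \<in> \<int>"
    by simp
next
  assume "x \<in> \<int>"
  then show "cis_2pi x = 1"
    by (auto simp: cis_2pi_def cis_multiple_2pi)
qed

lemma cis_2pi_Ints [simp]: "x \<in> \<int> \<Longrightarrow> cis_2pi x = 1"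
  by (simp add: cis_2pi_eq_1_iff)

lemma cis_2pi_cong: "x - y \<in> \<int> \<Longrightarrow> cis_2pi x = cis_2pi y"
  using cis_2pi_add[of "x - y" y] by simp

lemma continuous_on_cis_2pi [continuous_intros]:
  "continuous_on S f \<Longrightarrow> continuous_on S (\<lambda>x. cis_2pi (f x))"
  unfolding cis_2pi_def by (intro continuous_intros)

lemma measurable_cis_2pi [measurable]: "cis_2pi \<in> borel_measurable borel"
  by (intro borel_measurable_continuous_onI continuous_intros)

definition fourier_coefficient :: "(real \<Rightarrow> complex) \<Rightarrow> int \<Rightarrow> complex" where
  "fourier_coefficient h k = integral {0..1} (\<lambda>s. h s * cis_2pi (- of_int k * s))"

lemma fourier_coefficient_integrable:
  "continuous_on {0..1} h \<Longrightarrow> (\<lambda>s. h s * cis_2pi (- of_int k * s)) integrable_on {0..1}"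
  by (intro integrable_continuous_real continuous_intros)

lemma fourier_coefficient_add:
  assumes "continuous_on {0..1} f" "continuous_on {0..1} g"
  shows "fourier_coefficient (\<lambda>s. f s + g s) k = fourier_coefficient f k + fourier_coefficient g k"
  using assms unfolding fourier_coefficient_def distrib_right
  by (intro Henstock_Kurzweil_Integration.integral_add fourier_coefficient_integrable)

lemma fourier_coefficient_cmult:
  "fourier_coefficient (\<lambda>s. c * f s) k = c * fourier_coefficient f k"
  by (simp add: fourier_coefficient_def mult.assoc)

lemma fourier_coefficient_cis_2pi_mult:
  "fourier_coefficient (\<lambda>s. cis_2pi (of_int l * s) * f s) k = fourier_coefficient f (k - l)"
proof -
  have "cis_2pi (of_int l * s) * f s * cis_2pi (- of_int k * s) = f s * cis_2pi (- of_int (k - l) * s)" for s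
    using cis_2pi_add[of "of_int l * s" "- of_int k * s"] by (simp add: algebra_simps)
  then show ?thesis
    by (simp only: fourier_coefficient_def)
qed

lemma fourier_coefficient_1: "fourier_coefficient (\<lambda>_. 1) k = (if k = 0 then 1 else 0)"
proof (cases "k = 0")
  case False
  define c where "c = - (2 * pi * \<i> * of_int k)"
  have c: "c \<noteq> 0" "exp c = 1"
    unfolding exp_eq_1 using False by (auto simp: c_def intro!: exI[of _ "- k"])
  then have "((\<lambda>s. exp (c * of_real s)) has_integral exp (c * of_real 1) / c - exp (c * of_real 0) / c) {0..1}"
    by (intro fundamental_theorem_of_calculus)
      (auto intro!: derivative_eq_intros has_vector_derivative_real_field simp: field_simps)
  then show ?thesis
    using False c by (simp add: fourier_coefficient_def cis_2pi_conv_exp c_def mult_ac integral_unique)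
qed (simp add: fourier_coefficient_def)

definition fourier_null :: "(real \<Rightarrow> complex) \<Rightarrow> bool" where
  "fourier_null h \<longleftrightarrow> continuous_on {0..1} h \<and> (\<forall>k. fourier_coefficient h k = 0)"

lemma fourier_null_add: "fourier_null f \<Longrightarrow> fourier_null g \<Longrightarrow> fourier_null (\<lambda>s. f s + g s)"
  by (auto simp: fourier_null_def fourier_coefficient_add intro!: continuous_intros)

lemma fourier_null_cmult: "fourier_null f \<Longrightarrow> fourier_null (\<lambda>s. c * f s)"
  by (auto simp: fourier_null_def fourier_coefficient_cmult intro!: continuous_intros)

lemma fourier_null_cis_2pi_mult: "fourier_null f \<Longrightarrow> fourier_null (\<lambda>s. cis_2pi (of_int l * s) * f s)"
  by (auto simp: fourier_null_def fourier_coefficient_cis_2pi_mult intro!: continuous_intros)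

text \<open>Keeping \<open>f\<close> arbitrary makes the product case of the induction a composition.\<close>
lemma fourier_null_real_polynomial_mult:
  assumes "real_polynomial_function p" "fourier_null f"
  shows "fourier_null (\<lambda>s. of_real (p (cis_2pi s)) * f s)"
  using assms
proof (induction arbitrary: f)
  case (linear p)
  interpret bounded_linear p by fact
  define u v where "u = (of_real (p 1) - \<i> * of_real (p \<i>)) / 2" and "v = (of_real (p 1) + \<i> * of_real (p \<i>)) / 2"
  have p_eq: "p z = Re z * p 1 + Im z * p \<i>" for z
  proof -
    have "Re z *\<^sub>R 1 + Im z *\<^sub>R \<i> = z"
      by (simp add: complex_eq_iff)
    with add[of "Re z *\<^sub>R 1" "Im z *\<^sub>R \<i>"] show ?thesis
      by (simp only: scaleR real_scaleR_def)
  qed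
  have "u * cis_2pi (of_int 1 * s) + v * cis_2pi (of_int (- 1) * s) = of_real (p (cis_2pi s))" for s
    unfolding p_eq[of "cis_2pi s"] by (simp add: u_def v_def cis_2pi_def complex_eq_iff field_simps)
  then have "of_real (p (cis_2pi s)) * f s
      = u * (cis_2pi (of_int 1 * s) * f s) + v * (cis_2pi (of_int (- 1) * s) * f s)" for s
    by (simp only: distrib_right [symmetric] mult.assoc [symmetric])
  then show ?case
    using linear.prems by (simp only: fourier_null_add fourier_null_cmult fourier_null_cis_2pi_mult)
next
  case (const c)
  then show ?case
    by (intro fourier_null_cmult)
next
  case (add p q)
  then show ?case
    using fourier_null_add[OF add.IH(1) add.IH(2), of f f] by (simp add: distrib_right)
next
  case (mult p q)
  then show ?case
    using mult.IH(1)[OF mult.IH(2)[OF mult.prems]] by (simp add: mult.assoc)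
qed

lemma fourier_null_polynomial_mult:
  fixes g :: "complex \<Rightarrow> complex"
  assumes g: "polynomial_function g" and h: "fourier_null h"
  shows "fourier_null (\<lambda>s. h s * g (cis_2pi s))"
proof -
  have "real_polynomial_function (\<lambda>z. Re (g z))" "real_polynomial_function (\<lambda>z. Im (g z))"
    using g bounded_linear_Re bounded_linear_Im unfolding polynomial_function_def o_def by blast+
  then have "fourier_null (\<lambda>s. of_real (Re (g (cis_2pi s))) * h s + \<i> * (of_real (Im (g (cis_2pi s))) * h s))"
    by (intro fourier_null_add fourier_null_cmult fourier_null_real_polynomial_mult h)
  moreover have "of_real (Re (g (cis_2pi s))) * h s + \<i> * (of_real (Im (g (cis_2pi s))) * h s)
      = h s * g (cis_2pi s)" for s
    by (simp add: complex_eq_iff)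
  ultimately show ?thesis
    by (simp only:)
qed

lemma circle_polynomial_approximation:
  fixes h :: "real \<Rightarrow> complex"
  assumes cont: "continuous_on {0..1} h" and per: "h 0 = h 1" and "e > 0"
  obtains g where "polynomial_function g" "\<And>s. s \<in> {0..1} \<Longrightarrow> norm (h s - g (cis_2pi s)) < e"
proof -
  have "homotopic_loops UNIV h h"
    using per cont by (auto simp: homotopic_loops_refl path_def pathfinish_def pathstart_def)
  from homotopic_loops_imp_homotopic_circlemaps[OF this]
  have "continuous_on (sphere 0 1) (h \<circ> (\<lambda>z. Arg2pi z / (2 * pi)))"
    by (rule homotopic_with_imp_continuous[THEN conjunct1])
  from Stone_Weierstrass_polynomial_function[OF compact_sphere this \<open>e > 0\<close>]
  obtain g :: "complex \<Rightarrow> complex" where g: "polynomial_function g"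
    and approx: "\<And>z. z \<in> sphere 0 1 \<Longrightarrow> norm (h (Arg2pi z / (2 * pi)) - g z) < e"
    by auto
  have "norm (h s - g (cis_2pi s)) < e" if "s \<in> {0..1}" for s
  proof (cases "s = 1")
    case True
    have "Arg2pi 1 = 0"
      by (intro Arg2pi_unique[of 1]) auto
    with approx[of 1] per True show ?thesis
      by simp
  next
    case False
    then have "Arg2pi (cis_2pi s) = 2 * pi * s"
      using that by (intro Arg2pi_unique[of 1]) (auto simp: cis_2pi_conv_exp)
    with approx[of "cis_2pi s"] show ?thesis
      by simp
  qed
  with g show ?thesis
    by (rule that)
qed

lemma fourier_null_integral_cnj:
  assumes h: "fourier_null h" and per: "h 0 = h 1"
  shows "integral {0..1} (\<lambda>s. h s * cnj (h s)) = 0"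
proof -
  have cont: "continuous_on {0..1} h"
    using h by (simp add: fourier_null_def)
  then have "bounded (h ` {0..1})"
    by (intro compact_imp_bounded compact_continuous_image) auto
  then obtain B where "B > 0" and B: "\<And>s. s \<in> {0..1} \<Longrightarrow> norm (h s) \<le> B"
    unfolding bounded_pos by auto
  have "norm (integral {0..1} (\<lambda>s. h s * cnj (h s))) \<le> e" if "e > 0" for e
  proof -
    have "continuous_on {0..1} (\<lambda>s. cnj (h s))" "cnj (h 0) = cnj (h 1)"
      by (intro continuous_intros cont) (simp add: per)
    then obtain g where g: "polynomial_function g"
      and approx: "\<And>s. s \<in> {0..1} \<Longrightarrow> norm (cnj (h s) - g (cis_2pi s)) < e / B"
      by (rule circle_polynomial_approximation[where e = "e / B"]) (use \<open>e > 0\<close> \<open>B > 0\<close> in auto)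
    have "fourier_null (\<lambda>s. h s * g (cis_2pi s))"
      by (rule fourier_null_polynomial_mult[OF g h])
    then have g_cont: "continuous_on {0..1} (\<lambda>s. h s * g (cis_2pi s))"
      and g_null: "integral {0..1} (\<lambda>s. h s * g (cis_2pi s)) = 0"
      by (auto simp: fourier_null_def fourier_coefficient_def dest!: spec[of _ 0])
    have "integral {0..1} (\<lambda>s. h s * (cnj (h s) - g (cis_2pi s))) = integral {0..1} (\<lambda>s. h s * cnj (h s))"
      unfolding right_diff_distrib
      by (subst Henstock_Kurzweil_Integration.integral_diff)
        (auto simp: g_null intro!: integrable_continuous_real continuous_intros cont g_cont)
    moreover have "norm (integral {0..1} (\<lambda>s. h s * (cnj (h s) - g (cis_2pi s)))) \<le> e * (1 - 0)"
    proof (rule integral_bound)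
      show "continuous_on {0..1} (\<lambda>s. h s * (cnj (h s) - g (cis_2pi s)))"
        unfolding right_diff_distrib by (intro continuous_intros cont g_cont)
      show "norm (h s * (cnj (h s) - g (cis_2pi s))) \<le> e" if "s \<in> {0..1}" for s
        using mult_mono[OF B[OF that] less_imp_le[OF approx[OF that]]] \<open>B > 0\<close> by (simp add: norm_mult)
    qed simp
    ultimately show ?thesis
      by simp
  qed
  then have "norm (integral {0..1} (\<lambda>s. h s * cnj (h s))) \<le> 0"
    by (rule field_le_epsilon[where y = 0, simplified])
  then show ?thesis
    by simp
qed

lemma fourier_null_imp_zero:
  assumes h: "fourier_null h" and per: "h 0 = h 1" and s: "s \<in> {0..1}"
  shows "h s = 0"
proof -
  have cont: "continuous_on {0..1} (\<lambda>s. (norm (h s))\<^sup>2)"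
    using h unfolding fourier_null_def by (intro continuous_intros) auto
  then have has_integral: "((\<lambda>s. (norm (h s))\<^sup>2) has_integral integral {0..1} (\<lambda>s. (norm (h s))\<^sup>2)) {0..1}"
    by (intro integrable_integral integrable_continuous_real)
  then have "of_real (integral {0..1} (\<lambda>s. (norm (h s))\<^sup>2)) = integral {0..1} (\<lambda>s. complex_of_real ((norm (h s))\<^sup>2))"
    by (intro integral_unique [symmetric] has_integral_of_real)
  also have "\<dots> = 0"
    using fourier_null_integral_cnj[OF h per] by (simp only: complex_norm_square)
  finally have "((\<lambda>s. (norm (h s))\<^sup>2) has_integral 0) (cbox 0 1)"
    using has_integral by simp
  then have "(norm (h s))\<^sup>2 = 0"
    using s cont by (intro has_integral_0_cbox_imp_0[of 0 1 "\<lambda>s. (norm (h s))\<^sup>2"]) auto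
  then show ?thesis
    by simp
qed

subsection \<open>Poisson summation\<close>

lemma continuous_on_infsum_dominated:
  fixes f :: "'i \<Rightarrow> real \<Rightarrow> complex"
  assumes cont: "\<And>i. i \<in> I \<Longrightarrow> continuous_on {a..b} (f i)"
    and dominated: "\<And>i s. i \<in> I \<Longrightarrow> s \<in> {a..b} \<Longrightarrow> norm (f i s) \<le> M i" and M: "M summable_on I"
  shows "continuous_on {a..b} (\<lambda>s. \<Sum>\<^sub>\<infinity>i\<in>I. f i s)"
proof (rule uniform_limit_theorem)
  show "uniform_limit {a..b} (\<lambda>X s. \<Sum>i\<in>X. f i s) (\<lambda>s. \<Sum>\<^sub>\<infinity>i\<in>I. f i s) (finite_subsets_at_top I)"
    using dominated M by (rule Weierstrass_m_test_general)
  show "\<forall>\<^sub>F X in finite_subsets_at_top I. continuous_on {a..b} (\<lambda>s. \<Sum>i\<in>X. f i s)"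
    using cont by (intro eventually_finite_subsets_at_top_weakI continuous_intros) auto
qed simp

lemma has_sum_integral_dominated:
  fixes f :: "'i \<Rightarrow> real \<Rightarrow> complex"
  assumes cont: "\<And>i. i \<in> I \<Longrightarrow> continuous_on {a..b} (f i)"
    and dominated: "\<And>i s. i \<in> I \<Longrightarrow> s \<in> {a..b} \<Longrightarrow> norm (f i s) \<le> M i" and M: "M summable_on I"
  shows "((\<lambda>i. integral {a..b} (f i)) has_sum integral {a..b} (\<lambda>s. \<Sum>\<^sub>\<infinity>i\<in>I. f i s)) I"
proof -
  define F where "F = (\<lambda>X s. \<Sum>i\<in>X \<inter> I. f i s)"
  have partial: "(\<lambda>s. \<Sum>i\<in>X. f i s) = F X" if "X \<subseteq> I" for X
    using that by (simp add: F_def Int_absorb2)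
  have "uniform_limit {a..b} (\<lambda>X s. \<Sum>i\<in>X. f i s) (\<lambda>s. \<Sum>\<^sub>\<infinity>i\<in>I. f i s) (finite_subsets_at_top I)"
    using dominated M by (rule Weierstrass_m_test_general)
  then have "uniform_limit {a..b} F (\<lambda>s. \<Sum>\<^sub>\<infinity>i\<in>I. f i s) (finite_subsets_at_top I)"
    by (rule uniform_limit_cong[THEN iffD1, rotated 2])
      (auto intro!: eventually_finite_subsets_at_top_weakI simp: partial[THEN fun_cong, symmetric])
  moreover have "continuous_on {a..b} (F X)" for X
    unfolding F_def using cont by (intro continuous_intros) auto
  ultimately obtain K J where K: "\<And>X. (F X has_integral K X) {a..b}"
    and J: "((\<lambda>s. \<Sum>\<^sub>\<infinity>i\<in>I. f i s) has_integral J) {a..b}"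
    and lim: "(K \<longlongrightarrow> J) (finite_subsets_at_top I)"
    by (rule uniform_limit_integral) auto
  have "\<forall>\<^sub>F X in finite_subsets_at_top I. K X = (\<Sum>i\<in>X. integral {a..b} (f i))"
  proof (intro eventually_finite_subsets_at_top_weakI)
    fix X
    assume X: "finite X" "X \<subseteq> I"
    have "K X = integral {a..b} (\<lambda>s. \<Sum>i\<in>X. f i s)"
      using K[of X] X by (simp add: partial integral_unique)
    also have "\<dots> = (\<Sum>i\<in>X. integral {a..b} (f i))"
      using X cont by (intro Henstock_Kurzweil_Integration.integral_sum integrable_continuous_real) auto
    finally show "K X = (\<Sum>i\<in>X. integral {a..b} (f i))" .
  qed
  from Lim_transform_eventually[OF lim this] show ?thesis
    using J by (simp add: has_sum_def integral_unique)
qed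

lemma integral_symmetric_tendsto_lborel:
  fixes g :: "real \<Rightarrow> complex"
  assumes int: "integrable lborel g"
  shows "(\<lambda>N. integral {- real N..real N} g) \<longlonglongrightarrow> (LINT x|lborel. g x)"
proof -
  have [measurable]: "g \<in> borel_measurable lborel"
    using int by auto
  have "(\<lambda>N. LINT x|lborel. indicator {- real N..real N} x *\<^sub>R g x) \<longlonglongrightarrow> (LINT x|lborel. g x)"
  proof (rule integral_dominated_convergence[where w = "\<lambda>x. norm (g x)"])
    show "AE x in lborel. (\<lambda>N. indicator {- real N..real N} x *\<^sub>R g x) \<longlonglongrightarrow> g x"
    proof (rule AE_I2)
      fix x :: real
      have "\<forall>\<^sub>F N in sequentially. \<bar>x\<bar> \<le> real N"
        using filterlim_real_sequentially by (simp add: filterlim_at_top)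
      then show "(\<lambda>N. indicator {- real N..real N} x *\<^sub>R g x) \<longlonglongrightarrow> g x"
        by (intro tendsto_eventually) (auto elim: eventually_mono simp: abs_le_iff)
    qed
  qed (use int in \<open>auto split: split_indicator\<close>)
  moreover have "(LINT x|lborel. indicator {- real N..real N} x *\<^sub>R g x) = integral {- real N..real N} g" for N
  proof -
    have "set_integrable lborel {- real N..real N} g"
      unfolding set_integrable_def by (rule integrable_mult_indicator[OF _ int]) simp
    from set_borel_integral_eq_integral(2)[OF this] show ?thesis
      by (simp add: set_lebesgue_integral_def)
  qed
  ultimately show ?thesis
    by simp
qed

lemma filterlim_int_intervals_finite_subsets:
  "filterlim (\<lambda>N. {- int N..<int N}) (finite_subsets_at_top UNIV) sequentially"
  unfolding filterlim_finite_subsets_at_top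
proof (intro allI impI)
  fix X :: "int set"
  assume "finite X \<and> X \<subseteq> UNIV"
  then have "\<bar>x\<bar> \<le> Max (insert 0 (abs ` X))" if "x \<in> X" for x
    using that by (intro Max_ge) auto
  then have "X \<subseteq> {- int N..<int N}" if "N \<ge> nat (Max (insert 0 (abs ` X))) + 1" for N
    using that by fastforce
  then show "\<forall>\<^sub>F N in sequentially. finite {- int N..<int N} \<and> X \<subseteq> {- int N..<int N} \<and> {- int N..<int N} \<subseteq> UNIV"
    by (auto intro: eventually_sequentiallyI)
qed

lemma sum_integral_unit_intervals:
  fixes g :: "real \<Rightarrow> complex"
  assumes "continuous_on UNIV g"
  shows "(\<Sum>n\<in>{- int N..<int N}. integral {0..1} (\<lambda>s. g (of_int n + s))) = integral {- real N..real N} g"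
proof (induction N)
  case (Suc N)
  have int: "g integrable_on {a..b}" for a b
    using assms continuous_on_subset by (blast intro: integrable_continuous_real)
  have shift: "integral {0..1} (\<lambda>s. g (of_int n + s)) = integral {of_int n..of_int n + 1} g" for n :: int
  proof -
    have "(g has_integral integral {of_int n..of_int n + 1} g) (cbox (of_int n) (of_int n + 1))"
      using int by (simp add: integrable_integral)
    from has_integral_affinity'[OF this, of 1 "of_int n"] show ?thesis
      by (simp add: add.commute integral_unique)
  qed
  have "{- int (Suc N)..<int (Suc N)} = insert (int N) (insert (- int N - 1) {- int N..<int N})"
    by auto
  then have "(\<Sum>n\<in>{- int (Suc N)..<int (Suc N)}. integral {0..1} (\<lambda>s. g (of_int n + s)))
      = integral {real N..real N + 1} g + (integral {- real N - 1..- real N} g + integral {- real N..real N} g)"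
    using Suc by (simp add: shift)
  also have "integral {- real N - 1..- real N} g + integral {- real N..real N} g = integral {- real N - 1..real N} g"
    by (rule Henstock_Kurzweil_Integration.integral_combine) (auto intro: int)
  also have "integral {real N..real N + 1} g + integral {- real N - 1..real N} g = integral {- real N - 1..real N + 1} g"
    by (subst add.commute, rule Henstock_Kurzweil_Integration.integral_combine) (auto intro: int)
  also have "{- real N - 1..real N + 1} = {- real (Suc N)..real (Suc N)}"
    by (simp add: algebra_simps)
  finally show ?case .
qed simp

lemma integral_periodization:
  fixes g :: "real \<Rightarrow> complex"
  assumes cont: "continuous_on UNIV g" and int: "integrable lborel g"
    and dominated: "\<And>n s. s \<in> {0..1} \<Longrightarrow> norm (g (of_int n + s)) \<le> M n"
    and M: "M summable_on (UNIV :: int set)"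
  shows "integral {0..1} (\<lambda>s. \<Sum>\<^sub>\<infinity>n. g (of_int n + s)) = (LINT x|lborel. g x)"
proof (rule LIMSEQ_unique)
  have "((\<lambda>n. integral {0..1} (\<lambda>s. g (of_int n + s))) has_sum
      integral {0..1} (\<lambda>s. \<Sum>\<^sub>\<infinity>n. g (of_int n + s))) (UNIV :: int set)"
    by (rule has_sum_integral_dominated[where M = M])
      (use dominated M in \<open>auto intro!: continuous_intros continuous_on_compose2[OF cont]\<close>)
  from filterlim_compose[OF this[unfolded has_sum_def] filterlim_int_intervals_finite_subsets]
  show "(\<lambda>N. integral {- real N..real N} g) \<longlonglongrightarrow> integral {0..1} (\<lambda>s. \<Sum>\<^sub>\<infinity>n. g (of_int n + s))"
    unfolding sum_integral_unit_intervals[OF cont] .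
  show "(\<lambda>N. integral {- real N..real N} g) \<longlonglongrightarrow> (LINT x|lborel. g x)"
    by (rule integral_symmetric_tendsto_lborel[OF int])
qed

definition fourier_transform :: "(real \<Rightarrow> complex) \<Rightarrow> real \<Rightarrow> complex" where
  "fourier_transform g \<xi> = (LINT x|lborel. g x * cis_2pi (- \<xi> * x))"

lemma fourier_coefficient_periodization:
  assumes cont: "continuous_on UNIV g" and int: "integrable lborel g"
    and dominated: "\<And>n s. s \<in> {0..1} \<Longrightarrow> norm (g (of_int n + s)) \<le> M n"
    and M: "M summable_on (UNIV :: int set)"
  shows "fourier_coefficient (\<lambda>s. \<Sum>\<^sub>\<infinity>n::int. g (of_int n + s)) k = fourier_transform g (of_int k)"
proof -
  let ?g = "\<lambda>x. g x * cis_2pi (- of_int k * x)"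
  have "cis_2pi (- of_int k * (of_int n + s)) = cis_2pi (- of_int k * s)" for n s
    by (rule cis_2pi_cong) (simp add: algebra_simps)
  then have "fourier_coefficient (\<lambda>s. \<Sum>\<^sub>\<infinity>n::int. g (of_int n + s)) k
      = integral {0..1} (\<lambda>s. \<Sum>\<^sub>\<infinity>n::int. ?g (of_int n + s))"
    by (simp add: fourier_coefficient_def infsum_cmult_left')
  also have "\<dots> = (LINT x|lborel. ?g x)"
  proof (rule integral_periodization[OF _ _ _ M])
    show "continuous_on UNIV ?g"
      by (intro continuous_intros cont)
    have [measurable]: "g \<in> borel_measurable lborel"
      using int by auto
    show "integrable lborel ?g"
      by (rule Bochner_Integration.integrable_bound[OF int]) (auto simp: norm_mult)
    show "norm (?g (of_int n + s)) \<le> M n" if "s \<in> {0..1}" for n s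
      using dominated[OF that] by (simp add: norm_mult)
  qed
  finally show ?thesis
    by (simp only: fourier_transform_def)
qed

lemma fourier_coefficient_absolutely_summable_series:
  assumes a: "(\<lambda>l. norm (a l)) summable_on UNIV"
  shows "fourier_coefficient (\<lambda>s. \<Sum>\<^sub>\<infinity>l. a l * cis_2pi (of_int l * s)) k = a k"
proof -
  have "((\<lambda>l. integral {0..1} (\<lambda>s. a l * cis_2pi (of_int l * s) * cis_2pi (- of_int k * s)))
      has_sum integral {0..1} (\<lambda>s. \<Sum>\<^sub>\<infinity>l. a l * cis_2pi (of_int l * s) * cis_2pi (- of_int k * s))) UNIV"
    by (rule has_sum_integral_dominated[where M = "\<lambda>l. norm (a l)"])
      (auto intro!: continuous_intros a simp: norm_mult)
  moreover have "integral {0..1} (\<lambda>s. a l * cis_2pi (of_int l * s) * cis_2pi (- of_int k * s))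
      = (if l = k then a k else 0)" for l
    using fourier_coefficient_cmult[of "a l" "\<lambda>s. cis_2pi (of_int l * s) * 1" k]
      fourier_coefficient_cis_2pi_mult[of l "\<lambda>_. 1" k] fourier_coefficient_1[of "k - l"]
    by (auto simp: fourier_coefficient_def)
  ultimately have "((\<lambda>l. if l = k then a k else 0) has_sum
      integral {0..1} (\<lambda>s. \<Sum>\<^sub>\<infinity>l. a l * cis_2pi (of_int l * s) * cis_2pi (- of_int k * s))) UNIV"
    by (simp only:)
  moreover have "((\<lambda>l. if l = k then a k else 0) has_sum a k) UNIV"
    by (rule has_sum_finite_neutralI[of "{k}"]) auto
  ultimately have "integral {0..1} (\<lambda>s. \<Sum>\<^sub>\<infinity>l. a l * cis_2pi (of_int l * s) * cis_2pi (- of_int k * s)) = a k"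
    by (rule has_sum_unique)
  then show ?thesis
    by (simp only: fourier_coefficient_def infsum_cmult_left')
qed

lemma infsum_int_translate: "(\<Sum>\<^sub>\<infinity>n::int. g (n + k)) = (\<Sum>\<^sub>\<infinity>n. g n)"
proof -
  have "bij (\<lambda>n. n + k)"
    by (rule bij_betw_byWitness[of _ "\<lambda>n. n - k"]) auto
  then show ?thesis
    by (rule infsum_reindex_bij_betw)
qed

theorem poisson_summation:
  assumes cont: "continuous_on UNIV g" and int: "integrable lborel g"
    and dominated: "\<And>n s. s \<in> {0..1} \<Longrightarrow> norm (g (of_int n + s)) \<le> M n"
    and M: "M summable_on (UNIV :: int set)"
    and dual: "(\<lambda>k::int. norm (fourier_transform g (of_int k))) summable_on UNIV"
  shows "(\<Sum>\<^sub>\<infinity>n::int. g (of_int n)) = (\<Sum>\<^sub>\<infinity>k::int. fourier_transform g (of_int k))"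
proof -
  define f where "f = (\<lambda>s. \<Sum>\<^sub>\<infinity>n::int. g (of_int n + s))"
  define T where "T = (\<lambda>s. \<Sum>\<^sub>\<infinity>k::int. fourier_transform g (of_int k) * cis_2pi (of_int k * s))"
  have cont_f: "continuous_on {0..1} f"
    unfolding f_def
    by (rule continuous_on_infsum_dominated[OF _ dominated M])
      (auto intro!: continuous_intros continuous_on_compose2[OF cont])
  have cont_T: "continuous_on {0..1} T"
    unfolding T_def
    by (rule continuous_on_infsum_dominated[OF _ _ dual]) (auto intro!: continuous_intros simp: norm_mult)
  have "fourier_coefficient (\<lambda>s. f s + - 1 * T s) k = 0" for k
  proof -
    have "fourier_coefficient f k = fourier_transform g (of_int k)"
      unfolding f_def by (rule fourier_coefficient_periodization[OF cont int dominated M])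
    moreover have "fourier_coefficient T k = fourier_transform g (of_int k)"
      unfolding T_def by (rule fourier_coefficient_absolutely_summable_series[OF dual])
    ultimately show ?thesis
      by (subst fourier_coefficient_add[OF cont_f continuous_on_mult_left[OF cont_T]])
        (simp only: fourier_coefficient_cmult, simp)
  qed
  then have "fourier_null (\<lambda>s. f s + - 1 * T s)"
    unfolding fourier_null_def by (intro conjI continuous_intros cont_f cont_T) auto
  moreover have "f 1 = f 0"
    using infsum_int_translate[of "\<lambda>n. g (of_int n)" 1] by (simp add: f_def)
  moreover have "T 1 = T 0"
    by (simp add: T_def)
  ultimately have "f 0 + - 1 * T 0 = 0"
    by (intro fourier_null_imp_zero[of "\<lambda>s. f s + - 1 * T s"]) auto
  then show ?thesis
    by (simp add: f_def T_def)
qed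

lemma summable_on_int_split:
  fixes f :: "int \<Rightarrow> 'a :: banach"
  assumes "(\<lambda>n. f (int n)) summable_on UNIV" "(\<lambda>n. f (- 1 - int n)) summable_on UNIV"
  shows "f summable_on UNIV"
proof -
  have "f summable_on range int" "f summable_on range (\<lambda>n. - 1 - int n)"
    using assms by (auto simp: summable_on_reindex o_def inj_on_def)
  then have "f summable_on (range int \<union> range (\<lambda>n. - 1 - int n))"
    by (rule summable_on_Un_disjoint) auto
  moreover have "n \<in> range int \<union> range (\<lambda>n. - 1 - int n)" for n
    by (cases "n \<ge> 0") (auto intro: image_eqI[of _ _ "nat n"] image_eqI[of _ _ "nat (- 1 - n)"])
  then have "range int \<union> range (\<lambda>n. - 1 - int n) = UNIV"
    by blast
  ultimately show ?thesis
    by simp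
qed

lemma summable_gaussian_int:
  assumes "\<delta> > (0::real)"
  shows "(\<lambda>n::int. exp (- \<delta> * (of_int n)\<^sup>2)) summable_on UNIV"
proof (rule summable_on_int_split)
  have geometric: "(\<lambda>n. exp (- \<delta>) ^ n) summable_on UNIV"
    using assms by (subst summable_on_UNIV_nonneg_real_iff) (auto intro!: summable_geometric)
  have exp_le_power: "exp (- \<delta> * x\<^sup>2) \<le> exp (- \<delta>) ^ n" if "x\<^sup>2 \<ge> real n" for x n
    using that assms by (simp add: exp_of_nat2_mult [symmetric])
  have square: "real n \<le> (real n)\<^sup>2" for n
    by (cases n) (auto simp: power2_eq_square)
  have "real n \<le> (of_int (int n))\<^sup>2" for n
    using square by simp
  with exp_le_power show "(\<lambda>n. exp (- \<delta> * (of_int (int n))\<^sup>2)) summable_on UNIV"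
    by (intro summable_on_comparison_test[OF geometric]) auto
  have "(real_of_int (- 1 - int n))\<^sup>2 = (real n)\<^sup>2 + 2 * real n + 1" for n
    by (simp add: power2_eq_square algebra_simps)
  with square have "real n \<le> (of_int (- 1 - int n))\<^sup>2" for n
    by (metis add_increasing2 of_nat_0_le_iff mult_nonneg_nonneg zero_le_numeral zero_le_one)
  with exp_le_power show "(\<lambda>n. exp (- \<delta> * (of_int (- 1 - int n))\<^sup>2)) summable_on UNIV"
    by (intro summable_on_comparison_test[OF geometric]) auto
qed

lemma norm_gaussian_translate_le:
  assumes z: "Re z > 0" and \<beta>: "norm \<beta> \<le> R"
  shows "norm (exp (- of_real pi * z * (of_real x + \<beta>)\<^sup>2))
    \<le> exp (pi * (2 * (norm z * R)\<^sup>2 / Re z + norm z * R\<^sup>2)) * exp (- (pi * Re z / 2) * x\<^sup>2)"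
proof -
  define d q where "d = Re z" and "q = norm z * R"
  have "\<bar>Re (z * \<beta>)\<bar> \<le> q"
    using abs_Re_le_cmod[of "z * \<beta>"] mult_left_mono[OF \<beta> norm_ge_zero[of z]] by (simp add: norm_mult q_def)
  then have "\<bar>x * Re (z * \<beta>)\<bar> \<le> \<bar>x\<bar> * q"
    by (simp add: abs_mult mult_left_mono)
  moreover have "0 \<le> (d * \<bar>x\<bar> - 2 * q)\<^sup>2 / (2 * d)"
    using z by (simp add: d_def)
  then have "2 * (\<bar>x\<bar> * q) \<le> d / 2 * x\<^sup>2 + 2 * q\<^sup>2 / d"
    using z by (simp add: d_def power2_diff field_simps power2_eq_square)
  moreover have "\<bar>Re (z * \<beta>\<^sup>2)\<bar> \<le> norm z * R\<^sup>2"
    using abs_Re_le_cmod[of "z * \<beta>\<^sup>2"] mult_left_mono[OF power_mono[OF \<beta>, of 2] norm_ge_zero[of z]]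
    by (simp add: norm_mult norm_power)
  moreover have "Re (z * (of_real x + \<beta>)\<^sup>2) = d * x\<^sup>2 + 2 * (x * Re (z * \<beta>)) + Re (z * \<beta>\<^sup>2)"
    by (simp add: d_def power2_eq_square algebra_simps)
  ultimately have "- Re (z * (of_real x + \<beta>)\<^sup>2) \<le> (2 * q\<^sup>2 / d + norm z * R\<^sup>2) - d / 2 * x\<^sup>2"
    by linarith
  then have "pi * - Re (z * (of_real x + \<beta>)\<^sup>2) \<le> pi * ((2 * q\<^sup>2 / d + norm z * R\<^sup>2) - d / 2 * x\<^sup>2)"
    by (intro mult_left_mono) auto
  then show ?thesis
    by (simp add: norm_exp_eq_Re exp_add [symmetric] d_def q_def algebra_simps)
qed

lemma summable_gaussian_int_translate:
  assumes "Re z > 0"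
  shows "(\<lambda>n::int. norm (exp (- of_real pi * z * (of_int n + w)\<^sup>2))) summable_on UNIV"
proof (rule Infinite_Sum.abs_summable_on_comparison_test')
  show "(\<lambda>n::int. exp (pi * (2 * (norm z * norm w)\<^sup>2 / Re z + norm z * (norm w)\<^sup>2))
      * exp (- (pi * Re z / 2) * (of_int n)\<^sup>2)) summable_on UNIV"
    using assms by (intro summable_on_cmult_right summable_gaussian_int) auto
qed (use norm_gaussian_translate_le[OF assms order_refl, of "of_int _"] in simp)

lemma fourier_transform_gaussian_translate:
  assumes "Re z > 0"
  shows "fourier_transform (\<lambda>x. exp (- of_real pi * z * (of_real x + w)\<^sup>2)) \<xi>
    = exp (of_real pi * (2 * \<i> * of_real \<xi> * w - (of_real \<xi>)\<^sup>2 / z)) / csqrt z"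
proof -
  define \<beta> where "\<beta> = - (z * w + \<i> * of_real \<xi>)"
  have z: "z \<noteq> 0"
    using assms by auto
  have "exp (- of_real pi * z * (of_real x + w)\<^sup>2) * cis_2pi (- \<xi> * x)
      = exp (- of_real pi * z * w\<^sup>2) * complex_gaussian z \<beta> x" for x
    unfolding cis_2pi_conv_exp complex_gaussian_def exp_add [symmetric] \<beta>_def
    by (rule arg_cong[where f = exp]) (simp add: power2_eq_square algebra_simps)
  then have "fourier_transform (\<lambda>x. exp (- of_real pi * z * (of_real x + w)\<^sup>2)) \<xi>
      = exp (- of_real pi * z * w\<^sup>2) * exp (of_real pi * \<beta>\<^sup>2 / z) / csqrt z"
    by (simp add: fourier_transform_def integral_complex_gaussian[OF assms])
  also have "exp (- of_real pi * z * w\<^sup>2) * exp (of_real pi * \<beta>\<^sup>2 / z)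
      = exp (of_real pi * (2 * \<i> * of_real \<xi> * w - (of_real \<xi>)\<^sup>2 / z))"
    unfolding exp_add [symmetric] \<beta>_def using z
    by (intro arg_cong[where f = exp]) (simp add: power2_eq_square field_simps)
  finally show ?thesis .
qed

lemma integrable_gaussian_translate:
  assumes "Re z > 0"
  shows "integrable lborel (\<lambda>x. exp (- of_real pi * z * (of_real x + w)\<^sup>2))"
proof -
  have "exp (- of_real pi * z * (of_real x + w)\<^sup>2) = exp (- of_real pi * z * w\<^sup>2) * complex_gaussian z (- z * w) x" for x
    unfolding complex_gaussian_def exp_add [symmetric]
    by (rule arg_cong[where f = exp]) (simp add: power2_eq_square algebra_simps)
  then show ?thesis
    using integrable_complex_gaussian[OF assms] by simp
qed

lemma summable_fourier_transform_gaussian: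
  assumes z: "Re z > 0"
  shows "(\<lambda>k::int. norm (exp (of_real pi * (2 * \<i> * of_int k * w - (of_int k)\<^sup>2 / z)))) summable_on UNIV"
proof -
  have "z \<noteq> 0" "Re (1 / z) > 0"
    using z by (auto simp: Re_divide sum_power2_gt_zero_iff)
  then have "(\<lambda>k::int. norm (exp (- of_real pi * z * w\<^sup>2)) * norm (exp (- of_real pi * (1 / z) * (of_int k + - (\<i> * z * w))\<^sup>2)))
      summable_on UNIV"
    by (intro summable_on_cmult_right summable_gaussian_int_translate)
  moreover have "exp (of_real pi * (2 * \<i> * of_int k * w - (of_int k)\<^sup>2 / z))
      = exp (- of_real pi * z * w\<^sup>2) * exp (- of_real pi * (1 / z) * (of_int k + - (\<i> * z * w))\<^sup>2)" for k
    unfolding exp_add [symmetric] using \<open>z \<noteq> 0\<close>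
    by (intro arg_cong[where f = exp]) (simp add: power2_eq_square field_simps)
  ultimately show ?thesis
    by (simp only: norm_mult)
qed

theorem poisson_summation_gaussian:
  assumes z: "Re z > 0"
  shows "(\<Sum>\<^sub>\<infinity>n::int. exp (- of_real pi * z * (of_int n + w)\<^sup>2))
    = (\<Sum>\<^sub>\<infinity>k::int. exp (of_real pi * (2 * \<i> * of_int k * w - (of_int k)\<^sup>2 / z))) / csqrt z"
proof -
  define g where "g = (\<lambda>x::real. exp (- of_real pi * z * (of_real x + w)\<^sup>2))"
  have transform: "fourier_transform g \<xi> = exp (of_real pi * (2 * \<i> * of_real \<xi> * w - (of_real \<xi>)\<^sup>2 / z)) / csqrt z" for \<xi>
    unfolding g_def by (rule fourier_transform_gaussian_translate[OF z])
  have "(\<Sum>\<^sub>\<infinity>n::int. g (of_int n)) = (\<Sum>\<^sub>\<infinity>k::int. fourier_transform g (of_int k))"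
  proof (rule poisson_summation)
    show "continuous_on UNIV g"
      unfolding g_def by (intro continuous_intros)
    show "integrable lborel g"
      unfolding g_def by (rule integrable_gaussian_translate[OF z])
    let ?R = "norm w + 1"
    show "(\<lambda>n::int. exp (pi * (2 * (norm z * ?R)\<^sup>2 / Re z + norm z * ?R\<^sup>2)) * exp (- (pi * Re z / 2) * (of_int n)\<^sup>2))
        summable_on UNIV"
      using z by (intro summable_on_cmult_right summable_gaussian_int) auto
    show "norm (g (of_int n + s)) \<le> exp (pi * (2 * (norm z * ?R)\<^sup>2 / Re z + norm z * ?R\<^sup>2))
        * exp (- (pi * Re z / 2) * (of_int n)\<^sup>2)" if "s \<in> {0..1}" for n s
    proof -
      have "norm (of_real s + w) \<le> ?R"
        using norm_triangle_ineq[of "of_real s" w] that by simp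
      from norm_gaussian_translate_le[OF z this, of "of_int n"] show ?thesis
        by (simp add: g_def add.assoc)
    qed
    show "(\<lambda>k::int. norm (fourier_transform g (of_int k))) summable_on UNIV"
      using summable_on_cmult_left[OF summable_fourier_transform_gaussian[OF z, of w], of "inverse (norm (csqrt z))"]
      by (simp only: transform norm_mult divide_inverse norm_inverse of_real_of_int_eq)
  qed
  then show ?thesis
    unfolding transform by (simp add: g_def divide_inverse infsum_cmult_left')
qed

subsection \<open>Poisson summation for binary forms\<close>

definition of_int_pair :: "int \<times> int \<Rightarrow> real \<times> real" where
  "of_int_pair n = (of_int (fst n), of_int (snd n))"

lemma fst_of_int_pair [simp]: "fst (of_int_pair n) = of_int (fst n)"
  and snd_of_int_pair [simp]: "snd (of_int_pair n) = of_int (snd n)"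
  by (simp_all add: of_int_pair_def)

lemma norm2_pair: "(norm (v :: real \<times> real))\<^sup>2 = (fst v)\<^sup>2 + (snd v)\<^sup>2"
  by (simp add: norm_prod_def)

lemma summable_gaussian_int_pair:
  assumes "\<delta> > 0"
  shows "(\<lambda>n. exp (- \<delta> * (norm (of_int_pair n + w))\<^sup>2)) summable_on UNIV"
proof -
  have shift: "(\<lambda>n::int. exp (- \<delta> * (of_int n + x)\<^sup>2)) summable_on UNIV" for x :: real
  proof -
    have "- of_real pi * of_real (\<delta> / pi) * (of_int n + of_real x)\<^sup>2 = complex_of_real (- \<delta> * (of_int n + x)\<^sup>2)" for n :: int
      by simp
    then show ?thesis
      using summable_gaussian_int_translate[of "of_real (\<delta> / pi)" "of_real x"] assms
      by (simp only: norm_exp_eq_Re Re_complex_of_real) simp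
  qed
  let ?g = "\<lambda>n::int. exp (- \<delta> * (of_int n + fst w)\<^sup>2)" and ?h = "\<lambda>n::int. exp (- \<delta> * (of_int n + snd w)\<^sup>2)"
  have "(\<lambda>n. ?g (fst n) * ?h (snd n)) summable_on (UNIV \<times> UNIV)"
  proof (rule summable_on_SigmaI)
    show "((\<lambda>m. ?g (fst (n, m)) * ?h (snd (n, m))) has_sum (?g n * infsum ?h UNIV)) UNIV" for n
      using shift by (auto intro!: has_sum_cmult_right has_sum_infsum)
    show "(\<lambda>n. ?g n * infsum ?h UNIV) summable_on UNIV"
      using shift by (rule summable_on_cmult_left)
  qed auto
  then show ?thesis
    by (simp add: norm2_pair exp_add [symmetric] algebra_simps)
qed

lemma infsum_pair_iterated:
  fixes f :: "'a \<times> 'b \<Rightarrow> 'c::banach"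
  assumes "f summable_on UNIV"
  shows "infsum f UNIV = (\<Sum>\<^sub>\<infinity>x. \<Sum>\<^sub>\<infinity>y. f (x, y))" and "infsum f UNIV = (\<Sum>\<^sub>\<infinity>y. \<Sum>\<^sub>\<infinity>x. f (x, y))"
proof -
  show "infsum f UNIV = (\<Sum>\<^sub>\<infinity>x. \<Sum>\<^sub>\<infinity>y. f (x, y))"
    using infsum_Sigma_banach[of f UNIV "\<lambda>_. UNIV"] assms by simp
  also have "\<dots> = (\<Sum>\<^sub>\<infinity>y. \<Sum>\<^sub>\<infinity>x. f (x, y))"
    using infsum_swap_banach[of "\<lambda>x y. f (x, y)" UNIV UNIV] assms by simp
  finally show "infsum f UNIV = (\<Sum>\<^sub>\<infinity>y. \<Sum>\<^sub>\<infinity>x. f (x, y))" .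
qed

locale complex_binary_form =
  fixes z11 z12 z22 :: complex and \<epsilon> :: real
  assumes \<epsilon>_pos: "\<epsilon> > 0"
    and Re_form_ge': "\<And>x y. Re z11 * x\<^sup>2 + 2 * Re z12 * x * y + Re z22 * y\<^sup>2 \<ge> \<epsilon> * (x\<^sup>2 + y\<^sup>2)"
begin

definition form :: "real \<times> real \<Rightarrow> complex" where
  "form v = z11 * (of_real (fst v))\<^sup>2 + 2 * z12 * of_real (fst v) * of_real (snd v) + z22 * (of_real (snd v))\<^sup>2"

definition gram_det :: complex where
  "gram_det = z11 * z22 - z12\<^sup>2"

definition dual_form :: "real \<times> real \<Rightarrow> complex" where
  "dual_form v = (z22 * (of_real (fst v))\<^sup>2 - 2 * z12 * of_real (fst v) * of_real (snd v) + z11 * (of_real (snd v))\<^sup>2) / gram_det"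

text \<open>The exponent left after Fourier transform in the first variable only.\<close>
definition mixed_form :: "real \<times> real \<Rightarrow> complex" where
  "mixed_form v = (of_real (fst v))\<^sup>2 / z11 - 2 * \<i> * (z12 / z11) * of_real (fst v) * of_real (snd v)
    + gram_det / z11 * (of_real (snd v))\<^sup>2"

definition hermitian :: "complex \<Rightarrow> complex \<Rightarrow> complex" where
  "hermitian u v = cnj u * (z11 * u + z12 * v) + cnj v * (z12 * u + z22 * v)"

definition \<delta> :: real where
  "\<delta> = \<epsilon> / (2 * (norm z11)\<^sup>2 + 2 * (norm z12)\<^sup>2 + 2 * (norm z22)\<^sup>2 + 1)"

lemma \<delta>_pos: "\<delta> > 0"
  using \<epsilon>_pos by (simp add: \<delta>_def add_nonneg_pos)

lemma Re_form_ge: "Re (form v) \<ge> \<epsilon> * (norm v)\<^sup>2"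
  unfolding norm2_pair using Re_form_ge'[of "fst v" "snd v"]
  by (simp add: form_def power2_eq_square algebra_simps)

lemma Re_hermitian_ge: "\<epsilon> * ((norm u)\<^sup>2 + (norm v)\<^sup>2) \<le> Re (hermitian u v)"
proof -
  have "\<epsilon> * ((norm u)\<^sup>2 + (norm v)\<^sup>2) = \<epsilon> * ((Re u)\<^sup>2 + (Re v)\<^sup>2) + \<epsilon> * ((Im u)\<^sup>2 + (Im v)\<^sup>2)"
    by (simp add: cmod_power2 algebra_simps)
  also have "\<dots> \<le> (Re z11 * (Re u)\<^sup>2 + 2 * Re z12 * Re u * Re v + Re z22 * (Re v)\<^sup>2)
      + (Re z11 * (Im u)\<^sup>2 + 2 * Re z12 * Im u * Im v + Re z22 * (Im v)\<^sup>2)"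
    by (intro add_mono Re_form_ge')
  also have "\<dots> = Re (hermitian u v)"
    by (simp add: hermitian_def power2_eq_square algebra_simps)
  finally show ?thesis .
qed

lemma Re_hermitian_ge_image:
  "\<delta> * ((norm (z11 * u + z12 * v))\<^sup>2 + (norm (z12 * u + z22 * v))\<^sup>2 + (norm v)\<^sup>2) \<le> Re (hermitian u v)"
proof -
  define B where "B = 2 * (norm z11)\<^sup>2 + 2 * (norm z12)\<^sup>2 + 2 * (norm z22)\<^sup>2 + 1"
  have "B > 0"
    by (simp add: B_def add_nonneg_pos)
  have "(norm (x * u + y * v))\<^sup>2 \<le> 2 * (norm x)\<^sup>2 * (norm u)\<^sup>2 + 2 * (norm y)\<^sup>2 * (norm v)\<^sup>2" for x y
  proof -
    have "(norm (x * u + y * v))\<^sup>2 \<le> (norm x * norm u + norm y * norm v)\<^sup>2"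
      using norm_triangle_ineq[of "x * u" "y * v"] by (intro power_mono) (auto simp: norm_mult)
    also have "\<dots> \<le> 2 * (norm x * norm u)\<^sup>2 + 2 * (norm y * norm v)\<^sup>2"
      using sum_squares_bound[of "norm x * norm u" "norm y * norm v"] by (simp add: power2_sum)
    finally show ?thesis
      by (simp add: power_mult_distrib)
  qed
  from this[of z11 z12] this[of z12 z22]
  have "(norm (z11 * u + z12 * v))\<^sup>2 + (norm (z12 * u + z22 * v))\<^sup>2 + (norm v)\<^sup>2 \<le> B * ((norm u)\<^sup>2 + (norm v)\<^sup>2)"
    using mult_nonneg_nonneg[OF zero_le_power2[of "norm z11"] zero_le_power2[of "norm v"]]
      mult_nonneg_nonneg[OF zero_le_power2[of "norm z22"] zero_le_power2[of "norm u"]]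
      zero_le_power2[of "norm u"]
    unfolding B_def distrib_left distrib_right by linarith
  then have "\<delta> * ((norm (z11 * u + z12 * v))\<^sup>2 + (norm (z12 * u + z22 * v))\<^sup>2 + (norm v)\<^sup>2)
      \<le> \<delta> * (B * ((norm u)\<^sup>2 + (norm v)\<^sup>2))"
    using \<delta>_pos by (intro mult_left_mono) auto
  also have "\<dots> = \<epsilon> * ((norm u)\<^sup>2 + (norm v)\<^sup>2)"
    using \<open>B > 0\<close> by (simp add: \<delta>_def B_def)
  finally show ?thesis
    using Re_hermitian_ge by (rule order_trans)
qed

lemma Re_z11_pos: "Re z11 > 0"
  using Re_form_ge'[of 1 0] \<epsilon>_pos by simp

lemma z11_nonzero: "z11 \<noteq> 0"
  using Re_z11_pos by auto

lemma Re_schur_complement_pos: "Re (gram_det / z11) > 0"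
proof -
  have "\<epsilon> * ((norm (- z12 / z11))\<^sup>2 + (norm (1::complex))\<^sup>2) > 0"
    using \<epsilon>_pos by (intro mult_pos_pos add_nonneg_pos) auto
  also have "\<dots> \<le> Re (hermitian (- z12 / z11) 1)"
    by (rule Re_hermitian_ge)
  also have "hermitian (- z12 / z11) 1 = gram_det / z11"
    using z11_nonzero by (simp add: hermitian_def gram_det_def field_simps power2_eq_square)
  finally show ?thesis .
qed

lemma gram_det_nonzero: "gram_det \<noteq> 0"
  using Re_schur_complement_pos by auto

lemma form_complete_square:
  "form v = z11 * (of_real (fst v) + z12 / z11 * of_real (snd v))\<^sup>2 + gram_det / z11 * (of_real (snd v))\<^sup>2"
  using z11_nonzero by (simp add: form_def gram_det_def field_simps power2_eq_square)

lemma mixed_form_complete_square: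
  "mixed_form v = gram_det / z11 * (of_real (snd v) - \<i> * of_real (fst v) * (z12 / gram_det))\<^sup>2 + z22 / gram_det * (of_real (fst v))\<^sup>2"
proof -
  define k y where "k = complex_of_real (fst v)" and "y = complex_of_real (snd v)"
  have "gram_det / z11 * (z12 / gram_det) = z12 / z11"
    using gram_det_nonzero by simp
  moreover have "z22 / gram_det - gram_det / z11 * (z12 / gram_det)\<^sup>2 = 1 / z11"
    using z11_nonzero gram_det_nonzero by (simp add: field_simps power2_eq_square) (simp add: gram_det_def power2_eq_square algebra_simps)
  moreover have "gram_det / z11 * (y - \<i> * k * (z12 / gram_det))\<^sup>2 + z22 / gram_det * k\<^sup>2
      = k\<^sup>2 * (z22 / gram_det - gram_det / z11 * (z12 / gram_det)\<^sup>2) - 2 * \<i> * (gram_det / z11 * (z12 / gram_det)) * k * y + gram_det / z11 * y\<^sup>2"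
    by (simp add: power2_eq_square algebra_simps)
  ultimately show ?thesis
    by (simp only: mixed_form_def k_def [symmetric] y_def [symmetric] mult_1_right times_divide_eq_right)
qed

lemma Re_mixed_form_ge: "Re (mixed_form v) \<ge> \<delta> * (norm v)\<^sup>2"
proof -
  define k y where "k = complex_of_real (fst v)" and "y = complex_of_real (snd v)"
  define u where "u = - \<i> * k / z11 - z12 / z11 * y"
  have first: "z11 * u + z12 * y = - \<i> * k"
    using z11_nonzero by (simp add: u_def right_diff_distrib)
  have second: "z12 * u + z22 * y = - \<i> * k * (z12 / z11) + gram_det / z11 * y"
    using z11_nonzero by (simp add: u_def gram_det_def field_simps power2_eq_square)
  have "Re (hermitian u y) = Re (cnj u * (- \<i> * k)) + Re (y * (- \<i> * k * (z12 / z11) + gram_det / z11 * y))"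
    unfolding hermitian_def first second by (simp add: y_def)
  also have "Re (cnj u * (- \<i> * k)) = Re (u * (\<i> * k))"
    by (simp add: k_def)
  also have "Re (u * (\<i> * k)) + Re (y * (- \<i> * k * (z12 / z11) + gram_det / z11 * y)) = Re (mixed_form v)"
    unfolding plus_complex.sel(1) [symmetric] mixed_form_def u_def k_def [symmetric] y_def [symmetric]
    by (rule arg_cong[where f = Re]) (simp add: power2_eq_square algebra_simps)
  finally have "Re (hermitian u y) = Re (mixed_form v)" .
  moreover have "\<delta> * (norm v)\<^sup>2 \<le> \<delta> * ((norm (z11 * u + z12 * y))\<^sup>2 + (norm (z12 * u + z22 * y))\<^sup>2 + (norm y)\<^sup>2)"
    unfolding first using \<delta>_pos by (intro mult_left_mono) (auto simp: norm2_pair norm_mult k_def y_def)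
  ultimately show ?thesis
    using Re_hermitian_ge_image[of u y] by linarith
qed

lemma Re_dual_form_ge: "Re (dual_form v) \<ge> \<delta> * (norm v)\<^sup>2"
proof -
  define k l where "k = complex_of_real (fst v)" and "l = complex_of_real (snd v)"
  define u w where "u = (z22 * k - z12 * l) / gram_det" and "w = (z11 * l - z12 * k) / gram_det"
  have "z11 * u + z12 * w = gram_det * k / gram_det" "z12 * u + z22 * w = gram_det * l / gram_det"
    unfolding u_def w_def times_divide_eq_right add_divide_distrib [symmetric]
    by (simp_all add: gram_det_def power2_eq_square algebra_simps)
  then have image: "z11 * u + z12 * w = k" "z12 * u + z22 * w = l"
    using gram_det_nonzero by simp_all
  have "Re (hermitian u w) = Re (k * u + l * w)"
    unfolding hermitian_def image by (simp add: k_def l_def)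
  also have "k * u + l * w = dual_form v"
    by (simp add: u_def w_def dual_form_def k_def l_def power2_eq_square diff_divide_distrib add_divide_distrib algebra_simps)
  finally have "Re (hermitian u w) = Re (dual_form v)" .
  moreover have "\<delta> * (norm v)\<^sup>2 \<le> \<delta> * ((norm (z11 * u + z12 * w))\<^sup>2 + (norm (z12 * u + z22 * w))\<^sup>2 + (norm w)\<^sup>2)"
    unfolding image using \<delta>_pos by (intro mult_left_mono) (auto simp: norm2_pair k_def l_def)
  ultimately show ?thesis
    using Re_hermitian_ge_image[of u w] by linarith
qed

lemma summable_exp_of_Re_ge:
  assumes "e > 0" and "\<And>v. Re (f v) \<ge> e * (norm v)\<^sup>2"
  shows "(\<lambda>n. exp (- of_real pi * f (of_int_pair n + w) + \<i> * of_real (\<phi> n))) summable_on UNIV"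
proof (rule abs_summable_summable[OF Infinite_Sum.abs_summable_on_comparison_test'])
  show "(\<lambda>n. exp (- (pi * e) * (norm (of_int_pair n + w))\<^sup>2)) summable_on UNIV"
    using assms(1) by (intro summable_gaussian_int_pair) simp
  show "norm (exp (- of_real pi * f (of_int_pair n + w) + \<i> * of_real (\<phi> n)))
      \<le> exp (- (pi * e) * (norm (of_int_pair n + w))\<^sup>2)" for n
    using assms(2)[of "of_int_pair n + w"] by (simp add: norm_exp_eq_Re mult.assoc)
qed

lemma poisson_first_variable:
  "(\<Sum>\<^sub>\<infinity>n::int. exp (- of_real pi * form (of_int n + x, y)))
    = (\<Sum>\<^sub>\<infinity>k::int. exp (- of_real pi * mixed_form (of_int k, y) + \<i> * of_real (2 * pi * (of_int k * x)))) / csqrt z11"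
proof -
  define E where "E = exp (- of_real pi * (gram_det / z11 * (of_real y)\<^sup>2))"
  define w where "w = of_real x + z12 / z11 * of_real y"
  have primal: "exp (- of_real pi * form (of_int n + x, y)) = exp (- of_real pi * z11 * (of_int n + w)\<^sup>2) * E" for n :: int
    unfolding form_complete_square E_def w_def exp_add [symmetric]
    by (rule arg_cong[where f = exp]) (simp add: algebra_simps)
  have dual: "exp (of_real pi * (2 * \<i> * of_int k * w - (of_int k)\<^sup>2 / z11)) * E
      = exp (- of_real pi * mixed_form (of_int k, y) + \<i> * of_real (2 * pi * (of_int k * x)))" for k :: int
    unfolding mixed_form_def E_def w_def exp_add [symmetric]
    by (rule arg_cong[where f = exp]) (simp add: algebra_simps)
  have "(\<Sum>\<^sub>\<infinity>n::int. exp (- of_real pi * form (of_int n + x, y)))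
      = (\<Sum>\<^sub>\<infinity>k::int. exp (of_real pi * (2 * \<i> * of_int k * w - (of_int k)\<^sup>2 / z11))) / csqrt z11 * E"
    by (simp only: primal infsum_cmult_left' poisson_summation_gaussian[OF Re_z11_pos])
  also have "\<dots> = (\<Sum>\<^sub>\<infinity>k::int. exp (of_real pi * (2 * \<i> * of_int k * w - (of_int k)\<^sup>2 / z11)) * E) / csqrt z11"
    by (simp add: infsum_cmult_left')
  finally show ?thesis
    by (simp only: dual)
qed

lemma poisson_second_variable:
  "(\<Sum>\<^sub>\<infinity>m::int. exp (- of_real pi * mixed_form (x, of_int m + y) + \<i> * of_real \<phi>))
    = (\<Sum>\<^sub>\<infinity>l::int. exp (- of_real pi * dual_form (x, of_int l) + \<i> * of_real (\<phi> + 2 * pi * (of_int l * y))))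
      / csqrt (gram_det / z11)"
proof -
  define E where "E = exp (- of_real pi * (z22 / gram_det * (of_real x)\<^sup>2) + \<i> * of_real \<phi>)"
  define w where "w = of_real y - \<i> * of_real x * (z12 / gram_det)"
  have primal: "exp (- of_real pi * mixed_form (x, of_int m + y) + \<i> * of_real \<phi>)
      = exp (- of_real pi * (gram_det / z11) * (of_int m + w)\<^sup>2) * E" for m :: int
    unfolding mixed_form_complete_square E_def w_def exp_add [symmetric]
    by (rule arg_cong[where f = exp]) (simp add: algebra_simps)
  have expand: "dual_form (x, of_int l)
      = z22 / gram_det * (of_real x)\<^sup>2 - 2 * (z12 / gram_det) * of_real x * of_int l + (of_int l)\<^sup>2 / (gram_det / z11)" for l :: int
    by (simp add: dual_form_def add_divide_distrib diff_divide_distrib)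
  have dual: "exp (of_real pi * (2 * \<i> * of_int l * w - (of_int l)\<^sup>2 / (gram_det / z11))) * E
      = exp (- of_real pi * dual_form (x, of_int l) + \<i> * of_real (\<phi> + 2 * pi * (of_int l * y)))" for l :: int
    unfolding expand E_def w_def exp_add [symmetric]
    by (intro arg_cong[where f = exp]) (simp add: algebra_simps)
  have "(\<Sum>\<^sub>\<infinity>m::int. exp (- of_real pi * mixed_form (x, of_int m + y) + \<i> * of_real \<phi>))
      = (\<Sum>\<^sub>\<infinity>l::int. exp (of_real pi * (2 * \<i> * of_int l * w - (of_int l)\<^sup>2 / (gram_det / z11)))) / csqrt (gram_det / z11) * E"
    by (simp only: primal infsum_cmult_left' poisson_summation_gaussian[OF Re_schur_complement_pos])
  also have "\<dots> = (\<Sum>\<^sub>\<infinity>l::int. exp (of_real pi * (2 * \<i> * of_int l * w - (of_int l)\<^sup>2 / (gram_det / z11))) * E) / csqrt (gram_det / z11)"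
    by (simp add: infsum_cmult_left')
  finally show ?thesis
    by (simp only: dual)
qed

theorem poisson_summation_form:
  "(\<Sum>\<^sub>\<infinity>n. exp (- of_real pi * form (of_int_pair n + w)))
    = (\<Sum>\<^sub>\<infinity>k. exp (- of_real pi * dual_form (of_int_pair k) + \<i> * of_real (2 * pi * (of_int_pair k \<bullet> w))))
      / (csqrt z11 * csqrt (gram_det / z11))"
proof -
  define F where "F = (\<lambda>n. exp (- of_real pi * form (of_int_pair n + w)))"
  define G where "G = (\<lambda>k. exp (- of_real pi * mixed_form (of_int_pair k + (0, snd w)) + \<i> * of_real (2 * pi * (of_int (fst k) * fst w))))"
  define H where "H = (\<lambda>k. exp (- of_real pi * dual_form (of_int_pair k + 0) + \<i> * of_real (2 * pi * (of_int_pair k \<bullet> w))))"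
  have F: "F summable_on UNIV"
    using summable_exp_of_Re_ge[OF \<epsilon>_pos Re_form_ge, of w "\<lambda>_. 0"] by (simp add: F_def)
  have G: "G summable_on UNIV"
    unfolding G_def by (rule summable_exp_of_Re_ge[OF \<delta>_pos Re_mixed_form_ge])
  have H: "H summable_on UNIV"
    unfolding H_def by (rule summable_exp_of_Re_ge[OF \<delta>_pos Re_dual_form_ge])
  have first: "(\<Sum>\<^sub>\<infinity>n. F (n, m)) = (\<Sum>\<^sub>\<infinity>k. G (k, m)) / csqrt z11" for m
    using poisson_first_variable[of "fst w" "of_int m + snd w"]
    by (cases w) (simp add: F_def G_def of_int_pair_def)
  have second: "(\<Sum>\<^sub>\<infinity>m. G (k, m)) = (\<Sum>\<^sub>\<infinity>l. H (k, l)) / csqrt (gram_det / z11)" for k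
    using poisson_second_variable[of "of_int k" "snd w" "2 * pi * (of_int k * fst w)"]
    by (cases w) (simp add: G_def H_def of_int_pair_def distrib_left)
  have "infsum F UNIV = (\<Sum>\<^sub>\<infinity>m. \<Sum>\<^sub>\<infinity>k. G (k, m)) / csqrt z11"
    unfolding infsum_pair_iterated(2)[OF F] first by (simp add: divide_inverse infsum_cmult_left')
  also have "(\<Sum>\<^sub>\<infinity>m. \<Sum>\<^sub>\<infinity>k. G (k, m)) = (\<Sum>\<^sub>\<infinity>k. \<Sum>\<^sub>\<infinity>m. G (k, m))"
    using infsum_pair_iterated[OF G] by simp
  also have "\<dots> = infsum H UNIV / csqrt (gram_det / z11)"
    unfolding infsum_pair_iterated(1)[OF H] second by (simp add: divide_inverse infsum_cmult_left')
  finally show ?thesis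
    by (simp add: F_def H_def mult.commute)
qed

end

subsection \<open>Periodic functions on the integer lattice\<close>

definition int_scale :: "int \<Rightarrow> int \<times> int \<Rightarrow> int \<times> int" (infixr "*\<^sub>Z" 75) where
  "k *\<^sub>Z n = (k * fst n, k * snd n)"

definition int_dot :: "int \<times> int \<Rightarrow> int \<times> int \<Rightarrow> int" (infixl "\<bullet>\<^sub>Z" 70) where
  "m \<bullet>\<^sub>Z n = fst m * fst n + snd m * snd n"

lemma fst_int_scale [simp]: "fst (k *\<^sub>Z n) = k * fst n"
  and snd_int_scale [simp]: "snd (k *\<^sub>Z n) = k * snd n"
  by (simp_all add: int_scale_def)

lemma int_scale_scale: "j *\<^sub>Z k *\<^sub>Z n = (j * k) *\<^sub>Z n"
  by (simp add: prod_eq_iff)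

lemma int_scale_cancel: "k \<noteq> 0 \<Longrightarrow> k *\<^sub>Z m = k *\<^sub>Z n \<longleftrightarrow> m = n"
  by (simp add: prod_eq_iff)

lemma of_int_pair_add: "of_int_pair (m + n) = of_int_pair m + of_int_pair n"
  by (simp add: prod_eq_iff)

lemma of_int_pair_scale: "of_int_pair (k *\<^sub>Z n) = of_int k *\<^sub>R of_int_pair n"
  by (simp add: prod_eq_iff)

lemma inner_of_int_pair: "of_int_pair m \<bullet> of_int_pair n = of_int (m \<bullet>\<^sub>Z n)"
  by (simp add: of_int_pair_def int_dot_def)

lemma int_dot_commute: "m \<bullet>\<^sub>Z n = n \<bullet>\<^sub>Z m"
  by (simp add: int_dot_def mult.commute)

lemma int_dot_add: "k \<bullet>\<^sub>Z (m + n) = k \<bullet>\<^sub>Z m + k \<bullet>\<^sub>Z n" "(m + n) \<bullet>\<^sub>Z k = m \<bullet>\<^sub>Z k + n \<bullet>\<^sub>Z k"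
  by (simp_all add: int_dot_def algebra_simps)

lemma int_dot_scale: "m \<bullet>\<^sub>Z (k *\<^sub>Z n) = k * (m \<bullet>\<^sub>Z n)" "(k *\<^sub>Z m) \<bullet>\<^sub>Z n = k * (m \<bullet>\<^sub>Z n)"
  by (simp_all add: int_dot_def algebra_simps)

definition periodic :: "int \<Rightarrow> (int \<times> int \<Rightarrow> 'a) \<Rightarrow> bool" where
  "periodic K f \<longleftrightarrow> (\<forall>n k. f (n + K *\<^sub>Z k) = f n)"

lemma periodicD: "periodic K f \<Longrightarrow> f (n + K *\<^sub>Z k) = f n"
  unfolding periodic_def by blast

lemma periodic_dvd: "periodic K f \<Longrightarrow> K dvd K' \<Longrightarrow> periodic K' f"
  unfolding periodic_def dvd_def by (metis int_scale_scale)

lemma periodic_translate: "periodic K f \<Longrightarrow> periodic K (\<lambda>n. f (n + s))"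
  using periodicD[of K f "_ + s"] by (simp add: periodic_def ac_simps)

definition residue_box :: "int \<Rightarrow> (int \<times> int) set" where
  "residue_box K = {0..<\<bar>K\<bar>} \<times> {0..<\<bar>K\<bar>}"

definition residue :: "int \<Rightarrow> int \<times> int \<Rightarrow> int \<times> int" where
  "residue K n = (fst n mod \<bar>K\<bar>, snd n mod \<bar>K\<bar>)"

lemma finite_residue_box [simp]: "finite (residue_box K)"
  by (simp add: residue_box_def)

lemma residue_in_box: "K \<noteq> 0 \<Longrightarrow> residue K n \<in> residue_box K"
  by (simp add: residue_def residue_box_def)

lemma residue_of_box: "n \<in> residue_box K \<Longrightarrow> residue K n = n"
  by (auto simp: residue_def residue_box_def)

lemma residue_residue_add: "residue K (residue K m + n) = residue K (m + n)"
  by (simp add: residue_def mod_add_left_eq)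

lemma mod_abs_add_mult [simp]: "(x + K * y) mod \<bar>K\<bar> = x mod \<bar>K\<bar>" for K x y :: int
  by (simp add: mod_eq_dvd_iff)

lemma residue_add_scale: "residue K (n + K *\<^sub>Z k) = residue K n"
  by (simp add: residue_def)

lemma residue_decompose:
  obtains k where "n = residue K n + K *\<^sub>Z k"
proof
  have "x = x mod \<bar>K\<bar> + K * (sgn K * (x div \<bar>K\<bar>))" for x
    by (simp add: mult.assoc [symmetric] abs_sgn [symmetric])
  then show "n = residue K n + K *\<^sub>Z (sgn K * (fst n div \<bar>K\<bar>), sgn K * (snd n div \<bar>K\<bar>))"
    by (simp add: residue_def prod_eq_iff)
qed

lemma periodic_residue: "periodic K f \<Longrightarrow> f (residue K n) = f n"
  by (metis periodicD residue_decompose)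

lemma sum_residue_box_translate:
  assumes K: "K \<noteq> 0" and f: "periodic K f"
  shows "(\<Sum>n\<in>residue_box K. f (n + s)) = sum f (residue_box K)"
proof (rule sum.reindex_bij_witness[of _ "\<lambda>n. residue K (n + - s)" "\<lambda>n. residue K (n + s)"])
  show "residue K (residue K (n + s) + - s) = n" if "n \<in> residue_box K" for n
    using that unfolding residue_residue_add by (simp add: residue_of_box)
  show "residue K (residue K (n + - s) + s) = n" if "n \<in> residue_box K" for n
    using that unfolding residue_residue_add by (simp add: residue_of_box)
qed (simp_all add: K residue_in_box periodic_residue[OF f])

lemma periodic_bounded:
  fixes f :: "int \<times> int \<Rightarrow> 'a::real_normed_vector"
  assumes "K \<noteq> 0" and f: "periodic K f"
  obtains B where "\<And>n. norm (f n) \<le> B"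
proof
  show "norm (f n) \<le> (\<Sum>r\<in>residue_box K. norm (f r))" for n
    using member_le_sum[of "residue K n" "residue_box K" "\<lambda>r. norm (f r)"] assms
    by (simp add: residue_in_box periodic_residue[OF f])
qed

lemma bij_betw_residue_classes:
  assumes K: "K \<noteq> 0"
  shows "bij_betw (\<lambda>(r, k). r + K *\<^sub>Z k) (residue_box K \<times> UNIV) UNIV"
proof (rule bij_betw_imageI)
  show "inj_on (\<lambda>(r, k). r + K *\<^sub>Z k) (residue_box K \<times> UNIV)"
  proof (rule inj_onI)
    fix u v
    assume "u \<in> residue_box K \<times> UNIV" "v \<in> residue_box K \<times> UNIV"
      and decomposition_eq: "(case u of (r, k) \<Rightarrow> r + K *\<^sub>Z k) = (case v of (r, k) \<Rightarrow> r + K *\<^sub>Z k)"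
    then have box: "fst u \<in> residue_box K" "fst v \<in> residue_box K"
      by auto
    have "residue K (fst u + K *\<^sub>Z snd u) = residue K (fst v + K *\<^sub>Z snd v)"
      using decomposition_eq by (simp add: case_prod_unfold)
    then have "fst u = fst v"
      unfolding residue_add_scale using box by (simp add: residue_of_box)
    then show "u = v"
      using decomposition_eq K by (simp add: case_prod_unfold prod_eq_iff)
  qed
  show "(\<lambda>(r, k). r + K *\<^sub>Z k) ` (residue_box K \<times> UNIV) = UNIV"
  proof (intro equalityI subsetI UNIV_I)
    fix n
    obtain k where "n = residue K n + K *\<^sub>Z k"
      by (rule residue_decompose)
    then show "n \<in> (\<lambda>(r, k). r + K *\<^sub>Z k) ` (residue_box K \<times> UNIV)"
      using residue_in_box[OF K, of n] by (auto intro: image_eqI[of _ _ "(residue K n, k)"])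
  qed
qed

lemma infsum_residue_classes:
  fixes F :: "int \<times> int \<Rightarrow> 'a::banach"
  assumes K: "K \<noteq> 0" and F: "F summable_on UNIV"
  shows "infsum F UNIV = (\<Sum>r\<in>residue_box K. \<Sum>\<^sub>\<infinity>k. F (r + K *\<^sub>Z k))"
proof -
  let ?F = "\<lambda>(r, k). F (r + K *\<^sub>Z k)"
  have F_eq: "?F = (\<lambda>x. F (case x of (r, k) \<Rightarrow> r + K *\<^sub>Z k))"
    by (simp add: case_prod_unfold)
  have "?F summable_on residue_box K \<times> UNIV"
    unfolding F_eq using F by (simp add: summable_on_reindex_bij_betw[OF bij_betw_residue_classes[OF K]])
  then have "infsum ?F (residue_box K \<times> UNIV) = (\<Sum>\<^sub>\<infinity>r\<in>residue_box K. \<Sum>\<^sub>\<infinity>k. F (r + K *\<^sub>Z k))"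
    by (rule infsum_Sigma'_banach [symmetric])
  then show ?thesis
    unfolding F_eq infsum_reindex_bij_betw[OF bij_betw_residue_classes[OF K]] by simp
qed

lemma in_range_int_scaleI:
  assumes "D \<noteq> 0" and "\<And>s. of_int (x \<bullet>\<^sub>Z s) / of_int D \<in> (\<int> :: real set)"
  shows "x \<in> range ((*\<^sub>Z) D)"
proof -
  obtain i j where "of_int (fst x) / of_int D = real_of_int i" "of_int (snd x) / of_int D = real_of_int j"
    using assms(2)[of "(1, 0)"] assms(2)[of "(0, 1)"] by (auto simp: int_dot_def elim!: Ints_cases)
  then have "real_of_int (fst x) = of_int (D * i)" "real_of_int (snd x) = of_int (D * j)"
    using assms(1) by (simp_all add: field_simps)
  then have "x = D *\<^sub>Z (i, j)"
    unfolding of_int_eq_iff by (simp add: prod_eq_iff)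
  then show ?thesis
    by blast
qed

lemma sum_cis_2pi_residue_box:
  assumes L: "L > 0"
  shows "(\<Sum>\<kappa>\<in>residue_box L. cis_2pi (of_int (x \<bullet>\<^sub>Z \<kappa>) / of_int L)) = (if x \<in> range ((*\<^sub>Z) L) then of_int (L * L) else 0)"
proof (cases "x \<in> range ((*\<^sub>Z) L)")
  case True
  then have "cis_2pi (of_int (x \<bullet>\<^sub>Z \<kappa>) / of_int L) = 1" for \<kappa>
    using L by (auto simp: int_dot_scale)
  then show ?thesis
    using True L by (simp add: residue_box_def)
next
  case False
  let ?f = "\<lambda>\<kappa>. cis_2pi (of_int (x \<bullet>\<^sub>Z \<kappa>) / of_int L)"
  have f_add: "?f (\<kappa> + s) = ?f \<kappa> * ?f s" for \<kappa> s
    by (simp add: int_dot_add add_divide_distrib cis_2pi_add)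
  have f_scale: "?f (L *\<^sub>Z \<kappa>) = 1" for \<kappa>
    using L by (simp add: int_dot_scale)
  have "periodic L ?f"
    by (simp add: periodic_def f_add f_scale)
  then have shift: "sum ?f (residue_box L) * ?f s = sum ?f (residue_box L)" for s
    using sum_residue_box_translate[of L ?f s] L by (simp add: f_add sum_distrib_right)
  have "sum ?f (residue_box L) = 0"
  proof (rule ccontr)
    assume "sum ?f (residue_box L) \<noteq> 0"
    then have integral: "of_int (x \<bullet>\<^sub>Z s) / of_int L \<in> (\<int> :: real set)" for s
      using shift[of s] by (simp add: cis_2pi_eq_1_iff)
    then have "x \<in> range ((*\<^sub>Z) L)"
      using L by (intro in_range_int_scaleI) auto
    with False show False ..
  qed
  with False show ?thesis
    by simp
qed

subsection \<open>Gauss sums\<close>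

locale int_binary_form =
  fixes p q r :: int
begin

definition gram :: "int \<times> int \<Rightarrow> int \<times> int" where
  "gram n = (p * fst n + q * snd n, q * fst n + r * snd n)"

definition adjugate :: "int \<times> int \<Rightarrow> int \<times> int" where
  "adjugate n = (r * fst n - q * snd n, p * snd n - q * fst n)"

definition gram_det :: int where
  "gram_det = p * r - q\<^sup>2"

definition qform :: "int \<times> int \<Rightarrow> real" where
  "qform n = of_int (n \<bullet>\<^sub>Z gram n) / 2"

lemma gram_add: "gram (m + n) = gram m + gram n"
  by (simp add: gram_def algebra_simps)

lemma gram_scale: "gram (k *\<^sub>Z n) = k *\<^sub>Z gram n"
  by (simp add: gram_def prod_eq_iff algebra_simps)

lemma gram_self_adjoint: "gram m \<bullet>\<^sub>Z n = m \<bullet>\<^sub>Z gram n"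
  by (simp add: gram_def int_dot_def algebra_simps)

lemma adjugate_self_adjoint: "adjugate m \<bullet>\<^sub>Z n = m \<bullet>\<^sub>Z adjugate n"
  by (simp add: adjugate_def int_dot_def algebra_simps)

lemma gram_adjugate: "gram (adjugate n) = gram_det *\<^sub>Z n"
  by (simp add: gram_def adjugate_def gram_det_def prod_eq_iff power2_eq_square algebra_simps)

lemma adjugate_gram: "adjugate (gram n) = gram_det *\<^sub>Z n"
  by (simp add: gram_def adjugate_def gram_det_def prod_eq_iff power2_eq_square algebra_simps)

lemma adjugate_scale: "adjugate (k *\<^sub>Z n) = k *\<^sub>Z adjugate n"
  by (simp add: adjugate_def prod_eq_iff algebra_simps)

lemma inj_gram: "gram_det \<noteq> 0 \<Longrightarrow> inj gram"
  by (metis adjugate_gram injI int_scale_cancel)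

lemma qform_add: "qform (m + n) = qform m + of_int (m \<bullet>\<^sub>Z gram n) + qform n"
  using gram_self_adjoint[of n m] int_dot_commute[of m "gram n"] int_dot_commute[of "gram m" n]
  by (simp add: qform_def gram_add int_dot_add add_divide_distrib)

lemma qform_scale: "qform (k *\<^sub>Z n) = (of_int k)\<^sup>2 * qform n"
  by (simp add: qform_def gram_scale int_dot_scale power2_eq_square)

lemma even_mult_qform_Ints: "even k \<Longrightarrow> of_int k * qform n \<in> \<int>"
  by (auto simp: qform_def elim!: evenE)

definition gauss_term :: "(int \<times> int \<Rightarrow> complex) \<Rightarrow> int \<Rightarrow> int \<Rightarrow> int \<times> int \<Rightarrow> int \<times> int \<Rightarrow> complex" where
  "gauss_term m a c k x = m x * cis_2pi (of_int a * qform x / of_int c - of_int (k \<bullet>\<^sub>Z x) / of_int (2 * c))"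

definition gauss_sum :: "(int \<times> int \<Rightarrow> complex) \<Rightarrow> int \<Rightarrow> int \<Rightarrow> int \<times> int \<Rightarrow> complex" where
  "gauss_sum m a c k = (\<Sum>x\<in>residue_box (2 * c). gauss_term m a c k x)"

definition gauss_const :: "int \<Rightarrow> int \<Rightarrow> int \<Rightarrow> complex" where
  "gauss_const L a c = (\<Sum>x\<in>residue_box (2 * c) \<inter> range ((*\<^sub>Z) L). cis_2pi (of_int a * qform x / of_int c))"

lemma gauss_term_translate:
  "gauss_term m a c k (x + s) = gauss_term (\<lambda>x. m (x + s)) a c k x
    * cis_2pi (of_int a * (of_int (x \<bullet>\<^sub>Z gram s) + qform s) / of_int c - of_int (k \<bullet>\<^sub>Z s) / of_int (2 * c))"
proof -
  have "of_int a * qform (x + s) / of_int c - of_int (k \<bullet>\<^sub>Z (x + s)) / of_int (2 * c)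
      = (of_int a * qform x / of_int c - of_int (k \<bullet>\<^sub>Z x) / of_int (2 * c))
        + (of_int a * (of_int (x \<bullet>\<^sub>Z gram s) + qform s) / of_int c - of_int (k \<bullet>\<^sub>Z s) / of_int (2 * c))"
    by (simp add: qform_add int_dot_add distrib_left add_divide_distrib)
  then show ?thesis
    by (simp only: gauss_term_def cis_2pi_add mult.assoc)
qed

lemma periodic_gauss_term:
  assumes c: "c \<noteq> 0" and m: "periodic L m" and L: "L dvd 2 * c"
  shows "periodic (2 * c) (gauss_term m a c k)"
  unfolding periodic_def
proof (intro allI)
  fix x s
  have m': "m (x + (2 * c) *\<^sub>Z s) = m x" for x
    using periodic_dvd[OF m L] by (rule periodicD)
  have "of_int a * (of_int (x \<bullet>\<^sub>Z gram ((2 * c) *\<^sub>Z s)) + qform ((2 * c) *\<^sub>Z s)) / of_int c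
      - of_int (k \<bullet>\<^sub>Z ((2 * c) *\<^sub>Z s)) / of_int (2 * c)
      = of_int (2 * a * (x \<bullet>\<^sub>Z gram s) - k \<bullet>\<^sub>Z s) + of_int (4 * a * c) * qform s"
    using c by (simp add: gram_scale qform_scale int_dot_scale power2_eq_square field_simps)
  also have "\<dots> \<in> \<int>"
    by (intro Ints_add Ints_of_int even_mult_qform_Ints) auto
  finally show "gauss_term m a c k (x + (2 * c) *\<^sub>Z s) = gauss_term m a c k x"
    unfolding gauss_term_translate m' by simp
qed

lemma gauss_sum_translate:
  assumes "c \<noteq> 0" "periodic L m" "L dvd 2 * c"
  shows "gauss_sum m a c k = (\<Sum>x\<in>residue_box (2 * c). gauss_term m a c k (x + s))"
  using sum_residue_box_translate[OF _ periodic_gauss_term[OF assms]] assms(1) by (simp add: gauss_sum_def)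

text \<open>A shift of the summation variable by \<open>c A\<^sup>-\<^sup>1 \<kappa>\<close> multiplies the sum by a root of unity.\<close>
lemma gauss_sum_eq_root_of_unity_mult:
  assumes c: "c \<noteq> 0" and m: "periodic L m" and c0: "c = 2 * L * L * gram_det * c0"
  shows "gauss_sum m a c k = gauss_sum m a c k * cis_2pi (- (of_int (adjugate k \<bullet>\<^sub>Z \<kappa>) / of_int (2 * gram_det)))"
proof -
  define s where "s = (2 * L * L * c0) *\<^sub>Z adjugate \<kappa>"
  have m': "m (x + s) = m x" for x
    using periodicD[OF m, of x "(2 * L * c0) *\<^sub>Z adjugate \<kappa>"] by (simp add: s_def int_scale_scale mult_ac)
  have gram_s: "gram s = c *\<^sub>Z \<kappa>"
    by (simp add: s_def c0 gram_scale gram_adjugate int_scale_scale mult_ac)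
  then have "qform s = of_int (c * (L * L * c0 * (adjugate \<kappa> \<bullet>\<^sub>Z \<kappa>)))"
    by (simp add: qform_def int_dot_scale) (simp add: s_def int_dot_scale)
  then have quadratic: "of_int a * (of_int (x \<bullet>\<^sub>Z gram s) + qform s) / of_int c
      = real_of_int (a * (x \<bullet>\<^sub>Z \<kappa> + L * L * c0 * (adjugate \<kappa> \<bullet>\<^sub>Z \<kappa>)))" for x
    using c by (simp add: gram_s int_dot_scale field_simps)
  have "2 * L * L * c0 \<noteq> 0"
    using c c0 by auto
  moreover have "k \<bullet>\<^sub>Z s = (2 * L * L * c0) * (adjugate k \<bullet>\<^sub>Z \<kappa>)" "2 * c = (2 * L * L * c0) * (2 * gram_det)"
    by (simp_all add: s_def c0 int_dot_scale adjugate_self_adjoint)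
  moreover have "W \<noteq> 0 \<Longrightarrow> of_int (W * x) / of_int (W * y) = (of_int x / of_int y :: real)" for W x y :: int
    by simp
  ultimately have linear: "of_int (k \<bullet>\<^sub>Z s) / of_int (2 * c)
      = (of_int (adjugate k \<bullet>\<^sub>Z \<kappa>) / of_int (2 * gram_det) :: real)"
    by (simp only: not_False_eq_True)
  have shift: "gauss_term m a c k (x + s)
      = gauss_term m a c k x * cis_2pi (- (of_int (adjugate k \<bullet>\<^sub>Z \<kappa>) / of_int (2 * gram_det)))" for x
    unfolding gauss_term_translate m' quadratic linear
    by (intro arg_cong2[where f = "(*)"] refl cis_2pi_cong) simp
  have "L dvd 2 * c"
    using c0 by simp
  from gauss_sum_translate[OF c m this, of a k s] show ?thesis
    by (simp only: shift sum_distrib_right [symmetric] gauss_sum_def [symmetric])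
qed

lemma gauss_sum_nonzero_imp_dual_index:
  assumes D: "gram_det \<noteq> 0" and "c \<noteq> 0" "periodic L m" "c = 2 * L * L * gram_det * c0"
    and nonzero: "gauss_sum m a c k \<noteq> 0"
  obtains \<nu> where "k = 2 *\<^sub>Z gram \<nu>"
proof -
  have "of_int (adjugate k \<bullet>\<^sub>Z \<kappa>) / of_int (2 * gram_det) \<in> (\<int> :: real set)" for \<kappa>
    using gauss_sum_eq_root_of_unity_mult[OF assms(2-4), of a k \<kappa>] nonzero
    by (simp only: mult_cancel_left1 cis_2pi_eq_1_iff minus_in_Ints_iff) simp
  then have "adjugate k \<in> range ((*\<^sub>Z) (2 * gram_det))"
    using D by (intro in_range_int_scaleI) auto
  then obtain \<nu> where "adjugate k = (2 * gram_det) *\<^sub>Z \<nu>"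
    by blast
  then have "gram_det *\<^sub>Z k = gram_det *\<^sub>Z 2 *\<^sub>Z gram \<nu>"
    by (simp add: gram_adjugate [symmetric] gram_scale int_scale_scale mult_ac)
  then show ?thesis
    using int_scale_cancel[OF D] that by blast
qed

lemma gauss_phase_complete_square:
  assumes c: "c \<noteq> 0" and det: "a * d - b * c = 1" and "even b"
  shows "cis_2pi (of_int a * qform (x + d *\<^sub>Z \<nu>) / of_int c
      - of_int (2 *\<^sub>Z gram \<nu> \<bullet>\<^sub>Z (x + d *\<^sub>Z \<nu>)) / of_int (2 * c)) * cis_2pi (of_int d * qform \<nu> / of_int c)
    = cis_2pi (of_int a * qform x / of_int c)"
proof -
  define u v w where "u = real_of_int (x \<bullet>\<^sub>Z gram \<nu>)" and "v = qform \<nu>" and "w = real_of_int c"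
  have linear: "of_int (2 *\<^sub>Z gram \<nu> \<bullet>\<^sub>Z (x + d *\<^sub>Z \<nu>)) = 2 * (u + of_int d * (2 * v))"
    using int_dot_commute[of "gram \<nu>"] by (simp add: u_def v_def qform_def int_dot_add int_dot_scale)
  have "a * d = b * c + 1"
    using det by simp
  then have ad: "of_int a * real_of_int d = of_int b * w + 1"
    unfolding w_def of_int_mult [symmetric] by simp
  have "qform (x + d *\<^sub>Z \<nu>) = qform x + of_int d * (u + of_int d * v)"
    by (simp add: u_def v_def qform_add qform_scale gram_scale int_dot_scale distrib_left power2_eq_square)
  then have quadratic: "of_int a * qform (x + d *\<^sub>Z \<nu>) = of_int a * qform x + (of_int b * w + 1) * (u + of_int d * v)"
    by (simp only: distrib_left[of "of_int a"] mult.assoc [symmetric] ad)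
  have "of_int a * qform (x + d *\<^sub>Z \<nu>) / w - of_int (2 *\<^sub>Z gram \<nu> \<bullet>\<^sub>Z (x + d *\<^sub>Z \<nu>)) / (2 * w) + of_int d * v / w
      = of_int a * qform x / w + (of_int (b * (x \<bullet>\<^sub>Z gram \<nu>)) + of_int (b * d) * v)"
    unfolding linear quadratic using c by (simp add: u_def w_def field_simps)
  moreover have "of_int (b * (x \<bullet>\<^sub>Z gram \<nu>)) + of_int (b * d) * v \<in> \<int>"
    unfolding v_def by (intro Ints_add Ints_of_int even_mult_qform_Ints) (simp add: \<open>even b\<close>)
  ultimately show ?thesis
    unfolding cis_2pi_add [symmetric] v_def w_def of_int_mult of_int_numeral
    by (intro cis_2pi_cong) (simp only: add_diff_cancel_left')
qed

lemma gauss_sum_complete_square: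
  assumes c: "c \<noteq> 0" and m: "periodic L m" and "L dvd 2 * c"
    and det: "a * d - b * c = 1" and "even b" and d: "L dvd d - 1"
  shows "gauss_sum m a c (2 *\<^sub>Z gram \<nu>) * cis_2pi (of_int d * qform \<nu> / of_int c)
    = gauss_sum (\<lambda>x. m (x + \<nu>)) a c 0"
proof -
  obtain e where "d = 1 + L * e"
    using d by (metis dvd_def add_diff_cancel_left' diff_add_cancel add.commute)
  then have x_d\<nu>: "x + d *\<^sub>Z \<nu> = (x + \<nu>) + L *\<^sub>Z (e *\<^sub>Z \<nu>)" for x
    by (simp add: prod_eq_iff algebra_simps)
  have "m (x + d *\<^sub>Z \<nu>) = m (x + \<nu>)" for x
    unfolding x_d\<nu> by (rule periodicD[OF m])
  then have "gauss_term m a c (2 *\<^sub>Z gram \<nu>) (x + d *\<^sub>Z \<nu>) * cis_2pi (of_int d * qform \<nu> / of_int c)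
      = gauss_term (\<lambda>x. m (x + \<nu>)) a c 0 x" for x
    unfolding gauss_term_def mult.assoc gauss_phase_complete_square[OF c det \<open>even b\<close>] by (simp add: int_dot_def)
  then show ?thesis
    using gauss_sum_translate[OF assms(1-3), of a "2 *\<^sub>Z gram \<nu>" "d *\<^sub>Z \<nu>"]
    by (simp add: gauss_sum_def sum_distrib_right)
qed

lemma gauss_sum_twist:
  assumes L: "L > 0" and c: "c \<noteq> 0" and m: "periodic L m"
    and c0: "c = 2 * L * L * gram_det * c0" and a: "L dvd a - 1"
  shows "gauss_sum m a c 0 = (\<Sum>x\<in>residue_box (2 * c). gauss_term m a c 0 x * cis_2pi (of_int (x \<bullet>\<^sub>Z \<kappa>) / of_int L))"
proof -
  define s where "s = (2 * L * c0) *\<^sub>Z adjugate \<kappa>"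
  have m': "m (x + s) = m x" for x
    using periodicD[OF m, of x "(2 * c0) *\<^sub>Z adjugate \<kappa>"] by (simp add: s_def int_scale_scale mult_ac)
  have gram_s: "L *\<^sub>Z gram s = c *\<^sub>Z \<kappa>"
    by (simp add: s_def c0 gram_scale gram_adjugate int_scale_scale mult_ac)
  have dot_gram: "real_of_int (x \<bullet>\<^sub>Z gram s) = of_int c * of_int (x \<bullet>\<^sub>Z \<kappa>) / of_int L" for x
  proof -
    have "L * (x \<bullet>\<^sub>Z gram s) = c * (x \<bullet>\<^sub>Z \<kappa>)"
      using gram_s by (metis int_dot_scale(1))
    then have "real_of_int (L * (x \<bullet>\<^sub>Z gram s)) = of_int (c * (x \<bullet>\<^sub>Z \<kappa>))"
      by (simp only:)
    then show ?thesis
      using L by (simp add: field_simps)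
  qed
  have "qform s = of_int c * of_int (c0 * (adjugate \<kappa> \<bullet>\<^sub>Z \<kappa>))"
    unfolding qform_def dot_gram using L by (simp add: s_def int_dot_scale)
  moreover obtain e where "a = 1 + L * e"
    using a by (metis dvd_def add_diff_cancel_left' diff_add_cancel add.commute)
  ultimately have "of_int a * (of_int (x \<bullet>\<^sub>Z gram s) + qform s) / of_int c - of_int (x \<bullet>\<^sub>Z \<kappa>) / of_int L
      = real_of_int (e * (x \<bullet>\<^sub>Z \<kappa>) + a * (c0 * (adjugate \<kappa> \<bullet>\<^sub>Z \<kappa>)))" for x
    unfolding dot_gram using c L by (simp add: field_simps)
  then have "cis_2pi (of_int a * (of_int (x \<bullet>\<^sub>Z gram s) + qform s) / of_int c) = cis_2pi (of_int (x \<bullet>\<^sub>Z \<kappa>) / of_int L)" for x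
    by (intro cis_2pi_cong) (metis Ints_of_int)
  then show ?thesis
    using gauss_sum_translate[OF c m, of a 0 s] c0
    by (simp add: gauss_term_translate m' int_dot_def)
qed

text \<open>Averaging over the twists leaves only the residues divisible by \<open>L\<close>.\<close>
lemma gauss_sum_periodic:
  assumes L: "L > 0" and "c \<noteq> 0" and m: "periodic L m"
    and "c = 2 * L * L * gram_det * c0" and "L dvd a - 1"
  shows "gauss_sum m a c 0 = m 0 * gauss_const L a c"
proof -
  let ?T = "gauss_term m a c 0" and ?e = "\<lambda>x \<kappa>. cis_2pi (of_int (x \<bullet>\<^sub>Z \<kappa>) / of_int L)"
  have T_divisible: "?T x = m 0 * cis_2pi (of_int a * qform x / of_int c)" if "x \<in> range ((*\<^sub>Z) L)" for x
    using that periodicD[OF m, of 0] by (auto simp: gauss_term_def int_dot_def)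
  have "of_int (L * L) * gauss_sum m a c 0 = (\<Sum>\<kappa>\<in>residue_box L. gauss_sum m a c 0)"
    using L by (simp add: residue_box_def)
  also have "\<dots> = (\<Sum>\<kappa>\<in>residue_box L. \<Sum>x\<in>residue_box (2 * c). ?T x * ?e x \<kappa>)"
    by (intro sum.cong refl gauss_sum_twist[OF assms])
  also have "\<dots> = (\<Sum>x\<in>residue_box (2 * c). ?T x * (\<Sum>\<kappa>\<in>residue_box L. ?e x \<kappa>))"
    by (subst sum.swap) (simp add: sum_distrib_left)
  also have "\<dots> = (\<Sum>x\<in>residue_box (2 * c). if x \<in> range ((*\<^sub>Z) L)
      then of_int (L * L) * m 0 * cis_2pi (of_int a * qform x / of_int c) else 0)"
    by (intro sum.cong refl) (simp add: sum_cis_2pi_residue_box[OF L] T_divisible)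
  also have "\<dots> = of_int (L * L) * (m 0 * gauss_const L a c)"
    unfolding gauss_const_def sum.inter_restrict[OF finite_residue_box] sum_distrib_left
    by (intro sum.cong) auto
  finally show ?thesis
    using L by simp
qed

theorem gauss_sum_eval:
  assumes L: "L > 0" and c: "c \<noteq> 0" and m: "periodic L m"
    and c0: "c = 2 * L * L * gram_det * c0" and "a * d - b * c = 1" "even b"
    and "L dvd a - 1" "L dvd d - 1"
  shows "gauss_sum m a c (2 *\<^sub>Z gram \<nu>) * cis_2pi (of_int d * qform \<nu> / of_int c) = m \<nu> * gauss_const L a c"
proof -
  have "L dvd 2 * c"
    using c0 by simp
  then show ?thesis
    using assms gauss_sum_complete_square[of c L m a d b \<nu>]
      gauss_sum_periodic[OF L c periodic_translate[OF m, of \<nu>] c0] by simp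
qed

end

subsection \<open>Principal congruence subgroups\<close>

definition matrix_cong :: "int \<Rightarrow> int^'n^'m \<Rightarrow> int^'n^'m \<Rightarrow> bool" where
  "matrix_cong N A B \<longleftrightarrow> (\<forall>i j. N dvd A $ i $ j - B $ i $ j)"

lemma matrix_cong_refl: "matrix_cong N A A"
  by (simp add: matrix_cong_def)

lemma matrix_cong_mult:
  fixes A A' :: "int^'n^'m" and B B' :: "int^'k^'n"
  assumes "matrix_cong N A A'" "matrix_cong N B B'"
  shows "matrix_cong N (A ** B) (A' ** B')"
  unfolding matrix_cong_def
proof (intro allI)
  fix i j
  have "N dvd (A $ i $ k - A' $ i $ k) * B $ k $ j + A' $ i $ k * (B $ k $ j - B' $ k $ j)" for k
    using assms by (simp add: matrix_cong_def)
  also have "(A $ i $ k - A' $ i $ k) * B $ k $ j + A' $ i $ k * (B $ k $ j - B' $ k $ j)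
      = A $ i $ k * B $ k $ j - A' $ i $ k * B' $ k $ j" for k
    by (simp add: algebra_simps)
  finally show "N dvd (A ** B) $ i $ j - (A' ** B') $ i $ j"
    by (simp add: matrix_matrix_mult_def sum_subtractf [symmetric] dvd_sum)
qed

definition principal_congruence :: "int \<Rightarrow> (int^2^2) set" where
  "principal_congruence N = {M \<in> carrier SL2Z. matrix_cong N M (mat 1)}"

lemma det_principal_congruence: "M \<in> principal_congruence N \<Longrightarrow> det M = 1"
  by (simp add: principal_congruence_def SL2Z_def)

lemma principal_congruenceD:
  assumes "M \<in> principal_congruence N"
  shows "M $ 1 $ 1 * M $ 2 $ 2 - M $ 1 $ 2 * M $ 2 $ 1 = 1"
    and "N dvd M $ 1 $ 1 - 1" "N dvd M $ 1 $ 2" "N dvd M $ 2 $ 1" "N dvd M $ 2 $ 2 - 1"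
  using assms by (auto simp: principal_congruence_def SL2Z_def det_2 matrix_cong_def mat_def forall_2)

lemma SL2Z_mult [simp]: "M \<otimes>\<^bsub>SL2Z\<^esub> M' = M ** M'"
  and SL2Z_one [simp]: "\<one>\<^bsub>SL2Z\<^esub> = mat 1"
  by (simp_all add: SL2Z_def)

lemma subgroup_principal_congruence: "subgroup (principal_congruence N) SL2Z"
proof -
  interpret group SL2Z
    by (rule group_SL2Z)
  show ?thesis
  proof
    show "x \<otimes>\<^bsub>SL2Z\<^esub> y \<in> principal_congruence N"
      if "x \<in> principal_congruence N" "y \<in> principal_congruence N" for x y
      using that m_closed[of x y] matrix_cong_mult[of N x "mat 1" y "mat 1"] by (simp add: principal_congruence_def)
    show "inv\<^bsub>SL2Z\<^esub> x \<in> principal_congruence N" if "x \<in> principal_congruence N" for x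
    proof -
      have x: "x \<in> carrier SL2Z" and "matrix_cong N x (mat 1)"
        using that by (auto simp: principal_congruence_def)
      then have "matrix_cong N (mat 1) x"
        by (simp add: matrix_cong_def dvd_diff_commute)
      from matrix_cong_mult[OF matrix_cong_refl this, of "inv\<^bsub>SL2Z\<^esub> x"] show ?thesis
        using x l_inv[OF x] by (simp add: principal_congruence_def)
    qed
    show "\<one>\<^bsub>SL2Z\<^esub> \<in> principal_congruence N"
      using one_closed by (simp add: principal_congruence_def matrix_cong_refl)
  qed (auto simp: principal_congruence_def)
qed

lemma principal_congruence_coset_eq:
  assumes x: "x \<in> carrier SL2Z" and y: "y \<in> carrier SL2Z" and "matrix_cong N y x"
  shows "principal_congruence N #>\<^bsub>SL2Z\<^esub> x = principal_congruence N #>\<^bsub>SL2Z\<^esub> y"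
proof -
  interpret group SL2Z
    by (rule group_SL2Z)
  have "matrix_cong N (y ** inv\<^bsub>SL2Z\<^esub> x) (mat 1)"
    using matrix_cong_mult[OF assms(3) matrix_cong_refl, of "inv\<^bsub>SL2Z\<^esub> x"] r_inv[OF x] by simp
  then have "y \<otimes>\<^bsub>SL2Z\<^esub> inv\<^bsub>SL2Z\<^esub> x \<in> principal_congruence N"
    using m_closed[OF y inv_closed[OF x]] by (simp add: principal_congruence_def)
  moreover have "y = (y \<otimes>\<^bsub>SL2Z\<^esub> inv\<^bsub>SL2Z\<^esub> x) \<otimes>\<^bsub>SL2Z\<^esub> x"
    by (simp only: m_assoc[OF y inv_closed[OF x] x] l_inv[OF x] r_one[OF y])
  ultimately have "y \<in> principal_congruence N #>\<^bsub>SL2Z\<^esub> x"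
    unfolding r_coset_def by blast
  then show ?thesis
    using x by (intro repr_independence subgroup_principal_congruence)
qed

lemma finite_image_factor:
  assumes "finite (\<rho> ` S)" and "\<And>x y. x \<in> S \<Longrightarrow> y \<in> S \<Longrightarrow> \<rho> x = \<rho> y \<Longrightarrow> f x = f y"
  shows "finite (f ` S)"
proof -
  have "f ` S \<subseteq> (\<lambda>v. f (inv_into S \<rho> v)) ` (\<rho> ` S)"
  proof
    fix w
    assume "w \<in> f ` S"
    then obtain x where "x \<in> S" "w = f x"
      by blast
    then show "w \<in> (\<lambda>v. f (inv_into S \<rho> v)) ` (\<rho> ` S)"
      using assms(2)[of x "inv_into S \<rho> (\<rho> x)"] by (auto simp: inv_into_into f_inv_into_f)
  qed
  then show ?thesis
    using assms(1) finite_surj by blast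
qed

lemma finite_rcosets_principal_congruence:
  assumes N: "N \<noteq> 0"
  shows "finite (rcosets\<^bsub>SL2Z\<^esub> (principal_congruence N))"
proof -
  define \<rho> where "\<rho> M = map (\<lambda>x. x mod \<bar>N\<bar>) [M $ 1 $ 1, M $ 1 $ 2, M $ 2 $ 1, M $ 2 $ 2]" for M :: "int^2^2"
  have "\<rho> ` carrier SL2Z \<subseteq> {xs. set xs \<subseteq> {0..<\<bar>N\<bar>} \<and> length xs = 4}"
    using N by (auto simp: \<rho>_def)
  then have "finite (\<rho> ` carrier SL2Z)"
    by (rule finite_subset) (simp add: finite_lists_length_eq)
  moreover have "principal_congruence N #>\<^bsub>SL2Z\<^esub> x = principal_congruence N #>\<^bsub>SL2Z\<^esub> y"
    if "x \<in> carrier SL2Z" "y \<in> carrier SL2Z" "\<rho> x = \<rho> y" for x y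
  proof (rule principal_congruence_coset_eq[OF that(1,2)])
    show "matrix_cong N y x"
      using that(3) by (auto simp: matrix_cong_def forall_2 \<rho>_def mod_eq_dvd_iff dvd_diff_commute)
  qed
  ultimately have "finite ((\<lambda>x. principal_congruence N #>\<^bsub>SL2Z\<^esub> x) ` carrier SL2Z)"
    by (rule finite_image_factor)
  then show ?thesis
    by (simp add: RCOSETS_def UNION_singleton_eq_range)
qed

definition automorphy_factor :: "int^2^2 \<Rightarrow> complex \<Rightarrow> complex" where
  "automorphy_factor M \<tau> = of_int (M $ 2 $ 1) * \<tau> + of_int (M $ 2 $ 2)"

lemma automorphy_factor_nonzero:
  assumes "det M = 1" "Im \<tau> > 0"
  shows "automorphy_factor M \<tau> \<noteq> 0"
proof
  assume "automorphy_factor M \<tau> = 0"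
  then have "M $ 2 $ 1 = 0" "M $ 2 $ 2 = 0"
    using assms(2) by (auto simp: automorphy_factor_def complex_eq_iff)
  then show False
    using assms(1) by (simp add: det_2)
qed

lemma Im_moebius:
  assumes "det M = 1"
  shows "Im (moebius M \<tau>) = Im \<tau> / (norm (automorphy_factor M \<tau>))\<^sup>2"
proof -
  define a b c d where "a = real_of_int (M $ 1 $ 1)" "b = real_of_int (M $ 1 $ 2)"
    "c = real_of_int (M $ 2 $ 1)" "d = real_of_int (M $ 2 $ 2)"
  have "real_of_int (M $ 1 $ 1 * M $ 2 $ 2 - M $ 1 $ 2 * M $ 2 $ 1) = 1"
    using assms by (simp add: det_2)
  then have det: "a * d - b * c = 1"
    by (simp add: a_b_c_d_def)
  have "(a * Im \<tau>) * (c * Re \<tau> + d) - (a * Re \<tau> + b) * (c * Im \<tau>) = (a * d - b * c) * Im \<tau>"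
    by (simp add: algebra_simps)
  then show ?thesis
    unfolding moebius_def automorphy_factor_def Im_divide cmod_power2 by (simp add: det a_b_c_d_def [symmetric])
qed

lemma Im_moebius_pos:
  assumes "det M = 1" "Im \<tau> > 0"
  shows "Im (moebius M \<tau>) > 0"
  using assms automorphy_factor_nonzero[OF assms] by (simp add: Im_moebius)

lemma moebius_eq_translate_inversion:
  assumes det: "det M = 1" and c: "M $ 2 $ 1 \<noteq> 0" and \<tau>: "Im \<tau> > 0"
  shows "moebius M \<tau> = of_real (of_int (M $ 1 $ 1) / of_int (M $ 2 $ 1)) - 1 / (of_int (M $ 2 $ 1) * automorphy_factor M \<tau>)"
proof -
  define j where "j = automorphy_factor M \<tau>"
  have j: "j \<noteq> 0"
    unfolding j_def by (rule automorphy_factor_nonzero[OF det \<tau>])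
  have "of_int (M $ 1 $ 1 * M $ 2 $ 2 - M $ 1 $ 2 * M $ 2 $ 1) = (1 :: complex)"
    using det by (simp add: det_2)
  then have "of_int (M $ 2 $ 1) * (of_int (M $ 1 $ 1) * \<tau> + of_int (M $ 1 $ 2)) = of_int (M $ 1 $ 1) * j - 1"
    by (simp add: j_def automorphy_factor_def algebra_simps)
  then have "of_int (M $ 1 $ 1) * \<tau> + of_int (M $ 1 $ 2) = (of_int (M $ 1 $ 1) * j - 1) / of_int (M $ 2 $ 1)"
    using c by (simp add: field_simps)
  then show ?thesis
    using c j unfolding moebius_def automorphy_factor_def [symmetric] j_def [symmetric]
    by (simp add: diff_divide_distrib)
qed

subsection \<open>The Siegel theta function and its modularity\<close>

definition hyperbolic_gaussian :: "complex \<Rightarrow> real \<Rightarrow> real \<Rightarrow> complex" where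
  "hyperbolic_gaussian \<tau> x y = cis_2pi (Re \<tau> * (x * y)) * of_real (exp (- (pi * Im \<tau> * (x\<^sup>2 + y\<^sup>2))))"

lemma norm_hyperbolic_gaussian: "norm (hyperbolic_gaussian \<tau> x y) = exp (- (pi * Im \<tau> * (x\<^sup>2 + y\<^sup>2)))"
  by (simp add: hyperbolic_gaussian_def norm_mult)

lemma hyperbolic_gaussian_scale:
  "hyperbolic_gaussian \<tau> (s * x) (s * y) = hyperbolic_gaussian (of_real (s\<^sup>2) * \<tau>) x y"
  by (simp add: hyperbolic_gaussian_def power_mult_distrib distrib_left mult_ac power2_eq_square)

lemma hyperbolic_gaussian_add_real:
  "hyperbolic_gaussian (of_real t + \<tau>) x y = cis_2pi (t * (x * y)) * hyperbolic_gaussian \<tau> x y"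
  by (simp add: hyperbolic_gaussian_def distrib_right cis_2pi_add mult.assoc)

lemma csqrt_mult_csqrt_divide:
  assumes "Re z > 0" "d > 0"
  shows "csqrt z * csqrt (of_real (d\<^sup>2) / z) = of_real d"
proof -
  have z: "csqrt z \<noteq> 0"
    using assms by auto
  have "csqrt (of_real (d\<^sup>2) / z) = of_real d / csqrt z"
  proof (rule csqrt_unique)
    show "(of_real d / csqrt z)\<^sup>2 = of_real (d\<^sup>2) / z"
      by (simp add: power_divide)
    have "Re (csqrt z) > 0"
      using assms(1) by (simp add: add_nonneg_pos)
    then have "0 < Re (of_real d / csqrt z)"
      unfolding Re_complex_div_gt_0 using assms(2) by (simp del: csqrt.simps)
    then show "0 < Re (of_real d / csqrt z) \<or> Re (of_real d / csqrt z) = 0 \<and> 0 \<le> Im (of_real d / csqrt z)" ..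
  qed
  then show ?thesis
    using z by simp
qed

lemma has_sum_sum:
  fixes f :: "'i \<Rightarrow> 'a \<Rightarrow> 'b :: topological_comm_monoid_add"
  assumes "finite I" "\<And>i. i \<in> I \<Longrightarrow> (f i has_sum s i) A"
  shows "((\<lambda>x. \<Sum>i\<in>I. f i x) has_sum (\<Sum>i\<in>I. s i)) A"
  using assms by (induction I rule: finite_induct) (auto intro!: has_sum_add)

locale hyperbolic_form = int_binary_form p q r for p q r :: int +
  fixes a b :: "real \<times> real"
  assumes coefficients: "2 * (fst a * fst b) = of_int p" "fst a * snd b + snd a * fst b = of_int q"
      "2 * (snd a * snd b) = of_int r"
    and nondegenerate: "fst a * snd b \<noteq> snd a * fst b"
begin

definition wedge :: real where
  "wedge = fst a * snd b - snd a * fst b"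

definition \<kappa> :: real where
  "\<kappa> = wedge\<^sup>2 / ((norm a)\<^sup>2 + (norm b)\<^sup>2)"

abbreviation theta_kernel :: "complex \<Rightarrow> real \<times> real \<Rightarrow> complex" where
  "theta_kernel \<tau> v \<equiv> hyperbolic_gaussian \<tau> (a \<bullet> v) (b \<bullet> v)"

definition dual_point :: "int \<times> int \<Rightarrow> real \<times> real" where
  "dual_point k = of_int_pair (adjugate k) /\<^sub>R of_int gram_det"

definition quarter_turn :: "int \<times> int \<Rightarrow> int \<times> int" where
  "quarter_turn k = (snd k, - fst k)"

lemma wedge_nonzero: "wedge \<noteq> 0"
  using nondegenerate by (simp add: wedge_def)

lemma gram_det_eq: "of_int gram_det = - wedge\<^sup>2"
  by (simp add: gram_det_def wedge_def coefficients [symmetric] power2_eq_square algebra_simps)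

lemma gram_det_nonzero: "gram_det \<noteq> 0"
  using gram_det_eq wedge_nonzero by (metis neg_equal_0_iff_equal of_int_0 power_eq_0_iff)

lemma qform_factor: "qform n = (a \<bullet> of_int_pair n) * (b \<bullet> of_int_pair n)"
  by (simp add: qform_def gram_def int_dot_def inner_prod_def coefficients [symmetric] field_simps)

lemma norm2_sum_pos: "(norm a)\<^sup>2 + (norm b)\<^sup>2 > 0"
proof -
  have "a \<noteq> 0"
    using nondegenerate by auto
  then show ?thesis
    by (simp add: add_pos_nonneg)
qed

lemma \<kappa>_pos: "\<kappa> > 0"
  using wedge_nonzero norm2_sum_pos by (simp add: \<kappa>_def)

lemma sum_squares_ge: "\<kappa> * (norm v)\<^sup>2 \<le> (a \<bullet> v)\<^sup>2 + (b \<bullet> v)\<^sup>2"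
proof -
  have "(x * s - y * t)\<^sup>2 \<le> (x\<^sup>2 + y\<^sup>2) * (s\<^sup>2 + t\<^sup>2)" for x y s t :: real
    using zero_le_power2[of "x * t + y * s"] by (simp add: power2_eq_square algebra_simps)
  from this[of "snd b" "a \<bullet> v" "snd a" "b \<bullet> v"] this[of "fst a" "b \<bullet> v" "fst b" "a \<bullet> v"]
  have "(snd b * (a \<bullet> v) - snd a * (b \<bullet> v))\<^sup>2 + (fst a * (b \<bullet> v) - fst b * (a \<bullet> v))\<^sup>2
      \<le> ((norm a)\<^sup>2 + (norm b)\<^sup>2) * ((a \<bullet> v)\<^sup>2 + (b \<bullet> v)\<^sup>2)"
    by (simp add: norm2_pair algebra_simps)
  also have "snd b * (a \<bullet> v) - snd a * (b \<bullet> v) = wedge * fst v"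
    by (simp add: wedge_def inner_prod_def algebra_simps)
  also have "fst a * (b \<bullet> v) - fst b * (a \<bullet> v) = wedge * snd v"
    by (simp add: wedge_def inner_prod_def algebra_simps)
  finally have "wedge\<^sup>2 * (norm v)\<^sup>2 \<le> ((norm a)\<^sup>2 + (norm b)\<^sup>2) * ((a \<bullet> v)\<^sup>2 + (b \<bullet> v)\<^sup>2)"
    by (simp add: norm2_pair power_mult_distrib distrib_left)
  then show ?thesis
    using norm2_sum_pos by (simp add: \<kappa>_def field_simps)
qed

lemma theta_kernel_scale: "theta_kernel \<tau> (s *\<^sub>R v) = theta_kernel (of_real (s\<^sup>2) * \<tau>) v"
  by (simp add: hyperbolic_gaussian_scale)

lemma theta_kernel_minus: "theta_kernel \<tau> (- v) = theta_kernel \<tau> v"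
  using theta_kernel_scale[of \<tau> "- 1" v] by simp

lemma theta_kernel_add_real: "theta_kernel (of_real t + \<tau>) (of_int_pair n) = cis_2pi (t * qform n) * theta_kernel \<tau> (of_int_pair n)"
  by (simp add: hyperbolic_gaussian_add_real qform_factor)

lemma norm_theta_kernel_le:
  assumes "Im \<tau> > 0"
  shows "norm (theta_kernel \<tau> v) \<le> exp (- (pi * Im \<tau> * \<kappa>) * (norm v)\<^sup>2)"
  using assms sum_squares_ge[of v] by (simp add: norm_hyperbolic_gaussian mult.assoc)

lemma dual_point_gram: "dual_point (k *\<^sub>Z gram n) = of_int k *\<^sub>R of_int_pair n"
  using gram_det_nonzero by (simp add: dual_point_def adjugate_scale adjugate_gram int_scale_scale of_int_pair_scale)

lemma dual_point_minus: "dual_point (- k) = - dual_point k"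
  by (simp add: dual_point_def adjugate_def of_int_pair_def prod_eq_iff algebra_simps)

lemma inner_dual_point:
  "a \<bullet> dual_point k = (a \<bullet> of_int_pair (quarter_turn k)) / wedge"
  "b \<bullet> dual_point k = - (b \<bullet> of_int_pair (quarter_turn k)) / wedge"
proof -
  have "a \<bullet> of_int_pair (adjugate k) = - wedge * (a \<bullet> of_int_pair (quarter_turn k))"
    "b \<bullet> of_int_pair (adjugate k) = wedge * (b \<bullet> of_int_pair (quarter_turn k))"
    by (simp_all add: adjugate_def quarter_turn_def wedge_def inner_prod_def coefficients [symmetric] algebra_simps)
  then show "a \<bullet> dual_point k = (a \<bullet> of_int_pair (quarter_turn k)) / wedge"
    "b \<bullet> dual_point k = - (b \<bullet> of_int_pair (quarter_turn k)) / wedge"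
    using wedge_nonzero by (simp_all add: dual_point_def gram_det_eq field_simps power2_eq_square)
qed

lemma norm_theta_kernel_dual_le:
  assumes "Im \<tau> > 0"
  shows "norm (theta_kernel \<tau> (dual_point k)) \<le> exp (- (pi * Im \<tau> * \<kappa> / wedge\<^sup>2) * (norm (of_int_pair k))\<^sup>2)"
proof -
  let ?v = "of_int_pair (quarter_turn k)"
  have "pi * Im \<tau> / wedge\<^sup>2 * (\<kappa> * (norm (of_int_pair k))\<^sup>2) = pi * Im \<tau> / wedge\<^sup>2 * (\<kappa> * (norm ?v)\<^sup>2)"
    by (simp add: norm2_pair quarter_turn_def add.commute)
  also have "\<dots> \<le> pi * Im \<tau> / wedge\<^sup>2 * ((a \<bullet> ?v)\<^sup>2 + (b \<bullet> ?v)\<^sup>2)"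
    using assms by (intro mult_left_mono sum_squares_ge) simp
  also have "\<dots> = pi * Im \<tau> * ((a \<bullet> dual_point k)\<^sup>2 + (b \<bullet> dual_point k)\<^sup>2)"
    unfolding inner_dual_point by (simp add: power_divide add_divide_distrib algebra_simps)
  finally show ?thesis
    by (simp add: norm_hyperbolic_gaussian mult_ac)
qed

lemma summable_theta_kernel_dual:
  assumes "Im \<tau> > 0"
  shows "(\<lambda>k. theta_kernel \<tau> (dual_point k) * cis_2pi (f k)) summable_on UNIV"
proof (rule abs_summable_summable[OF Infinite_Sum.abs_summable_on_comparison_test'])
  show "(\<lambda>k. exp (- (pi * Im \<tau> * \<kappa> / wedge\<^sup>2) * (norm (of_int_pair k + 0))\<^sup>2)) summable_on UNIV"
    using assms \<kappa>_pos wedge_nonzero by (intro summable_gaussian_int_pair) simp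
qed (use norm_theta_kernel_dual_le[OF assms] in \<open>simp add: norm_mult\<close>)

end

locale hyperbolic_form_at = hyperbolic_form p q r a b for p q r a b +
  fixes \<tau> :: complex
  assumes Im_\<tau>: "Im \<tau> > 0"
begin

text \<open>The Gram matrix of \<open>Im \<tau> ((a \<bullet> v)\<^sup>2 + (b \<bullet> v)\<^sup>2) - 2 \<i> Re \<tau> (a \<bullet> v) (b \<bullet> v)\<close>.\<close>
definition z11 :: complex where
  "z11 = Complex (Im \<tau> * ((fst a)\<^sup>2 + (fst b)\<^sup>2)) (- 2 * Re \<tau> * fst a * fst b)"

definition z12 :: complex where
  "z12 = Complex (Im \<tau> * (fst a * snd a + fst b * snd b)) (- Re \<tau> * (fst a * snd b + snd a * fst b))"

definition z22 :: complex where
  "z22 = Complex (Im \<tau> * ((snd a)\<^sup>2 + (snd b)\<^sup>2)) (- 2 * Re \<tau> * snd a * snd b)"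

lemmas z_defs = z11_def z12_def z22_def

sublocale Z: complex_binary_form z11 z12 z22 "Im \<tau> * \<kappa>"
proof
  show "Im \<tau> * \<kappa> > 0"
    using Im_\<tau> \<kappa>_pos by simp
  fix x y :: real
  have "Im \<tau> * \<kappa> * (x\<^sup>2 + y\<^sup>2) \<le> Im \<tau> * ((a \<bullet> (x, y))\<^sup>2 + (b \<bullet> (x, y))\<^sup>2)"
    using Im_\<tau> sum_squares_ge[of "(x, y)"] by (simp add: norm2_pair mult.assoc)
  also have "\<dots> = Re z11 * x\<^sup>2 + 2 * Re z12 * x * y + Re z22 * y\<^sup>2"
    by (simp add: z_defs inner_prod_def power2_eq_square algebra_simps)
  finally show "Im \<tau> * \<kappa> * (x\<^sup>2 + y\<^sup>2) \<le> Re z11 * x\<^sup>2 + 2 * Re z12 * x * y + Re z22 * y\<^sup>2" .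
qed

lemma form_eq:
  "Z.form v = of_real (Im \<tau> * ((a \<bullet> v)\<^sup>2 + (b \<bullet> v)\<^sup>2)) - 2 * \<i> * of_real (Re \<tau> * ((a \<bullet> v) * (b \<bullet> v)))"
  unfolding Z.form_def by (simp add: complex_eq_iff z_defs inner_prod_def power2_eq_square algebra_simps)

lemma gram_det_complex: "Z.gram_det = of_real ((\<bar>wedge\<bar> * norm \<tau>)\<^sup>2)"
proof -
  have "(\<bar>wedge\<bar> * norm \<tau>)\<^sup>2 = wedge\<^sup>2 * ((Re \<tau>)\<^sup>2 + (Im \<tau>)\<^sup>2)"
    by (simp add: power_mult_distrib cmod_power2)
  then show ?thesis
    unfolding Z.gram_det_def
    by (simp add: complex_eq_iff z_defs wedge_def power2_eq_square algebra_simps)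
qed

lemma theta_kernel_eq_form: "theta_kernel \<tau> v = exp (- of_real pi * Z.form v)"
  unfolding hyperbolic_gaussian_def form_eq cis_2pi_conv_exp exp_of_real [symmetric] exp_add [symmetric]
  by (rule arg_cong[where f = exp]) (simp add: algebra_simps)

lemma theta_kernel_eq_dual_form:
  "theta_kernel (- 1 / \<tau>) (dual_point k) = exp (- of_real pi * Z.dual_form (of_int_pair k))"
proof -
  define x y where "x = a \<bullet> of_int_pair (quarter_turn k)" and "y = b \<bullet> of_int_pair (quarter_turn k)"
  define n where "n = (Re \<tau>)\<^sup>2 + (Im \<tau>)\<^sup>2"
  have "n > 0"
    using Im_\<tau> by (simp add: n_def add_nonneg_pos)
  have inverse: "Re (- 1 / \<tau>) = - Re \<tau> / n" "Im (- 1 / \<tau>) = Im \<tau> / n"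
    by (simp_all add: Re_divide Im_divide n_def)
  have det: "Z.gram_det = of_real (wedge\<^sup>2 * n)"
    unfolding gram_det_complex by (simp add: power_mult_distrib cmod_power2 n_def)
  have "Z.dual_form (of_int_pair k) = Complex (Im \<tau> * (x\<^sup>2 + y\<^sup>2)) (- 2 * Re \<tau> * (x * y)) / Z.gram_det"
    unfolding Z.dual_form_def
    by (rule arg_cong2[where f = "(/)"])
      (simp_all add: complex_eq_iff z_defs x_def y_def quarter_turn_def inner_prod_def power2_eq_square algebra_simps)
  also have "\<dots> = of_real (Im (- 1 / \<tau>) * ((x / wedge)\<^sup>2 + (- y / wedge)\<^sup>2))
      - 2 * \<i> * of_real (Re (- 1 / \<tau>) * (x / wedge * (- y / wedge)))"
    unfolding det inverse using wedge_nonzero \<open>n > 0\<close>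
    by (simp add: complex_eq_iff Re_divide_of_real Im_divide_of_real field_simps power2_eq_square
        del: of_real_mult of_real_add of_real_power)
  finally have dual_form: "Z.dual_form (of_int_pair k) = of_real (Im (- 1 / \<tau>) * ((x / wedge)\<^sup>2 + (- y / wedge)\<^sup>2))
      - 2 * \<i> * of_real (Re (- 1 / \<tau>) * (x / wedge * (- y / wedge)))" .
  show ?thesis
    unfolding dual_form hyperbolic_gaussian_def inner_dual_point x_def [symmetric] y_def [symmetric]
      cis_2pi_conv_exp exp_of_real [symmetric] exp_add [symmetric]
    by (intro arg_cong[where f = exp]) (simp add: algebra_simps)
qed

lemma theta_inversion':
  "(\<Sum>\<^sub>\<infinity>n. theta_kernel \<tau> (of_int_pair n + w))
    = (\<Sum>\<^sub>\<infinity>k. theta_kernel (- 1 / \<tau>) (dual_point k) * cis_2pi (of_int_pair k \<bullet> w)) / of_real (\<bar>wedge\<bar> * norm \<tau>)"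
proof -
  have "\<tau> \<noteq> 0"
    using Im_\<tau> by auto
  then have "\<bar>wedge\<bar> * norm \<tau> > 0"
    using wedge_nonzero by simp
  then have sqrt: "csqrt z11 * csqrt (Z.gram_det / z11) = of_real (\<bar>wedge\<bar> * norm \<tau>)"
    unfolding gram_det_complex by (rule csqrt_mult_csqrt_divide[OF Z.Re_z11_pos])
  show ?thesis
    unfolding theta_kernel_eq_form theta_kernel_eq_dual_form cis_2pi_conv_exp exp_add [symmetric] sqrt [symmetric]
    by (rule Z.poisson_summation_form)
qed

end

context hyperbolic_form
begin

lemma theta_inversion:
  assumes "Im \<tau> > 0"
  shows "(\<Sum>\<^sub>\<infinity>n. theta_kernel \<tau> (of_int_pair n + w))
    = (\<Sum>\<^sub>\<infinity>k. theta_kernel (- 1 / \<tau>) (dual_point k) * cis_2pi (- (of_int_pair k \<bullet> w))) / of_real (\<bar>wedge\<bar> * norm \<tau>)"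
proof -
  interpret hyperbolic_form_at p q r a b \<tau>
    by standard (rule assms)
  have "bij (uminus :: int \<times> int \<Rightarrow> int \<times> int)"
    by (rule bij_uminus)
  from infsum_reindex_bij_betw[OF this, of "\<lambda>k. theta_kernel (- 1 / \<tau>) (dual_point k) * cis_2pi (of_int_pair k \<bullet> w)"]
  have "(\<Sum>\<^sub>\<infinity>k. theta_kernel (- 1 / \<tau>) (dual_point k) * cis_2pi (- (of_int_pair k \<bullet> w)))
      = (\<Sum>\<^sub>\<infinity>k. theta_kernel (- 1 / \<tau>) (dual_point k) * cis_2pi (of_int_pair k \<bullet> w))"
    unfolding dual_point_minus theta_kernel_minus by (simp add: of_int_pair_def inner_prod_def)
  then show ?thesis
    by (simp only: theta_inversion')
qed

lemma theta_inversion_residue_class: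
  assumes K: "K \<noteq> 0" and \<tau>: "Im \<tau> > 0"
  shows "(\<Sum>\<^sub>\<infinity>j. theta_kernel \<tau> (of_int_pair (x + K *\<^sub>Z j)))
    = (\<Sum>\<^sub>\<infinity>k. theta_kernel (- 1 / (of_real ((of_int K)\<^sup>2) * \<tau>)) (dual_point k) * cis_2pi (- (of_int (k \<bullet>\<^sub>Z x) / of_int K)))
      / of_real (\<bar>wedge\<bar> * ((of_int K)\<^sup>2 * norm \<tau>))"
proof -
  define w where "w = of_int_pair x /\<^sub>R of_int K"
  have point: "of_int_pair (x + K *\<^sub>Z j) = of_int K *\<^sub>R (of_int_pair j + w)" for j
    using K by (simp add: w_def of_int_pair_add of_int_pair_scale scaleR_add_right add.commute)
  have inner: "of_int_pair k \<bullet> w = of_int (k \<bullet>\<^sub>Z x) / of_int K" for k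
    by (simp add: w_def inner_of_int_pair divide_inverse mult.commute)
  have Im_scaled: "Im (of_real ((of_int K)\<^sup>2) * \<tau>) > 0"
    using K \<tau> by simp
  show ?thesis
    unfolding point theta_kernel_scale theta_inversion[OF Im_scaled] inner by (simp add: norm_mult norm_power)
qed

definition theta :: "(int \<times> int \<Rightarrow> complex) \<Rightarrow> complex \<Rightarrow> complex" where
  "theta m \<tau> = (\<Sum>\<^sub>\<infinity>n. m n * theta_kernel \<tau> (of_int_pair n))"

lemma summable_theta:
  assumes "\<And>n. norm (m n) \<le> B" and \<tau>: "Im \<tau> > 0"
  shows "(\<lambda>n. m n * theta_kernel \<tau> (of_int_pair n)) summable_on UNIV"
proof (rule abs_summable_summable[OF Infinite_Sum.abs_summable_on_comparison_test'])
  show "(\<lambda>n. B * exp (- (pi * Im \<tau> * \<kappa>) * (norm (of_int_pair n + 0))\<^sup>2)) summable_on UNIV"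
    using \<tau> \<kappa>_pos by (intro summable_on_cmult_right summable_gaussian_int_pair) simp
  show "norm (m n * theta_kernel \<tau> (of_int_pair n)) \<le> B * exp (- (pi * Im \<tau> * \<kappa>) * (norm (of_int_pair n + 0))\<^sup>2)" for n
    unfolding norm_mult using assms norm_theta_kernel_le[OF \<tau>, of "of_int_pair n"]
    by (intro mult_mono) (auto intro: order_trans[OF norm_ge_zero])
qed

text \<open>The expansion of \<open>\<theta>\<close> at the cusp \<open>h/c\<close>: split the sum into classes modulo \<open>2c\<close> and invert each of them.\<close>
lemma theta_near_rational:
  assumes c: "c \<noteq> 0" and m: "periodic L m" and L_dvd: "L dvd 2 * c" and \<tau>: "Im \<tau> > 0"
  shows "theta m (of_real (of_int h / of_int c) + \<tau>)
    = (\<Sum>\<^sub>\<infinity>k. gauss_sum m h c k * theta_kernel (- 1 / (of_real ((2 * of_int c)\<^sup>2) * \<tau>)) (dual_point k))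
      / of_real (\<bar>wedge\<bar> * ((2 * of_int c)\<^sup>2 * norm \<tau>))"
proof -
  define V where "V k = theta_kernel (- 1 / (of_real ((2 * of_int c)\<^sup>2) * \<tau>)) (dual_point k)" for k
  define D where "D = complex_of_real (\<bar>wedge\<bar> * ((2 * of_int c)\<^sup>2 * norm \<tau>))"
  define f where "f = gauss_term m h c 0"
  have f_eq: "f x = m x * cis_2pi (of_int h / of_int c * qform x)" for x
    by (simp add: f_def gauss_term_def int_dot_def)
  have f: "periodic (2 * c) f"
    unfolding f_def by (rule periodic_gauss_term[OF c m L_dvd])
  obtain B where B: "\<And>n. norm (f n) \<le> B"
    using periodic_bounded[OF _ f] c by auto
  have term_eq: "f x * (V k * cis_2pi (- (of_int (k \<bullet>\<^sub>Z x) / of_int (2 * c)))) = gauss_term m h c k x * V k" for x k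
    by (simp add: f_def gauss_term_def int_dot_def diff_conv_add_uminus cis_2pi_add mult_ac del: add_uminus_conv_diff)
  have "Im (- 1 / (of_real ((2 * of_int c)\<^sup>2) * \<tau>)) > 0"
    using c \<tau> by (simp add: Im_divide sum_power2_gt_zero_iff zero_less_mult_iff)
  from summable_on_cmult_right[OF summable_theta_kernel_dual[OF this]]
  have summable: "(\<lambda>k. gauss_term m h c k x * V k) summable_on UNIV" for x
    unfolding V_def [symmetric] term_eq [symmetric] .
  have "theta m (of_real (of_int h / of_int c) + \<tau>) = (\<Sum>\<^sub>\<infinity>x. f x * theta_kernel \<tau> (of_int_pair x))"
    unfolding theta_def theta_kernel_add_real f_eq by (simp only: mult.assoc)
  also have "\<dots> = (\<Sum>x\<in>residue_box (2 * c). \<Sum>\<^sub>\<infinity>j. f (x + (2 * c) *\<^sub>Z j) * theta_kernel \<tau> (of_int_pair (x + (2 * c) *\<^sub>Z j)))"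
    using c by (intro infsum_residue_classes summable_theta[OF B \<tau>]) simp
  also have "\<dots> = (\<Sum>x\<in>residue_box (2 * c). f x * ((\<Sum>\<^sub>\<infinity>k. V k * cis_2pi (- (of_int (k \<bullet>\<^sub>Z x) / of_int (2 * c)))) / D))"
    using theta_inversion_residue_class[of "2 * c", OF _ \<tau>] c
    by (simp add: periodicD[OF f] infsum_cmult_right' V_def D_def)
  also have "\<dots> = (\<Sum>x\<in>residue_box (2 * c). \<Sum>\<^sub>\<infinity>k. gauss_term m h c k x * V k) / D"
    unfolding times_divide_eq_right sum_divide_distrib infsum_cmult_right' [symmetric] term_eq ..
  also have "(\<Sum>x\<in>residue_box (2 * c). \<Sum>\<^sub>\<infinity>k. gauss_term m h c k x * V k) = (\<Sum>\<^sub>\<infinity>k. gauss_sum m h c k * V k)"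
    unfolding gauss_sum_def sum_distrib_right
    by (intro infsumI [symmetric] has_sum_sum has_sum_infsum summable finite_residue_box)
  finally show ?thesis
    by (simp only: V_def D_def)
qed

text \<open>The linear forms enter only through \<open>wedge\<close>, which does not change when \<open>(a, b)\<close> is rescaled to
  \<open>(e\<^sup>-\<^sup>u a, e\<^sup>u b)\<close>.\<close>
definition theta_multiplier :: "int \<Rightarrow> int^2^2 \<Rightarrow> complex" where
  "theta_multiplier L M = (if M $ 2 $ 1 = 0 then 1
     else gauss_const L (M $ 1 $ 1) (M $ 2 $ 1) / of_real (4 * \<bar>of_int (M $ 2 $ 1)\<bar> * \<bar>wedge\<bar>))"

definition theta_level :: "int \<Rightarrow> int" where
  "theta_level L = 4 * L * L * gram_det"

lemma theta_level_nonzero: "L > 0 \<Longrightarrow> theta_level L \<noteq> 0"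
  using gram_det_nonzero by (simp add: theta_level_def)

lemma theta_level_congruences:
  assumes "M \<in> principal_congruence (theta_level L)"
  shows "L dvd M $ 1 $ 1 - 1" "L dvd M $ 2 $ 2 - 1" "even (M $ 1 $ 2)"
    and "\<exists>c0. M $ 2 $ 1 = 2 * L * L * gram_det * (2 * c0)"
proof -
  have "L dvd theta_level L" "2 dvd theta_level L"
    by (simp_all add: theta_level_def)
  then show "L dvd M $ 1 $ 1 - 1" "L dvd M $ 2 $ 2 - 1" "even (M $ 1 $ 2)"
    using principal_congruenceD[OF assms] dvd_trans by blast+
  obtain k where "M $ 2 $ 1 = theta_level L * k"
    using principal_congruenceD(4)[OF assms] by blast
  then show "\<exists>c0. M $ 2 $ 1 = 2 * L * L * gram_det * (2 * c0)"
    by (intro exI[of _ k]) (simp add: theta_level_def)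
qed

lemma theta_modular_at_infinity:
  assumes L: "L > 0" and M: "M \<in> principal_congruence (theta_level L)" and c: "M $ 2 $ 1 = 0"
  shows "theta m (moebius M \<tau>) = theta m \<tau>"
proof -
  note [simp] = c
  have "L * L * \<bar>gram_det\<bar> > 0"
    using L gram_det_nonzero by simp
  then have level: "\<bar>theta_level L\<bar> > 2"
    using L by (simp add: theta_level_def abs_mult)
  have "M $ 1 $ 1 = 1 \<and> M $ 2 $ 2 = 1 \<or> M $ 1 $ 1 = - 1 \<and> M $ 2 $ 2 = - 1"
    using principal_congruenceD(1)[OF M] by (simp add: zmult_eq_1_iff)
  then have diagonal: "M $ 1 $ 1 = 1" "M $ 2 $ 2 = 1"
    using level principal_congruenceD(2)[OF M] dvd_imp_le_int[of "M $ 1 $ 1 - 1" "theta_level L"] by auto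
  have "theta_kernel (of_real (of_int (M $ 1 $ 2)) + \<tau>) (of_int_pair n) = theta_kernel \<tau> (of_int_pair n)" for n
    unfolding theta_kernel_add_real using even_mult_qform_Ints theta_level_congruences(3)[OF M] by simp
  then show ?thesis
    by (simp add: theta_def moebius_def diagonal add.commute)
qed

lemma infsum_gauss_sum_theta_kernel:
  assumes "L > 0" and c: "c \<noteq> 0" and m: "periodic L m" and c0: "c = 2 * L * L * gram_det * c0"
    and "h * d - b' * c = 1" "even b'" "L dvd h - 1" "L dvd d - 1"
  shows "(\<Sum>\<^sub>\<infinity>k. gauss_sum m h c k * theta_kernel (of_real (of_int d / of_int c) + \<tau>) ((1 / 2) *\<^sub>R dual_point k))
    = gauss_const L h c * theta m \<tau>"
proof -
  define \<tau>' where "\<tau>' = of_real (of_int d / of_int c) + \<tau>"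
  have "gauss_sum m h c k = 0" if "k \<notin> range (\<lambda>n. 2 *\<^sub>Z gram n)" for k
    using that gauss_sum_nonzero_imp_dual_index[OF gram_det_nonzero c m c0] by (metis rangeI)
  then have "(\<Sum>\<^sub>\<infinity>k. gauss_sum m h c k * theta_kernel \<tau>' ((1 / 2) *\<^sub>R dual_point k))
      = (\<Sum>\<^sub>\<infinity>k\<in>range (\<lambda>n. 2 *\<^sub>Z gram n). gauss_sum m h c k * theta_kernel \<tau>' ((1 / 2) *\<^sub>R dual_point k))"
    by (intro infsum_cong_neutral) auto
  also have "\<dots> = (\<Sum>\<^sub>\<infinity>n. gauss_sum m h c (2 *\<^sub>Z gram n) * theta_kernel \<tau>' (of_int_pair n))"
    using inj_gram[OF gram_det_nonzero]
    by (subst infsum_reindex) (auto simp: inj_def int_scale_cancel o_def dual_point_gram)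
  also have "\<dots> = (\<Sum>\<^sub>\<infinity>n. gauss_const L h c * (m n * theta_kernel \<tau> (of_int_pair n)))"
  proof (rule infsum_cong)
    fix n
    have "gauss_sum m h c (2 *\<^sub>Z gram n) * theta_kernel \<tau>' (of_int_pair n)
        = gauss_sum m h c (2 *\<^sub>Z gram n) * cis_2pi (of_int d * qform n / of_int c) * theta_kernel \<tau> (of_int_pair n)"
      unfolding \<tau>'_def theta_kernel_add_real by simp
    then show "gauss_sum m h c (2 *\<^sub>Z gram n) * theta_kernel \<tau>' (of_int_pair n)
        = gauss_const L h c * (m n * theta_kernel \<tau> (of_int_pair n))"
      unfolding gauss_sum_eval[OF assms] by (simp only: mult_ac)
  qed
  also have "\<dots> = gauss_const L h c * theta m \<tau>"
    by (simp add: theta_def infsum_cmult_right')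
  finally show ?thesis
    by (simp only: \<tau>'_def)
qed

lemma theta_modular_off_infinity:
  assumes L: "L > 0" and m: "periodic L m" and M: "M \<in> principal_congruence (theta_level L)"
    and c: "M $ 2 $ 1 \<noteq> 0" and \<tau>: "Im \<tau> > 0"
  shows "theta m (moebius M \<tau>) = theta_multiplier L M * of_real (norm (automorphy_factor M \<tau>)) * theta m \<tau>"
proof -
  define a' b' c' d' where entries: "a' = M $ 1 $ 1" "b' = M $ 1 $ 2" "c' = M $ 2 $ 1" "d' = M $ 2 $ 2"
  define j where "j = automorphy_factor M \<tau>"
  have det: "a' * d' - b' * c' = 1"
    using principal_congruenceD(1)[OF M] by (simp add: entries)
  then have det_M: "det M = 1"
    by (simp add: det_2 entries)
  obtain c0 where c0: "c' = 2 * L * L * gram_det * (2 * c0)"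
    using theta_level_congruences(4)[OF M] unfolding entries by blast
  then have L_dvd: "L dvd 2 * c'"
    by simp
  have c'_nonzero: "c' \<noteq> 0"
    using c by (simp add: entries)
  have j: "j \<noteq> 0"
    unfolding j_def by (rule automorphy_factor_nonzero[OF det_M \<tau>])
  define t where "t = - 1 / (of_int c' * j)"
  define \<tau>' where "\<tau>' = of_real (of_int d' / of_int c') + \<tau>"
  have j_eq: "j = of_int c' * \<tau>'"
    using c'_nonzero by (simp add: j_def automorphy_factor_def \<tau>'_def entries algebra_simps)
  have "moebius M \<tau> = of_real (of_int a' / of_int c') + t"
    using moebius_eq_translate_inversion[OF det_M c \<tau>] by (simp add: t_def j_def entries)
  moreover have "Im (moebius M \<tau>) > 0"
    by (rule Im_moebius_pos[OF det_M \<tau>])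
  ultimately have M_\<tau>: "moebius M \<tau> = of_real (of_int a' / of_int c') + t" and Im_t: "Im t > 0"
    by simp_all
  have "- 1 / (of_real ((2 * of_int c')\<^sup>2) * t) = of_real ((1 / 2)\<^sup>2) * \<tau>'"
    using c'_nonzero j by (simp add: t_def field_simps power2_eq_square) (simp add: j_eq)
  moreover have "(2 * of_int c')\<^sup>2 * norm t = 4 * \<bar>of_int c'\<bar> / norm j"
    unfolding power_mult_distrib power2_abs[of "of_int c'", symmetric] using c'_nonzero j
    by (simp add: t_def norm_mult norm_divide power2_eq_square del: abs_mult_self_eq)
  ultimately have expansion: "theta m (moebius M \<tau>)
      = (\<Sum>\<^sub>\<infinity>k. gauss_sum m a' c' k * theta_kernel \<tau>' ((1 / 2) *\<^sub>R dual_point k)) / of_real (\<bar>wedge\<bar> * (4 * \<bar>of_int c'\<bar> / norm j))"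
    using theta_near_rational[OF c'_nonzero m L_dvd Im_t, of a'] by (simp only: M_\<tau> theta_kernel_scale)
  have "(\<Sum>\<^sub>\<infinity>k. gauss_sum m a' c' k * theta_kernel \<tau>' ((1 / 2) *\<^sub>R dual_point k)) = gauss_const L a' c' * theta m \<tau>"
    unfolding \<tau>'_def by (rule infsum_gauss_sum_theta_kernel[OF L c'_nonzero m c0 det theta_level_congruences(3,1,2)[OF M, folded entries]])
  then show ?thesis
    unfolding expansion using c j by (simp add: theta_multiplier_def j_def entries mult_ac)
qed

theorem theta_modular:
  assumes "L > 0" "periodic L m" "M \<in> principal_congruence (theta_level L)" "Im \<tau> > 0"
  shows "theta m (moebius M \<tau>) = theta_multiplier L M * of_real (norm (automorphy_factor M \<tau>)) * theta m \<tau>"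
proof (cases "M $ 2 $ 1 = 0")
  case True
  then have "\<bar>M $ 2 $ 2\<bar> = 1"
    using principal_congruenceD(1)[OF assms(3)] by (auto simp: zmult_eq_1_iff)
  with True have "norm (automorphy_factor M \<tau>) = 1"
    by (simp add: automorphy_factor_def)
  with True theta_modular_at_infinity[OF assms(1,3)] show ?thesis
    by (simp add: theta_multiplier_def)
qed (rule theta_modular_off_infinity[OF assms(1-3) _ assms(4)])

end

subsection \<open>The Bessel function as an integral of Gaussians\<close>

lemma cosh_ge_quadratic: "cosh (s::real) \<ge> 1 + s\<^sup>2 / 4"
proof -
  have "1 + \<bar>s\<bar> + \<bar>s\<bar>\<^sup>2 / 2 \<le> exp \<bar>s\<bar>"
    by (rule exp_lower_Taylor_quadratic) simp
  moreover have "1 + (- \<bar>s\<bar>) \<le> exp (- \<bar>s\<bar>)"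
    by (rule exp_ge_add_one_self)
  ultimately have "1 + s\<^sup>2 / 4 \<le> (exp \<bar>s\<bar> + exp (- \<bar>s\<bar>)) / 2"
    by simp
  also have "\<dots> = cosh \<bar>s\<bar>"
    by (simp add: cosh_field_def)
  finally show ?thesis
    by (simp add: cosh_real_abs)
qed

lemma has_bochner_integral_exp_neg_square:
  assumes "x > (0::real)"
  shows "has_bochner_integral lborel (\<lambda>s. exp (- (x * s\<^sup>2))) (sqrt (pi / x))"
proof -
  have gaussian: "complex_gaussian (of_real (x / pi)) (\<i> * of_real 0) = (\<lambda>s. of_real (exp (- (x * s\<^sup>2))))"
    by (simp add: fun_eq_iff complex_gaussian_def exp_of_real [symmetric])
  have "x / pi > 0"
    using assms by simp
  from has_bochner_integral_gaussian_fourier[OF this, of 0]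
  have "has_bochner_integral lborel (\<lambda>s. complex_of_real (exp (- (x * s\<^sup>2)))) (of_real (sqrt (pi / x)))"
    unfolding gaussian by (simp add: real_sqrt_divide)
  from has_bochner_integral_bounded_linear[OF bounded_linear_Re this] show ?thesis
    by simp
qed

lemma exp_cosh_le:
  fixes x s :: real
  assumes "x > 0"
  shows "exp (- x * cosh (2 * s)) \<le> exp (- x) * exp (- (x * s\<^sup>2))"
proof -
  have "x * (1 + (2 * s)\<^sup>2 / 4) \<le> x * cosh (2 * s)"
    using assms by (intro mult_left_mono cosh_ge_quadratic) auto
  then show ?thesis
    by (simp add: exp_add [symmetric] algebra_simps power2_eq_square)
qed

lemma continuous_on_exp_cosh: "continuous_on S (\<lambda>s::real. exp (- x * cosh (2 * s)))"
  by (intro continuous_intros)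

lemma integrable_exp_cosh:
  assumes "x > (0::real)"
  shows "integrable lborel (\<lambda>s. exp (- x * cosh (2 * s)))"
proof (rule Bochner_Integration.integrable_bound)
  show "integrable lborel (\<lambda>s. exp (- x) * exp (- (x * s\<^sup>2)))"
    using has_bochner_integral_exp_neg_square[OF assms] by (auto simp: has_bochner_integral_iff)
  show "(\<lambda>s. exp (- x * cosh (2 * s))) \<in> borel_measurable lborel"
    using borel_measurable_continuous_onI[OF continuous_on_exp_cosh] by simp
qed (use exp_cosh_le[OF assms] in auto)

lemma has_bochner_integral_bessel_K0:
  assumes x: "x > 0"
  shows "has_bochner_integral lborel (\<lambda>u. exp (- x * cosh (2 * (u - t)))) (bessel_K0 x)"
proof -
  define f where "f = (\<lambda>s. exp (- x * cosh s))"
  have "has_bochner_integral lborel (\<lambda>s. f (0 + 2 * s)) (LINT s|lborel. f (2 * s))"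
    using integrable_exp_cosh[OF x] by (simp add: has_bochner_integral_iff f_def)
  then have "has_bochner_integral lborel f (2 * (LINT s|lborel. f (2 * s)))"
    using lborel_has_bochner_integral_real_affine_iff[of 2 f "2 * (LINT s|lborel. f (2 * s))" 0] by simp
  then have int: "integrable lborel f" and scale: "(LINT s|lborel. f s) = 2 * (LINT s|lborel. f (2 * s))"
    by (auto simp: has_bochner_integral_iff)
  have half: "set_integrable lborel {0..} f"
    unfolding set_integrable_def by (rule integrable_mult_indicator[OF _ int]) simp
  then have "has_bochner_integral lborel (\<lambda>s. indicator {0..} s *\<^sub>R f s) (bessel_K0 x)"
    using set_borel_integral_eq_integral(2)[OF half]
    by (simp add: has_bochner_integral_iff set_integrable_def set_lebesgue_integral_def bessel_K0_def f_def)
  then have "has_bochner_integral lborel f (2 *\<^sub>R bessel_K0 x)"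
    by (rule has_bochner_integral_even_function) (simp add: f_def)
  then have "(LINT s|lborel. f (2 * s)) = bessel_K0 x"
    using scale by (simp add: has_bochner_integral_iff)
  then have "has_bochner_integral lborel (\<lambda>s. f (2 * s)) (bessel_K0 x)"
    using integrable_exp_cosh[OF x] by (simp add: has_bochner_integral_iff f_def)
  then show ?thesis
    using lborel_has_bochner_integral_real_affine_iff[of 1 "\<lambda>s. f (2 * s)" _ "- t"] by (simp add: f_def)
qed

lemma bessel_K0_nonneg: "bessel_K0 x \<ge> 0"
  unfolding bessel_K0_def
  by (cases "(\<lambda>t. exp (- x * cosh t)) integrable_on {0..}")
    (auto intro: integral_nonneg simp: not_integrable_integral)

lemma has_bochner_integral_mono:
  fixes f g :: "'a \<Rightarrow> real"
  assumes "has_bochner_integral M f x" "has_bochner_integral M g y" "\<And>u. f u \<le> g u"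
  shows "x \<le> y"
  using assms by (auto simp: has_bochner_integral_iff intro: integral_mono)

lemma bessel_K0_le:
  assumes "x > 0"
  shows "bessel_K0 x \<le> exp (- x) * sqrt (pi / x)"
proof (rule has_bochner_integral_mono)
  show "has_bochner_integral lborel (\<lambda>s. exp (- x * cosh (2 * (s - 0)))) (bessel_K0 x)"
    by (rule has_bochner_integral_bessel_K0[OF assms])
  show "has_bochner_integral lborel (\<lambda>s. exp (- x) * exp (- (x * s\<^sup>2))) (exp (- x) * sqrt (pi / x))"
    by (intro has_bochner_integral_mult_right has_bochner_integral_exp_neg_square assms)
qed (use exp_cosh_le[OF assms] in simp)

text \<open>The majorant of \<open>Q = \<alpha>\<beta>\<close> at parameter \<open>u\<close>, up to a factor 2; for \<open>Q \<noteq> 0\<close> it is smallest at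
  \<open>u = majorant_argmin \<alpha> \<beta>\<close>.\<close>
definition majorant :: "real \<Rightarrow> real \<Rightarrow> real \<Rightarrow> real" where
  "majorant \<alpha> \<beta> u = (\<alpha> * exp (- u))\<^sup>2 + (\<beta> * exp u)\<^sup>2"

definition majorant_argmin :: "real \<Rightarrow> real \<Rightarrow> real" where
  "majorant_argmin \<alpha> \<beta> = ln (\<bar>\<alpha>\<bar> / \<bar>\<beta>\<bar>) / 2"

lemma exp_majorant_argmin:
  "\<alpha> * \<beta> \<noteq> 0 \<Longrightarrow> exp (2 * majorant_argmin \<alpha> \<beta>) = \<bar>\<alpha>\<bar> / \<bar>\<beta>\<bar>"
  by (simp add: majorant_argmin_def)

lemma majorant_expand: "majorant \<alpha> \<beta> u = \<alpha>\<^sup>2 * exp (- 2 * u) + \<beta>\<^sup>2 * exp (2 * u)"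
  by (simp add: majorant_def power_mult_distrib) (simp add: power2_eq_square exp_add [symmetric])

lemma continuous_on_majorant [continuous_intros]: "continuous_on S (majorant \<alpha> \<beta>)"
  unfolding majorant_def by (intro continuous_intros)

lemma exp_mult_cancel: "x * exp (- u) * (y * exp u) = x * (y::real)"
  by (simp add: exp_minus field_simps)

lemma majorant_eq_cosh:
  assumes "\<alpha> * \<beta> \<noteq> 0"
  shows "majorant \<alpha> \<beta> u = 2 * \<bar>\<alpha> * \<beta>\<bar> * cosh (2 * (u - majorant_argmin \<alpha> \<beta>))"
proof -
  define h where "h = majorant_argmin \<alpha> \<beta>"
  have "\<bar>\<alpha>\<bar> = \<bar>\<beta>\<bar> * exp (2 * h)"
    using exp_majorant_argmin[OF assms] assms by (simp add: h_def)
  then have "\<bar>\<alpha>\<bar>\<^sup>2 * exp (- 2 * u) + \<bar>\<beta>\<bar>\<^sup>2 * exp (2 * u) = \<bar>\<alpha>\<bar> * \<bar>\<beta>\<bar> * (exp (2 * h - 2 * u) + exp (- (2 * h)) * exp (2 * u))"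
    by (simp add: power2_eq_square exp_diff exp_minus field_simps)
  also have "\<dots> = 2 * \<bar>\<alpha> * \<beta>\<bar> * cosh (2 * (u - h))"
    by (simp add: cosh_field_def abs_mult exp_add [symmetric] algebra_simps)
  finally show ?thesis
    by (simp add: majorant_expand h_def)
qed

lemma majorant_ge: "majorant \<alpha> \<beta> u \<ge> 2 * \<bar>\<alpha> * \<beta>\<bar>"
  using sum_squares_bound[of "\<bar>\<alpha> * exp (- u)\<bar>" "\<bar>\<beta> * exp u\<bar>"] exp_mult_cancel[of \<alpha> u \<beta>]
  by (simp only: majorant_def power2_abs mult.assoc abs_mult [symmetric])

lemma majorant_ge_sum_squares:
  assumes "\<bar>u\<bar> \<le> R"
  shows "exp (- 2 * R) * (\<alpha>\<^sup>2 + \<beta>\<^sup>2) \<le> majorant \<alpha> \<beta> u"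
proof -
  have "\<alpha>\<^sup>2 * exp (- 2 * R) \<le> \<alpha>\<^sup>2 * exp (- 2 * u)" "\<beta>\<^sup>2 * exp (- 2 * R) \<le> \<beta>\<^sup>2 * exp (2 * u)"
    using assms by (auto intro!: mult_left_mono)
  then show ?thesis
    by (simp add: majorant_expand algebra_simps)
qed

lemma majorant_mult_cosh_le:
  assumes "\<alpha> * \<beta> \<noteq> 0" and same_side: "(t - majorant_argmin \<alpha> \<beta>) * (u - t) \<ge> 0"
  shows "majorant \<alpha> \<beta> t * cosh (2 * (u - t)) \<le> majorant \<alpha> \<beta> u"
proof -
  define h where "h = majorant_argmin \<alpha> \<beta>"
  have "sinh (2 * (t - h)) * sinh (2 * (u - t)) \<ge> 0"
    using same_side by (auto simp: zero_le_mult_iff h_def)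
  then have "cosh (2 * (t - h)) * cosh (2 * (u - t)) \<le> cosh (2 * (t - h) + 2 * (u - t))"
    unfolding cosh_add by simp
  also have "2 * (t - h) + 2 * (u - t) = 2 * (u - h)"
    by simp
  finally have "2 * \<bar>\<alpha> * \<beta>\<bar> * (cosh (2 * (t - h)) * cosh (2 * (u - t))) \<le> 2 * \<bar>\<alpha> * \<beta>\<bar> * cosh (2 * (u - h))"
    by (rule mult_left_mono) simp
  then show ?thesis
    unfolding majorant_eq_cosh[OF assms(1)] h_def by (simp only: mult_ac)
qed

lemma majorant_scale: "majorant (exp s * \<alpha>) (exp (- s) * \<beta>) (u + s) = majorant \<alpha> \<beta> u"
proof -
  have "exp s * \<alpha> * exp (- (u + s)) = \<alpha> * exp (- u)" "exp (- s) * \<beta> * exp (u + s) = \<beta> * exp u"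
    using exp_add[of s "- (u + s)"] exp_add[of "- s" "u + s"] by (simp_all add: mult_ac)
  then show ?thesis
    by (simp only: majorant_def)
qed

lemma majorant_argmin_scale:
  assumes "\<alpha> * \<beta> \<noteq> 0"
  shows "majorant_argmin (exp s * \<alpha>) (exp (- s) * \<beta>) = majorant_argmin \<alpha> \<beta> + s"
proof -
  have "exp (2 * majorant_argmin (exp s * \<alpha>) (exp (- s) * \<beta>)) = exp (2 * (majorant_argmin \<alpha> \<beta> + s))"
    using assms exp_add[of s s]
    by (simp add: exp_majorant_argmin distrib_left exp_add abs_mult exp_minus field_simps)
  then show ?thesis
    by simp
qed

lemma has_bochner_integral_exp_majorant:
  assumes "\<alpha> * \<beta> \<noteq> 0" "y > 0"
  shows "has_bochner_integral lborel (\<lambda>u. exp (- (pi * y * majorant \<alpha> \<beta> u))) (bessel_K0 (2 * pi * \<bar>\<alpha> * \<beta>\<bar> * y))"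
  using has_bochner_integral_bessel_K0[of "2 * pi * \<bar>\<alpha> * \<beta>\<bar> * y" "majorant_argmin \<alpha> \<beta>"] assms
  by (simp add: majorant_eq_cosh mult_ac)

lemma hyperbolic_gaussian_majorant:
  "hyperbolic_gaussian \<tau> (\<alpha> * exp (- u)) (\<beta> * exp u)
    = cis_2pi (Re \<tau> * (\<alpha> * \<beta>)) * of_real (exp (- (pi * Im \<tau> * majorant \<alpha> \<beta> u)))"
  by (simp only: hyperbolic_gaussian_def majorant_def exp_mult_cancel)

text \<open>Replaces the Gaussian concentrated around \<open>majorant_argmin \<alpha> \<beta>\<close> by its total mass placed at that point, and
  measures the difference against \<open>sgn (t - u) / 2\<close>.\<close>
definition concentration_error :: "real \<Rightarrow> real \<Rightarrow> real \<Rightarrow> real \<Rightarrow> real" where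
  "concentration_error y \<alpha> \<beta> t =
     (LINT u|lborel. exp (- (pi * y * majorant \<alpha> \<beta> u)) * ((sgn (t - majorant_argmin \<alpha> \<beta>) - sgn (t - u)) / 2))"

lemma integrable_mult_sgn_difference:
  fixes g :: "real \<Rightarrow> real"
  assumes "integrable lborel g" "\<bar>c\<bar> \<le> 1"
  shows "integrable lborel (\<lambda>u. g u * ((c - sgn (t - u)) / 2))"
proof (rule Bochner_Integration.integrable_bound[OF assms(1)])
  have [measurable]: "g \<in> borel_measurable lborel"
    using assms by auto
  show "(\<lambda>u. g u * ((c - sgn (t - u)) / 2)) \<in> borel_measurable lborel"
    by measurable
  have "\<bar>(c - sgn (t - u)) / 2\<bar> \<le> 1" for u
    using assms(2) by (auto simp: sgn_real_def)
  then have "norm (g u * ((c - sgn (t - u)) / 2)) \<le> norm (g u)" for u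
    unfolding real_norm_def abs_mult[of "g u"] by (intro mult_left_le) auto
  then show "AE u in lborel. norm (g u * ((c - sgn (t - u)) / 2)) \<le> norm (g u)"
    by simp
qed

lemma abs_concentration_error_le:
  assumes ab: "\<alpha> * \<beta> \<noteq> 0" and y: "y > 0"
  shows "\<bar>concentration_error y \<alpha> \<beta> t\<bar> \<le> bessel_K0 (pi * y * majorant \<alpha> \<beta> t)"
proof -
  define R where "R = majorant \<alpha> \<beta> t"
  have "2 * \<bar>\<alpha> * \<beta>\<bar> > 0"
    using ab by simp
  with majorant_ge[of \<alpha> \<beta> t] have "R > 0"
    unfolding R_def by linarith
  let ?g = "\<lambda>u. exp (- (pi * y * majorant \<alpha> \<beta> u))"
  let ?w = "\<lambda>u. (sgn (t - majorant_argmin \<alpha> \<beta>) - sgn (t - u)) / 2"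
  have bound: "norm (?g u * ?w u) \<le> exp (- (pi * y * R) * cosh (2 * (u - t)))" for u
  proof (cases "?w u = 0")
    case False
    then have "(t - majorant_argmin \<alpha> \<beta>) * (u - t) \<ge> 0"
      by (auto simp: zero_le_mult_iff not_less sgn_real_def split: if_splits)
    then have "pi * y * (R * cosh (2 * (u - t))) \<le> pi * y * majorant \<alpha> \<beta> u"
      unfolding R_def using y by (intro mult_left_mono majorant_mult_cosh_le ab) auto
    moreover have "\<bar>?w u\<bar> \<le> 1"
      by (auto simp: sgn_real_def)
    ultimately have "?g u * \<bar>?w u\<bar> \<le> exp (- (pi * y * R) * cosh (2 * (u - t))) * 1"
      by (intro mult_mono) (auto simp: mult.assoc)
    then show ?thesis
      by (simp add: abs_mult)
  qed simp
  have "integrable lborel ?g"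
    using has_bochner_integral_exp_majorant[OF ab y] by (simp add: has_bochner_integral_iff)
  then have "integrable lborel (\<lambda>u. norm (?g u * ?w u))"
    by (intro integrable_norm integrable_mult_sgn_difference) (simp_all add: sgn_real_def)
  then have "has_bochner_integral lborel (\<lambda>u. norm (?g u * ?w u)) (LINT u|lborel. norm (?g u * ?w u))"
    by (rule has_bochner_integral_integrable)
  moreover have "has_bochner_integral lborel (\<lambda>u. exp (- (pi * y * R) * cosh (2 * (u - t)))) (bessel_K0 (pi * y * R))"
    using \<open>R > 0\<close> y by (intro has_bochner_integral_bessel_K0) simp
  ultimately have "(LINT u|lborel. norm (?g u * ?w u)) \<le> bessel_K0 (pi * y * R)"
    using bound by (rule has_bochner_integral_mono)
  with integral_norm_bound[of lborel "\<lambda>u. ?g u * ?w u"]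
  have "norm (LINT u|lborel. ?g u * ?w u) \<le> bessel_K0 (pi * y * R)"
    by (rule order_trans)
  then show ?thesis
    by (simp only: concentration_error_def R_def real_norm_def)
qed

lemma concentration_error_scale:
  assumes ab: "\<alpha> * \<beta> \<noteq> 0"
  shows "concentration_error y (exp s * \<alpha>) (exp (- s) * \<beta>) (t + s) = concentration_error y \<alpha> \<beta> t"
  unfolding concentration_error_def majorant_argmin_scale[OF ab]
  using majorant_scale[of s \<alpha> \<beta>]
  by (subst lborel_integral_real_affine[of 1 _ s]) (simp_all add: add.commute)

definition oriented_integral :: "real \<Rightarrow> real \<Rightarrow> (real \<Rightarrow> 'a::banach) \<Rightarrow> 'a" where
  "oriented_integral t1 t2 f = sgn (t2 - t1) *\<^sub>R integral {min t1 t2..max t1 t2} f"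

lemma integral_sgn_difference:
  fixes g :: "real \<Rightarrow> real"
  assumes g: "integrable lborel g"
  shows "(LINT u|lborel. g u * ((sgn (t2 - u) - sgn (t1 - u)) / 2)) = oriented_integral t1 t2 g"
proof -
  have [measurable]: "g \<in> borel_measurable lborel"
    using g by auto
  have "(LINT u|lborel. g u * ((sgn (t2 - u) - sgn (t1 - u)) / 2))
      = (LINT u|lborel. sgn (t2 - t1) * (indicator {min t1 t2..max t1 t2} u *\<^sub>R g u))"
  proof (rule integral_cong_AE)
    show "AE u in lborel. g u * ((sgn (t2 - u) - sgn (t1 - u)) / 2)
        = sgn (t2 - t1) * (indicator {min t1 t2..max t1 t2} u *\<^sub>R g u)"
      using AE_lborel_singleton[of t1] AE_lborel_singleton[of t2]
      by eventually_elim (auto simp: sgn_real_def indicator_def min_def max_def)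
  qed measurable
  moreover have "set_integrable lborel {min t1 t2..max t1 t2} g"
    unfolding set_integrable_def by (rule integrable_mult_indicator[OF _ g]) simp
  from set_borel_integral_eq_integral(2)[OF this]
  have "(LINT u|lborel. sgn (t2 - t1) * (indicator {min t1 t2..max t1 t2} u *\<^sub>R g u)) = oriented_integral t1 t2 g"
    by (simp add: set_lebesgue_integral_def oriented_integral_def)
  ultimately show ?thesis
    by simp
qed

lemma bessel_K0_decomposition:
  assumes ab: "\<alpha> * \<beta> \<noteq> 0" and y: "y > 0"
  shows "(sgn (t2 - majorant_argmin \<alpha> \<beta>) - sgn (t1 - majorant_argmin \<alpha> \<beta>)) / 2 * bessel_K0 (2 * pi * \<bar>\<alpha> * \<beta>\<bar> * y)
    = concentration_error y \<alpha> \<beta> t2 - concentration_error y \<alpha> \<beta> t1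
      + oriented_integral t1 t2 (\<lambda>u. exp (- (pi * y * majorant \<alpha> \<beta> u)))"
proof -
  define g where "g = (\<lambda>u. exp (- (pi * y * majorant \<alpha> \<beta> u)))"
  define w where "w t u = (sgn (t - majorant_argmin \<alpha> \<beta>) - sgn (t - u)) / 2" for t u
  define d where "d = (sgn (t2 - majorant_argmin \<alpha> \<beta>) - sgn (t1 - majorant_argmin \<alpha> \<beta>)) / 2"
  have g: "integrable lborel g" "(LINT u|lborel. g u) = bessel_K0 (2 * pi * \<bar>\<alpha> * \<beta>\<bar> * y)"
    using has_bochner_integral_exp_majorant[OF ab y] by (auto simp: has_bochner_integral_iff g_def)
  have int_product: "integrable lborel (\<lambda>u. g u * w t u)" for t
    unfolding w_def by (rule integrable_mult_sgn_difference[OF g(1)]) (simp add: sgn_real_def)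
  have "g u * ((sgn (t2 - u) - sgn (t1 - u)) / 2) = g u * d - (g u * w t2 u - g u * w t1 u)" for u
    by (simp add: d_def w_def field_simps)
  then have "oriented_integral t1 t2 g = (LINT u|lborel. g u * d - (g u * w t2 u - g u * w t1 u))"
    unfolding integral_sgn_difference[OF g(1), symmetric] by (simp only:)
  also have "\<dots> = (LINT u|lborel. g u) * d - (concentration_error y \<alpha> \<beta> t2 - concentration_error y \<alpha> \<beta> t1)"
    using g(1) int_product by (simp add: concentration_error_def g_def w_def)
  finally show ?thesis
    unfolding g(2) unfolding d_def g_def by simp
qed

subsection \<open>Bessel series and integrals of theta functions\<close>

lemma has_sum_diff:
  fixes f g :: "'a \<Rightarrow> complex"
  assumes "(f has_sum x) A" "(g has_sum y) A"
  shows "((\<lambda>n. f n - g n) has_sum (x - y)) A"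
  using has_sum_add[OF assms(1) has_sum_uminusI[OF assms(2)]] by simp

lemma has_sum_oriented_integral_dominated:
  fixes f :: "'i \<Rightarrow> real \<Rightarrow> complex"
  assumes "\<And>i. continuous_on UNIV (f i)"
    and "\<And>i u. \<bar>u\<bar> \<le> \<bar>t1\<bar> + \<bar>t2\<bar> \<Longrightarrow> norm (f i u) \<le> M i" and "M summable_on UNIV"
  shows "((\<lambda>i. oriented_integral t1 t2 (f i)) has_sum oriented_integral t1 t2 (\<lambda>u. \<Sum>\<^sub>\<infinity>i. f i u)) UNIV"
  unfolding oriented_integral_def
proof (intro has_sum_scaleR has_sum_integral_dominated[where M = M])
  show "continuous_on {min t1 t2..max t1 t2} (f i)" for i
    using assms(1) continuous_on_subset by blast
  show "norm (f i u) \<le> M i" if "u \<in> {min t1 t2..max t1 t2}" for i u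
    using that by (intro assms(2)) auto
qed fact

lemma oriented_integral_cmult:
  fixes g :: "real \<Rightarrow> real"
  assumes "continuous_on UNIV g"
  shows "oriented_integral t1 t2 (\<lambda>u. k * complex_of_real (g u)) = k * of_real (oriented_integral t1 t2 g)"
proof -
  let ?I = "{min t1 t2..max t1 t2}"
  have "(g has_integral integral ?I g) ?I"
    using assms continuous_on_subset by (blast intro: integrable_integral integrable_continuous_real)
  then have "integral ?I (\<lambda>u. k * of_real (g u)) = k * of_real (integral ?I g)"
    by (intro integral_unique has_integral_mult_right has_integral_of_real)
  then show ?thesis
    unfolding oriented_integral_def by (simp add: scaleR_conv_of_real)
qed

lemma oriented_integral_mult_right:
  "oriented_integral t1 t2 (\<lambda>u. k * f u) = k * oriented_integral t1 t2 (f :: real \<Rightarrow> complex)"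
  by (simp add: oriented_integral_def)

lemma sum_infsum_cong:
  fixes F G :: "'j \<Rightarrow> 'a \<Rightarrow> 'b::{topological_comm_monoid_add, t2_space}"
  assumes "finite J" and "\<And>n. (\<Sum>j\<in>J. F j n) = (\<Sum>j\<in>J. G j n)"
    and "\<And>j. j \<in> J \<Longrightarrow> F j summable_on UNIV" "\<And>j. j \<in> J \<Longrightarrow> G j summable_on UNIV"
  shows "(\<Sum>j\<in>J. infsum (F j) UNIV) = (\<Sum>j\<in>J. infsum (G j) UNIV)"
proof (rule has_sum_unique)
  show "((\<lambda>n. \<Sum>j\<in>J. F j n) has_sum (\<Sum>j\<in>J. infsum (F j) UNIV)) UNIV"
    by (intro has_sum_sum has_sum_infsum assms)
  show "((\<lambda>n. \<Sum>j\<in>J. F j n) has_sum (\<Sum>j\<in>J. infsum (G j) UNIV)) UNIV"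
    unfolding assms(2) by (intro has_sum_sum has_sum_infsum assms)
qed

context hyperbolic_form
begin

abbreviation \<alpha> :: "int \<times> int \<Rightarrow> real" where
  "\<alpha> n \<equiv> a \<bullet> of_int_pair n"

abbreviation \<beta> :: "int \<times> int \<Rightarrow> real" where
  "\<beta> n \<equiv> b \<bullet> of_int_pair n"

definition anisotropic :: "(int \<times> int \<Rightarrow> complex) \<Rightarrow> bool" where
  "anisotropic m \<longleftrightarrow> (\<exists>B. \<forall>n. norm (m n) \<le> B) \<and> (\<forall>n. m n \<noteq> 0 \<longrightarrow> qform n \<noteq> 0)"

definition crossing :: "real \<Rightarrow> real \<Rightarrow> int \<times> int \<Rightarrow> real" where
  "crossing t1 t2 n = (sgn (t2 - majorant_argmin (\<alpha> n) (\<beta> n)) - sgn (t1 - majorant_argmin (\<alpha> n) (\<beta> n))) / 2"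

definition bessel_term :: "(int \<times> int \<Rightarrow> complex) \<Rightarrow> complex \<Rightarrow> real \<Rightarrow> real \<Rightarrow> int \<times> int \<Rightarrow> complex" where
  "bessel_term m \<tau> t1 t2 n = m n * of_real (crossing t1 t2 n) * cis_2pi (Re \<tau> * qform n) *
     of_real (bessel_K0 (2 * pi * \<bar>qform n\<bar> * Im \<tau>))"

definition error_term :: "(int \<times> int \<Rightarrow> complex) \<Rightarrow> complex \<Rightarrow> real \<Rightarrow> int \<times> int \<Rightarrow> complex" where
  "error_term m \<tau> t n = m n * cis_2pi (Re \<tau> * qform n) * of_real (concentration_error (Im \<tau>) (\<alpha> n) (\<beta> n) t)"

definition theta_term :: "(int \<times> int \<Rightarrow> complex) \<Rightarrow> complex \<Rightarrow> real \<Rightarrow> int \<times> int \<Rightarrow> complex" where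
  "theta_term m \<tau> u n = m n * hyperbolic_gaussian \<tau> (\<alpha> n * exp (- u)) (\<beta> n * exp u)"

definition bessel_series :: "(int \<times> int \<Rightarrow> complex) \<Rightarrow> complex \<Rightarrow> real \<Rightarrow> real \<Rightarrow> complex" where
  "bessel_series m \<tau> t1 t2 = infsum (bessel_term m \<tau> t1 t2) UNIV"

definition error_series :: "(int \<times> int \<Rightarrow> complex) \<Rightarrow> complex \<Rightarrow> real \<Rightarrow> complex" where
  "error_series m \<tau> t = infsum (error_term m \<tau> t) UNIV"

definition theta_integral :: "(int \<times> int \<Rightarrow> complex) \<Rightarrow> complex \<Rightarrow> real \<Rightarrow> real \<Rightarrow> complex" where
  "theta_integral m \<tau> t1 t2 = oriented_integral t1 t2 (\<lambda>u. infsum (theta_term m \<tau> u) UNIV)"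

lemma anisotropicD: "anisotropic m \<Longrightarrow> m n \<noteq> 0 \<Longrightarrow> qform n \<noteq> 0"
  unfolding anisotropic_def by blast

lemma anisotropic_bounded:
  assumes "anisotropic m"
  obtains B where "\<And>n. norm (m n) \<le> B"
  using assms unfolding anisotropic_def by blast

lemma abs_qform_ge: "qform n \<noteq> 0 \<Longrightarrow> 2 * \<bar>qform n\<bar> \<ge> 1"
proof -
  assume "qform n \<noteq> 0"
  then have "\<bar>n \<bullet>\<^sub>Z gram n\<bar> \<ge> 1"
    by (simp add: qform_def)
  then have "1 \<le> \<bar>real_of_int (n \<bullet>\<^sub>Z gram n)\<bar>"
    by linarith
  then show ?thesis
    by (simp add: qform_def)
qed

definition decay :: "real \<Rightarrow> real \<Rightarrow> int \<times> int \<Rightarrow> real" where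
  "decay y R n = exp (- (pi * y * (exp (- 2 * R) * \<kappa>)) * (norm (of_int_pair n))\<^sup>2)"

lemma decay_nonneg: "decay y R n \<ge> 0"
  by (simp add: decay_def)

lemma summable_decay: "y > 0 \<Longrightarrow> decay y R summable_on UNIV"
  using summable_gaussian_int_pair[of "pi * y * (exp (- 2 * R) * \<kappa>)" 0] \<kappa>_pos
  by (simp add: decay_def [abs_def])

lemma exp_majorant_le:
  assumes "y > 0" "\<bar>u\<bar> \<le> R"
  shows "exp (- (pi * y * majorant (\<alpha> n) (\<beta> n) u)) \<le> decay y R n"
proof -
  have "exp (- 2 * R) * (\<kappa> * (norm (of_int_pair n))\<^sup>2) \<le> exp (- 2 * R) * ((\<alpha> n)\<^sup>2 + (\<beta> n)\<^sup>2)"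
    by (intro mult_left_mono sum_squares_ge) simp
  also have "\<dots> \<le> majorant (\<alpha> n) (\<beta> n) u"
    by (rule majorant_ge_sum_squares[OF assms(2)])
  finally have "pi * y * (exp (- 2 * R) * (\<kappa> * (norm (of_int_pair n))\<^sup>2)) \<le> pi * y * majorant (\<alpha> n) (\<beta> n) u"
    using assms(1) by (intro mult_left_mono) auto
  then show ?thesis
    by (simp add: decay_def mult_ac)
qed

lemma norm_error_term_le:
  assumes m: "anisotropic m" and y: "Im \<tau> > 0" and B: "\<And>n. norm (m n) \<le> B"
  shows "norm (error_term m \<tau> t n) \<le> B * (decay (Im \<tau>) \<bar>t\<bar> n * sqrt (1 / Im \<tau>))"
proof (cases "m n = 0")
  case True
  then have "B \<ge> 0"
    using B[of n] by simp
  with True y show ?thesis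
    by (simp add: error_term_def decay_nonneg)
next
  case False
  let ?R = "majorant (\<alpha> n) (\<beta> n) t"
  have qform: "qform n \<noteq> 0"
    using m False by (rule anisotropicD)
  then have ab: "\<alpha> n * \<beta> n \<noteq> 0"
    by (simp add: qform_factor)
  have R: "?R \<ge> 1"
    using abs_qform_ge[OF qform] majorant_ge[of "\<alpha> n" "\<beta> n" t] by (simp add: qform_factor)
  have "\<bar>concentration_error (Im \<tau>) (\<alpha> n) (\<beta> n) t\<bar> \<le> bessel_K0 (pi * Im \<tau> * ?R)"
    by (rule abs_concentration_error_le[OF ab y])
  also have "\<dots> \<le> exp (- (pi * Im \<tau> * ?R)) * sqrt (pi / (pi * Im \<tau> * ?R))"
    using y R by (intro bessel_K0_le) simp
  also have "\<dots> \<le> decay (Im \<tau>) \<bar>t\<bar> n * sqrt (1 / Im \<tau>)"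
  proof (rule mult_mono)
    show "exp (- (pi * Im \<tau> * ?R)) \<le> decay (Im \<tau>) \<bar>t\<bar> n"
      by (rule exp_majorant_le[OF y order_refl])
    have "1 / (Im \<tau> * ?R) \<le> 1 / Im \<tau>"
      using y R by (intro divide_left_mono) auto
    then show "sqrt (pi / (pi * Im \<tau> * ?R)) \<le> sqrt (1 / Im \<tau>)"
      by (simp add: mult.assoc)
  qed (use y R decay_nonneg in \<open>auto intro!: mult_nonneg_nonneg\<close>)
  finally have "norm (m n) * \<bar>concentration_error (Im \<tau>) (\<alpha> n) (\<beta> n) t\<bar>
      \<le> B * (decay (Im \<tau>) \<bar>t\<bar> n * sqrt (1 / Im \<tau>))"
    using order_trans[OF norm_ge_zero B[of n]] by (intro mult_mono B) auto
  then show ?thesis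
    by (simp add: error_term_def norm_mult)
qed

lemma summable_error_term:
  assumes m: "anisotropic m" and y: "Im \<tau> > 0"
  shows "error_term m \<tau> t summable_on UNIV"
proof -
  obtain B where "\<And>n. norm (m n) \<le> B"
    using anisotropic_bounded[OF m] by blast
  then have "norm (error_term m \<tau> t n) \<le> B * (decay (Im \<tau>) \<bar>t\<bar> n * sqrt (1 / Im \<tau>))" for n
    by (rule norm_error_term_le[OF m y])
  moreover have "(\<lambda>n. B * (decay (Im \<tau>) \<bar>t\<bar> n * sqrt (1 / Im \<tau>))) summable_on UNIV"
    by (intro summable_on_cmult_right summable_on_cmult_left summable_decay y)
  ultimately show ?thesis
    by (blast intro: abs_summable_summable Infinite_Sum.abs_summable_on_comparison_test')
qed

lemma theta_term_eq:
  "theta_term m \<tau> u n = m n * cis_2pi (Re \<tau> * qform n) * of_real (exp (- (pi * Im \<tau> * majorant (\<alpha> n) (\<beta> n) u)))"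
  by (simp add: theta_term_def hyperbolic_gaussian_majorant qform_factor)

lemma has_sum_theta_integral:
  assumes m: "anisotropic m" and y: "Im \<tau> > 0"
  shows "((\<lambda>n. m n * cis_2pi (Re \<tau> * qform n)
      * of_real (oriented_integral t1 t2 (\<lambda>u. exp (- (pi * Im \<tau> * majorant (\<alpha> n) (\<beta> n) u)))))
    has_sum theta_integral m \<tau> t1 t2) UNIV"
proof -
  obtain B where B: "\<And>n. norm (m n) \<le> B"
    using anisotropic_bounded[OF m] by blast
  have B_nonneg: "B \<ge> 0"
    using B[of 0] norm_ge_zero order_trans by blast
  have "((\<lambda>n. oriented_integral t1 t2 (\<lambda>u. theta_term m \<tau> u n)) has_sum theta_integral m \<tau> t1 t2) UNIV"
    unfolding theta_integral_def
  proof (rule has_sum_oriented_integral_dominated)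
    show "continuous_on UNIV (\<lambda>u. theta_term m \<tau> u n)" for n
      unfolding theta_term_eq by (intro continuous_intros)
    show "norm (theta_term m \<tau> u n) \<le> B * decay (Im \<tau>) (\<bar>t1\<bar> + \<bar>t2\<bar>) n" if "\<bar>u\<bar> \<le> \<bar>t1\<bar> + \<bar>t2\<bar>" for n u
      using mult_mono[OF B exp_majorant_le[OF y that] B_nonneg] by (simp add: theta_term_eq norm_mult)
    show "(\<lambda>n. B * decay (Im \<tau>) (\<bar>t1\<bar> + \<bar>t2\<bar>) n) summable_on UNIV"
      by (intro summable_on_cmult_right summable_decay y)
  qed
  then show ?thesis
    unfolding theta_term_eq by (subst (asm) oriented_integral_cmult) (auto intro!: continuous_intros)
qed

lemma bessel_term_decomposition:
  assumes m: "anisotropic m" and y: "Im \<tau> > 0"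
  shows "bessel_term m \<tau> t1 t2 n = error_term m \<tau> t2 n - error_term m \<tau> t1 n + m n * cis_2pi (Re \<tau> * qform n)
    * of_real (oriented_integral t1 t2 (\<lambda>u. exp (- (pi * Im \<tau> * majorant (\<alpha> n) (\<beta> n) u))))"
proof (cases "m n = 0")
  case False
  then have "\<alpha> n * \<beta> n \<noteq> 0"
    using anisotropicD[OF m] by (simp add: qform_factor)
  from bessel_K0_decomposition[OF this y, of t2 t1]
  have decomposition: "crossing t1 t2 n * bessel_K0 (2 * pi * \<bar>qform n\<bar> * Im \<tau>)
      = concentration_error (Im \<tau>) (\<alpha> n) (\<beta> n) t2 - concentration_error (Im \<tau>) (\<alpha> n) (\<beta> n) t1
        + oriented_integral t1 t2 (\<lambda>u. exp (- (pi * Im \<tau> * majorant (\<alpha> n) (\<beta> n) u)))"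
    by (simp only: crossing_def qform_factor)
  have "bessel_term m \<tau> t1 t2 n
      = m n * cis_2pi (Re \<tau> * qform n) * of_real (crossing t1 t2 n * bessel_K0 (2 * pi * \<bar>qform n\<bar> * Im \<tau>))"
    by (simp add: bessel_term_def)
  then show ?thesis
    unfolding decomposition error_term_def by (simp only: of_real_add of_real_diff ring_distribs)
qed (simp add: bessel_term_def error_term_def)

lemma has_sum_bessel_series:
  assumes "anisotropic m" "Im \<tau> > 0"
  shows "(bessel_term m \<tau> t1 t2 has_sum (error_series m \<tau> t2 - error_series m \<tau> t1 + theta_integral m \<tau> t1 t2)) UNIV"
  unfolding bessel_term_decomposition[OF assms, abs_def] error_series_def
  by (intro has_sum_add has_sum_diff has_sum_infsum summable_error_term has_sum_theta_integral assms)

lemma summable_bessel_term: "anisotropic m \<Longrightarrow> Im \<tau> > 0 \<Longrightarrow> bessel_term m \<tau> t1 t2 summable_on UNIV"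
  using has_sum_bessel_series has_sum_imp_summable by blast

lemma bessel_series_decomposition:
  assumes "anisotropic m" "Im \<tau> > 0"
  shows "bessel_series m \<tau> t1 t2 = error_series m \<tau> t2 - error_series m \<tau> t1 + theta_integral m \<tau> t1 t2"
  unfolding bessel_series_def by (rule infsumI[OF has_sum_bessel_series[OF assms]])

lemma bessel_series_additive:
  assumes "anisotropic m" "Im \<tau> > 0"
  shows "bessel_series m \<tau> t1 t2 + bessel_series m \<tau> t2 t3 = bessel_series m \<tau> t1 t3"
proof -
  have "crossing t1 t3 n = crossing t1 t2 n + crossing t2 t3 n" for n
    by (simp add: crossing_def field_simps)
  then have "bessel_term m \<tau> t1 t3 = (\<lambda>n. bessel_term m \<tau> t1 t2 n + bessel_term m \<tau> t2 t3 n)"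
    by (simp add: bessel_term_def ring_distribs fun_eq_iff)
  then show ?thesis
    unfolding bessel_series_def using summable_bessel_term[OF assms] by (simp add: infsum_add)
qed

definition hyperbolic_shift :: "(int \<times> int \<Rightarrow> int \<times> int) \<Rightarrow> real \<Rightarrow> bool" where
  "hyperbolic_shift g s \<longleftrightarrow> bij g \<and> (\<forall>n. \<alpha> (g n) = exp s * \<alpha> n \<and> \<beta> (g n) = exp (- s) * \<beta> n)"

lemma hyperbolic_shiftD:
  assumes "hyperbolic_shift g s"
  shows "bij g" "\<alpha> (g n) = exp s * \<alpha> n" "\<beta> (g n) = exp (- s) * \<beta> n"
  using assms unfolding hyperbolic_shift_def by blast+

lemma qform_hyperbolic_shift: "hyperbolic_shift g s \<Longrightarrow> qform (g n) = qform n"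
  by (simp add: qform_factor hyperbolic_shiftD exp_minus field_simps)

lemma anisotropic_compose: "hyperbolic_shift g s \<Longrightarrow> anisotropic m \<Longrightarrow> anisotropic (m \<circ> g)"
  unfolding anisotropic_def o_def by (metis qform_hyperbolic_shift)

lemma error_series_shift:
  assumes g: "hyperbolic_shift g s" and m: "anisotropic m"
  shows "error_series m \<tau> (t + s) = error_series (m \<circ> g) \<tau> t"
proof -
  have "error_term m \<tau> (t + s) (g n) = error_term (m \<circ> g) \<tau> t n" for n
  proof (cases "m (g n) = 0")
    case False
    then have "\<alpha> n * \<beta> n \<noteq> 0"
      using anisotropicD[OF m] qform_hyperbolic_shift[OF g] by (metis qform_factor)
    then show ?thesis
      by (simp add: error_term_def qform_hyperbolic_shift[OF g] hyperbolic_shiftD[OF g] concentration_error_scale)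
  qed (simp add: error_term_def)
  then show ?thesis
    unfolding error_series_def using infsum_reindex_bij_betw[OF hyperbolic_shiftD(1)[OF g], of "error_term m \<tau> (t + s)"]
    by simp
qed

lemma bessel_series_shift:
  assumes g: "hyperbolic_shift g s" and m: "anisotropic m"
  shows "bessel_series m \<tau> (t1 + s) (t2 + s) = bessel_series (m \<circ> g) \<tau> t1 t2"
proof -
  have "bessel_term m \<tau> (t1 + s) (t2 + s) (g n) = bessel_term (m \<circ> g) \<tau> t1 t2 n" for n
  proof (cases "m (g n) = 0")
    case False
    then have "\<alpha> n * \<beta> n \<noteq> 0"
      using anisotropicD[OF m] qform_hyperbolic_shift[OF g] by (metis qform_factor)
    then show ?thesis
      by (simp add: bessel_term_def crossing_def qform_hyperbolic_shift[OF g] hyperbolic_shiftD[OF g] majorant_argmin_scale)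
  qed (simp add: bessel_term_def)
  then show ?thesis
    unfolding bessel_series_def
    using infsum_reindex_bij_betw[OF hyperbolic_shiftD(1)[OF g], of "bessel_term m \<tau> (t1 + s) (t2 + s)"] by simp
qed

lemma exp_scale_cancel: "exp (- u) * x * (exp u * y) = x * (y :: real)"
  using exp_mult_cancel[of x u y] by (simp add: mult_ac)

lemma hyperbolic_form_rescale: "hyperbolic_form p q r (exp (- u) *\<^sub>R a) (exp u *\<^sub>R b)"
proof
  show "2 * (fst (exp (- u) *\<^sub>R a) * fst (exp u *\<^sub>R b)) = of_int p"
    "2 * (snd (exp (- u) *\<^sub>R a) * snd (exp u *\<^sub>R b)) = of_int r"
    "fst (exp (- u) *\<^sub>R a) * snd (exp u *\<^sub>R b) + snd (exp (- u) *\<^sub>R a) * fst (exp u *\<^sub>R b) = of_int q"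
    "fst (exp (- u) *\<^sub>R a) * snd (exp u *\<^sub>R b) \<noteq> snd (exp (- u) *\<^sub>R a) * fst (exp u *\<^sub>R b)"
    using coefficients nondegenerate by (simp_all only: fst_scaleR snd_scaleR real_scaleR_def exp_scale_cancel) simp_all
qed

lemma theta_term_modular:
  assumes L: "L > 0" and m: "periodic L m" and M: "M \<in> principal_congruence (theta_level L)" and \<tau>: "Im \<tau> > 0"
  shows "infsum (theta_term m (moebius M \<tau>) u) UNIV
    = theta_multiplier L M * of_real (norm (automorphy_factor M \<tau>)) * infsum (theta_term m \<tau> u) UNIV"
proof -
  interpret U: hyperbolic_form p q r "exp (- u) *\<^sub>R a" "exp u *\<^sub>R b"
    by (rule hyperbolic_form_rescale)
  have theta: "U.theta m \<tau> = infsum (theta_term m \<tau> u) UNIV" for \<tau>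
    unfolding U.theta_def theta_term_def by (simp add: mult.commute)
  have "U.wedge = wedge"
    by (simp add: U.wedge_def wedge_def exp_scale_cancel mult.commute[of "exp u * _"])
  then have "U.theta_multiplier L M = theta_multiplier L M"
    by (simp add: U.theta_multiplier_def theta_multiplier_def)
  then show ?thesis
    using U.theta_modular[OF L m M \<tau>] by (simp add: theta)
qed

lemma theta_integral_modular:
  assumes "L > 0" "periodic L m" "M \<in> principal_congruence (theta_level L)" "Im \<tau> > 0"
  shows "theta_integral m (moebius M \<tau>) t1 t2
    = theta_multiplier L M * of_real (norm (automorphy_factor M \<tau>)) * theta_integral m \<tau> t1 t2"
  unfolding theta_integral_def theta_term_modular[OF assms] by (rule oriented_integral_mult_right)

end

locale shift_cocycle = hyperbolic_form p q r a b for p q r a b +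
  fixes J :: "'j set" and m :: "'j \<Rightarrow> int \<times> int \<Rightarrow> complex" and g :: "'j \<Rightarrow> int \<times> int \<Rightarrow> int \<times> int" and s :: "'j \<Rightarrow> real"
  assumes finite_J: "finite J"
    and anisotropic: "\<And>j. j \<in> J \<Longrightarrow> anisotropic (m j)"
    and shift: "\<And>j. j \<in> J \<Longrightarrow> hyperbolic_shift (g j) (s j)"
    and cocycle: "\<And>n. (\<Sum>j\<in>J. m j n - m j (g j n)) = 0"
begin

definition total_series :: "real \<Rightarrow> complex \<Rightarrow> complex" where
  "total_series t \<tau> = (\<Sum>j\<in>J. bessel_series (m j) \<tau> t (t + s j))"

lemma sum_mult_shift: "(\<Sum>j\<in>J. m j n * c) = (\<Sum>j\<in>J. (m j \<circ> g j) n * c)"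
  using cocycle[of n] by (simp add: sum_distrib_right [symmetric] sum_subtractf)

lemma anisotropic_shift: "j \<in> J \<Longrightarrow> anisotropic (m j \<circ> g j)"
  by (rule anisotropic_compose[OF shift anisotropic])

lemma total_series_eq_theta_integral:
  assumes "Im \<tau> > 0"
  shows "total_series t \<tau> = (\<Sum>j\<in>J. theta_integral (m j) \<tau> t (t + s j))"
proof -
  have "(\<Sum>j\<in>J. error_series (m j) \<tau> t) = (\<Sum>j\<in>J. error_series (m j \<circ> g j) \<tau> t)"
    unfolding error_series_def
  proof (rule sum_infsum_cong[OF finite_J])
    show "(\<Sum>j\<in>J. error_term (m j) \<tau> t n) = (\<Sum>j\<in>J. error_term (m j \<circ> g j) \<tau> t n)" for n
      unfolding error_term_def mult.assoc by (rule sum_mult_shift)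
  qed (simp_all add: summable_error_term assms anisotropic anisotropic_shift)
  also have "\<dots> = (\<Sum>j\<in>J. error_series (m j) \<tau> (t + s j))"
    by (intro sum.cong refl error_series_shift [symmetric] shift anisotropic)
  finally show ?thesis
    unfolding total_series_def
    by (simp add: bessel_series_decomposition[OF anisotropic assms] sum.distrib sum_subtractf cong: sum.cong)
qed

lemma total_series_independent:
  assumes "Im \<tau> > 0"
  shows "total_series t \<tau> = total_series t' \<tau>"
proof -
  have "(\<Sum>j\<in>J. bessel_series (m j) \<tau> t t') = (\<Sum>j\<in>J. bessel_series (m j \<circ> g j) \<tau> t t')"
    unfolding bessel_series_def
  proof (rule sum_infsum_cong[OF finite_J])
    show "(\<Sum>j\<in>J. bessel_term (m j) \<tau> t t' n) = (\<Sum>j\<in>J. bessel_term (m j \<circ> g j) \<tau> t t' n)" for n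
      unfolding bessel_term_def mult.assoc by (rule sum_mult_shift)
  qed (simp_all add: summable_bessel_term assms anisotropic anisotropic_shift)
  also have "\<dots> = (\<Sum>j\<in>J. bessel_series (m j) \<tau> (t + s j) (t' + s j))"
    by (intro sum.cong refl bessel_series_shift [symmetric] shift anisotropic)
  finally have "(\<Sum>j\<in>J. bessel_series (m j) \<tau> t t') = (\<Sum>j\<in>J. bessel_series (m j) \<tau> (t + s j) (t' + s j))" .
  moreover have "total_series t \<tau> + (\<Sum>j\<in>J. bessel_series (m j) \<tau> (t + s j) (t' + s j))
      = (\<Sum>j\<in>J. bessel_series (m j) \<tau> t t') + total_series t' \<tau>"
    unfolding total_series_def sum.distrib [symmetric]
    by (intro sum.cong refl) (simp add: bessel_series_additive anisotropic assms)
  ultimately show ?thesis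
    by simp
qed

lemma total_series_modular:
  assumes L: "L > 0" and per: "\<And>j. j \<in> J \<Longrightarrow> periodic L (m j)"
    and M: "M \<in> principal_congruence (theta_level L)" and \<tau>: "Im \<tau> > 0"
  shows "of_real (sqrt (Im (moebius M \<tau>))) * total_series t (moebius M \<tau>)
    = theta_multiplier L M * (of_real (sqrt (Im \<tau>)) * total_series t \<tau>)"
proof -
  define j where "j = automorphy_factor M \<tau>"
  have det: "det M = 1"
    by (rule det_principal_congruence[OF M])
  have j: "j \<noteq> 0"
    unfolding j_def by (rule automorphy_factor_nonzero[OF det \<tau>])
  have Im_M: "Im (moebius M \<tau>) = Im \<tau> / (norm j)\<^sup>2"
    unfolding j_def by (rule Im_moebius[OF det])
  have "total_series t (moebius M \<tau>) = (\<Sum>i\<in>J. theta_integral (m i) (moebius M \<tau>) t (t + s i))"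
    by (rule total_series_eq_theta_integral[OF Im_moebius_pos[OF det \<tau>]])
  also have "\<dots> = theta_multiplier L M * of_real (norm j) * total_series t \<tau>"
    unfolding total_series_eq_theta_integral[OF \<tau>] sum_distrib_left j_def
    by (intro sum.cong refl theta_integral_modular L per M \<tau>)
  finally have "of_real (sqrt (Im (moebius M \<tau>))) * total_series t (moebius M \<tau>)
      = theta_multiplier L M * (of_real (sqrt (Im (moebius M \<tau>)) * norm j) * total_series t \<tau>)"
    by simp
  also have "sqrt (Im (moebius M \<tau>)) * norm j = sqrt (Im \<tau>)"
    using j by (simp add: Im_M real_sqrt_divide)
  finally show ?thesis .
qed

end

subsection \<open>Eigenfunctions of the Laplacian\<close>

lemma open_upper_half_plane: "open upper_half_plane"
  unfolding upper_half_plane_def by (rule open_halfspace_Im_gt)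

definition has_partials :: "(complex \<Rightarrow> complex) \<Rightarrow> (complex \<Rightarrow> complex) \<Rightarrow> (complex \<Rightarrow> complex) \<Rightarrow> bool" where
  "has_partials F Fx Fy \<longleftrightarrow> (\<forall>\<tau>\<in>upper_half_plane.
     (F has_derivative (\<lambda>h. of_real (Re h) * Fx \<tau> + of_real (Im h) * Fy \<tau>)) (at \<tau>))"

lemma has_partials_cong:
  assumes "has_partials F Fx Fy" "\<And>\<tau>. \<tau> \<in> upper_half_plane \<Longrightarrow> F \<tau> = G \<tau>"
  shows "has_partials G Fx Fy"
  using assms unfolding has_partials_def
  by (blast intro: has_derivative_transform_within_open[OF _ open_upper_half_plane])

lemma has_partials_add:
  assumes "has_partials F Fx Fy" "has_partials G Gx Gy"
  shows "has_partials (\<lambda>\<tau>. F \<tau> + G \<tau>) (\<lambda>\<tau>. Fx \<tau> + Gx \<tau>) (\<lambda>\<tau>. Fy \<tau> + Gy \<tau>)"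
  unfolding has_partials_def
proof
  fix \<tau> assume "\<tau> \<in> upper_half_plane"
  with assms have "(F has_derivative (\<lambda>h. of_real (Re h) * Fx \<tau> + of_real (Im h) * Fy \<tau>)) (at \<tau>)"
    "(G has_derivative (\<lambda>h. of_real (Re h) * Gx \<tau> + of_real (Im h) * Gy \<tau>)) (at \<tau>)"
    unfolding has_partials_def by blast+
  from has_derivative_add[OF this]
  show "((\<lambda>\<tau>. F \<tau> + G \<tau>) has_derivative
      (\<lambda>h. of_real (Re h) * (Fx \<tau> + Gx \<tau>) + of_real (Im h) * (Fy \<tau> + Gy \<tau>))) (at \<tau>)"
    by (simp add: algebra_simps)
qed

lemma has_partials_cmult:
  assumes "has_partials F Fx Fy"
  shows "has_partials (\<lambda>\<tau>. k * F \<tau>) (\<lambda>\<tau>. k * Fx \<tau>) (\<lambda>\<tau>. k * Fy \<tau>)"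
  unfolding has_partials_def
proof
  fix \<tau> assume "\<tau> \<in> upper_half_plane"
  with assms have "(F has_derivative (\<lambda>h. of_real (Re h) * Fx \<tau> + of_real (Im h) * Fy \<tau>)) (at \<tau>)"
    unfolding has_partials_def by blast
  from has_derivative_mult_right[OF this, of k]
  show "((\<lambda>\<tau>. k * F \<tau>) has_derivative (\<lambda>h. of_real (Re h) * (k * Fx \<tau>) + of_real (Im h) * (k * Fy \<tau>))) (at \<tau>)"
    by (simp add: algebra_simps)
qed

lemma has_partials_differentiable: "has_partials F Fx Fy \<Longrightarrow> F differentiable_on upper_half_plane"
  unfolding has_partials_def differentiable_on_def differentiable_def
  using has_derivative_at_withinI by blast

lemma has_partials_continuous: "has_partials F Fx Fy \<Longrightarrow> continuous_on upper_half_plane F"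
  by (rule differentiable_imp_continuous_on) (rule has_partials_differentiable)

lemma has_partialsD:
  assumes "has_partials F Fx Fy" "\<tau> \<in> upper_half_plane"
  shows "partial_x F \<tau> = Fx \<tau>" "partial_y F \<tau> = Fy \<tau>"
proof -
  have derivative: "((\<lambda>s. F (\<tau> + h * of_real s)) has_vector_derivative of_real (Re h) * Fx \<tau> + of_real (Im h) * Fy \<tau>) (at 0)"
    for h
  proof -
    have "(F has_derivative (\<lambda>h. of_real (Re h) * Fx \<tau> + of_real (Im h) * Fy \<tau>)) (at (\<tau> + h * of_real 0))"
      using assms by (simp add: has_partials_def)
    moreover have "((\<lambda>s. \<tau> + h * of_real s) has_derivative (\<lambda>s. h * of_real s)) (at (0::real))"
      by (auto intro!: derivative_eq_intros)
    ultimately have "((\<lambda>s. F (\<tau> + h * of_real s)) has_derivative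
        (\<lambda>s. of_real (Re (h * of_real s)) * Fx \<tau> + of_real (Im (h * of_real s)) * Fy \<tau>)) (at 0)"
      using has_derivative_compose by blast
    then show ?thesis
      by (simp add: has_vector_derivative_def scaleR_conv_of_real algebra_simps)
  qed
  show "partial_x F \<tau> = Fx \<tau>" "partial_y F \<tau> = Fy \<tau>"
    unfolding partial_x_def partial_y_def
    using derivative[of 1] derivative[of \<i>] by (auto intro: vector_derivative_at)
qed

lemma has_partials_partial:
  assumes F: "has_partials F Fx Fy" and Fx: "has_partials Fx Fxx Fxy" and Fy: "has_partials Fy Fyx Fyy"
  shows "has_partials (partial_x F) Fxx Fxy" "has_partials (partial_y F) Fyx Fyy"
  using has_partials_cong[OF Fx] has_partials_cong[OF Fy] has_partialsD[OF F] by simp_all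

lemma laplace0_eq:
  assumes "has_partials F Fx Fy" "has_partials Fx Fxx Fxy" "has_partials Fy Fyx Fyy" "\<tau> \<in> upper_half_plane"
  shows "laplace0 F \<tau> = - of_real ((Im \<tau>)\<^sup>2) * (Fxx \<tau> + Fyy \<tau>)"
  by (simp add: laplace0_def has_partialsD[OF has_partials_partial(1)[OF assms(1-3)] assms(4)]
      has_partialsD[OF has_partials_partial(2)[OF assms(1-3)] assms(4)])

lemma Ck_upper_2I:
  assumes "has_partials F Fx Fy" "has_partials Fx Fxx Fxy" "has_partials Fy Fyx Fyy"
    and "continuous_on upper_half_plane Fxx" "continuous_on upper_half_plane Fxy"
      "continuous_on upper_half_plane Fyx" "continuous_on upper_half_plane Fyy"
  shows "Ck_upper 2 F"
proof -
  note partials = has_partials_partial[OF assms(1-3)]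
  have "continuous_on upper_half_plane (partial_x (partial_x F))" "continuous_on upper_half_plane (partial_y (partial_x F))"
    "continuous_on upper_half_plane (partial_x (partial_y F))" "continuous_on upper_half_plane (partial_y (partial_y F))"
    using assms(4-7)
    by (auto simp: has_partialsD[OF partials(1)] has_partialsD[OF partials(2)] cong: continuous_on_cong)
  then show ?thesis
    using has_partials_differentiable[OF assms(1)] partials[THEN has_partials_differentiable]
    by (simp add: numeral_2_eq_2)
qed

context oscillating_laplace
begin

definition power_laplace :: "real \<Rightarrow> ('a \<Rightarrow> complex) \<Rightarrow> complex \<Rightarrow> complex" where
  "power_laplace e w \<tau> = of_real (Im \<tau> powr e) * laplace w \<tau>"

lemma has_partials_power_laplace:
  assumes w: "admissible w"
  shows "has_partials (power_laplace e w) (power_laplace e (phase_mult 1 w))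
    (\<lambda>\<tau>. of_real e * power_laplace (e - 1) w \<tau> + power_laplace e (phase_mult \<i> w) \<tau>)"
  unfolding has_partials_def
proof
  fix \<tau> assume "\<tau> \<in> upper_half_plane"
  then have \<tau>: "Im \<tau> > 0"
    by (simp add: upper_half_plane_def)
  have "((\<lambda>y. y powr e) has_derivative (\<lambda>h. h * (e * Im \<tau> powr (e - 1)))) (at (Im \<tau>))"
    using has_real_derivative_powr[OF \<tau>, of e] by (simp add: has_field_derivative_def mult.commute[of _ "e * _"])
  from has_derivative_compose[OF has_derivative_Im[OF has_derivative_ident] this]
  have "((\<lambda>\<tau>. complex_of_real (Im \<tau> powr e)) has_derivative (\<lambda>h. of_real (Im h * (e * Im \<tau> powr (e - 1))))) (at \<tau>)"
    by (rule has_derivative_of_real)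
  from has_derivative_mult[OF this has_derivative_laplace[OF w \<tau>]]
  have "(power_laplace e w has_derivative (\<lambda>h. of_real (Im \<tau> powr e) * laplace (phase_mult h w) \<tau> +
      of_real (Im h * (e * Im \<tau> powr (e - 1))) * laplace w \<tau>)) (at \<tau>)"
    unfolding power_laplace_def[abs_def] .
  moreover have "of_real (Im \<tau> powr e) * laplace (phase_mult h w) \<tau>
        + of_real (Im h * (e * Im \<tau> powr (e - 1))) * laplace w \<tau>
      = of_real (Re h) * power_laplace e (phase_mult 1 w) \<tau> +
        of_real (Im h) * (of_real e * power_laplace (e - 1) w \<tau> + power_laplace e (phase_mult \<i> w) \<tau>)" for h
    by (subst laplace_phase_mult[OF w \<tau>]) (simp add: power_laplace_def algebra_simps)
  ultimately show "(power_laplace e w has_derivative (\<lambda>h. of_real (Re h) * power_laplace e (phase_mult 1 w) \<tau> +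
      of_real (Im h) * (of_real e * power_laplace (e - 1) w \<tau> + power_laplace e (phase_mult \<i> w) \<tau>))) (at \<tau>)"
    by simp
qed

lemma second_partials_power_laplace:
  assumes w: "admissible w"
  defines "D \<equiv> phase_mult \<i>"
  shows "has_partials (\<lambda>\<tau>. of_real e * power_laplace (e - 1) w \<tau> + power_laplace e (D w) \<tau>)
    (\<lambda>\<tau>. of_real e * power_laplace (e - 1) (phase_mult 1 w) \<tau> + power_laplace e (phase_mult 1 (D w)) \<tau>)
    (\<lambda>\<tau>. of_real e * (of_real (e - 1) * power_laplace (e - 1 - 1) w \<tau> + power_laplace (e - 1) (D w) \<tau>)
      + (of_real e * power_laplace (e - 1) (D w) \<tau> + power_laplace e (D (D w)) \<tau>))"
  unfolding D_def by (intro has_partials_add has_partials_cmult has_partials_power_laplace admissible_phase_mult w)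

lemma continuous_on_power_laplace: "admissible w \<Longrightarrow> continuous_on upper_half_plane (power_laplace e w)"
  by (rule has_partials_continuous[OF has_partials_power_laplace])

lemma Ck_upper_power_laplace:
  assumes w: "admissible w" and F: "\<And>\<tau>. \<tau> \<in> upper_half_plane \<Longrightarrow> power_laplace e w \<tau> = F \<tau>"
  shows "Ck_upper 2 F"
  by (rule Ck_upper_2I[OF has_partials_cong[OF has_partials_power_laplace[OF w] F]
        has_partials_power_laplace[OF admissible_phase_mult[OF w]] second_partials_power_laplace[OF w]])
    (intro continuous_intros continuous_on_power_laplace admissible_phase_mult w | assumption)+

lemma laplace0_power_laplace:
  assumes w: "admissible w" and F: "\<And>\<tau>. \<tau> \<in> upper_half_plane \<Longrightarrow> power_laplace e w \<tau> = F \<tau>"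
    and \<tau>: "\<tau> \<in> upper_half_plane"
  shows "laplace0 F \<tau> = of_real (e * (1 - e)) * F \<tau> - of_real (Im \<tau> powr (e + 1)) *
    (of_real (2 * e) * laplace (phase_mult \<i> w) \<tau> + of_real (Im \<tau>) *
      (laplace (phase_mult 1 (phase_mult 1 w)) \<tau> + laplace (phase_mult \<i> (phase_mult \<i> w)) \<tau>))"
proof -
  have y: "Im \<tau> > 0"
    using \<tau> by (simp add: upper_half_plane_def)
  have powr: "Im \<tau> powr e = (Im \<tau>)\<^sup>2 * Im \<tau> powr (e - 1 - 1)" "Im \<tau> powr (e - 1) = Im \<tau> * Im \<tau> powr (e - 1 - 1)"
    "Im \<tau> powr (e + 1) = (Im \<tau>)\<^sup>2 * (Im \<tau> * Im \<tau> powr (e - 1 - 1))"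
    using y powr_add[of "Im \<tau>" "e - 1 - 1" 1] powr_add[of "Im \<tau>" "e - 1" 1] powr_add[of "Im \<tau>" e 1]
    by (simp_all add: power2_eq_square)
  have "has_partials F (power_laplace e (phase_mult 1 w))
      (\<lambda>\<tau>. of_real e * power_laplace (e - 1) w \<tau> + power_laplace e (phase_mult \<i> w) \<tau>)"
    using has_partials_cong[OF has_partials_power_laplace[OF w]] F by blast
  from laplace0_eq[OF this has_partials_power_laplace[OF admissible_phase_mult[OF w]] second_partials_power_laplace[OF w] \<tau>]
  show ?thesis
    unfolding F[OF \<tau>, symmetric] power_laplace_def powr by (simp add: algebra_simps power2_eq_square)
qed

end

lemma integral_deriv_vanishing_at_infinity:
  fixes f F :: "real \<Rightarrow> real"
  assumes "\<And>s. (F has_real_derivative f s) (at s)" and "continuous_on UNIV f" and "integrable lborel f"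
    and "(F \<longlongrightarrow> 0) at_top" "(F \<longlongrightarrow> 0) at_bot"
  shows "(LINT s|lborel. f s) = 0"
proof -
  have "(LBINT s=-\<infinity>..\<infinity>. f s) = 0 - 0"
  proof (rule interval_integral_FTC_integrable)
    show "((F \<circ> real_of_ereal) \<longlongrightarrow> 0) (at_right (- \<infinity>))" "((F \<circ> real_of_ereal) \<longlongrightarrow> 0) (at_left \<infinity>)"
      using assms(4,5) by (simp_all add: ereal_tendsto_simps)
  qed (use assms in \<open>auto simp: set_integrable_def continuous_on_eq_continuous_at
        has_real_derivative_iff_has_vector_derivative [symmetric]\<close>)
  then show ?thesis
    by (simp add: interval_lebesgue_integral_def set_lebesgue_integral_def)
qed

text \<open>The modified Bessel equation for \<open>K\<^sub>0\<close>, under the integral sign.\<close>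
lemma integral_bessel_equation:
  fixes x y :: real
  assumes "x > 0" "y > 0"
  defines "f \<equiv> \<lambda>s. (y * ((x * cosh (2 * s))\<^sup>2 - x\<^sup>2) - x * cosh (2 * s)) * exp (- (x * cosh (2 * s)) * y)"
  assumes "integrable lborel f"
  shows "(LINT s|lborel. f s) = 0"
proof (rule integral_deriv_vanishing_at_infinity)
  let ?F = "\<lambda>s. - (x / 2 * sinh (2 * s) * exp (- (x * cosh (2 * s)) * y))"
  show "(?F has_real_derivative f s) (at s)" for s
    unfolding f_def
    by (auto intro!: derivative_eq_intros simp: cosh_square_eq power_mult_distrib) (simp add: field_simps power2_eq_square)
  show "continuous_on UNIV f"
    unfolding f_def by (intro continuous_intros)
  show "(?F \<longlongrightarrow> 0) at_top" "(?F \<longlongrightarrow> 0) at_bot"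
    unfolding sinh_field_def cosh_field_def using assms(1,2) by real_asymp+
qed fact

lemma integral_count_space_infsum:
  fixes f :: "'a \<Rightarrow> complex"
  assumes "(\<lambda>n. norm (f n)) summable_on UNIV"
  shows "integrable (count_space UNIV) f" "(LINT n|count_space UNIV. f n) = infsum f UNIV"
proof -
  have "Infinite_Set_Sum.abs_summable_on f UNIV"
    using assms abs_summable_equivalent by blast
  from this[unfolded abs_summable_on_def] infsetsum_infsum[OF this]
  show "integrable (count_space UNIV) f" "(LINT n|count_space UNIV. f n) = infsum f UNIV"
    by (simp_all add: infsetsum_def)
qed

locale bessel_expansion =
  fixes C :: "'n::countable \<Rightarrow> complex" and Q :: "'n \<Rightarrow> real"
  assumes summable_bessel: "y > 0 \<Longrightarrow> (\<lambda>n. norm (C n) * bessel_K0 (2 * pi * \<bar>Q n\<bar> * y)) summable_on UNIV"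
    and support: "C n \<noteq> 0 \<Longrightarrow> Q n \<noteq> 0"
begin

abbreviation index_measure :: "('n \<times> real) measure" where
  "index_measure \<equiv> count_space UNIV \<Otimes>\<^sub>M lborel"

definition frequency :: "'n \<times> real \<Rightarrow> real" where
  "frequency = (\<lambda>(n, s). 2 * pi * Q n)"

definition damping :: "'n \<times> real \<Rightarrow> real" where
  "damping = (\<lambda>(n, s). 2 * pi * \<bar>Q n\<bar> * cosh (2 * s))"

definition weight :: "'n \<times> real \<Rightarrow> complex" where
  "weight = (\<lambda>(n, s). C n)"

lemma borel_measurable_index_measure:
  fixes f :: "'n \<times> real \<Rightarrow> 'b::topological_space"
  assumes "\<And>n. continuous_on UNIV (\<lambda>s. f (n, s))"
  shows "f \<in> borel_measurable index_measure"
  using borel_measurable_continuous_onI[OF assms] by (intro measurable_pair_measure_countable1) auto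

sublocale pair_sigma_finite "count_space (UNIV :: 'n set)" "lborel :: real measure"
  by (intro pair_sigma_finite.intro sigma_finite_measure_count_space_countable lborel.sigma_finite_measure_axioms) simp

sublocale oscillating_laplace index_measure frequency damping
proof
  show "frequency \<in> borel_measurable index_measure" "damping \<in> borel_measurable index_measure"
    by (rule borel_measurable_index_measure; simp add: frequency_def damping_def; intro continuous_intros)+
  show "\<bar>frequency u\<bar> \<le> damping u" for u
    using mult_left_mono[OF cosh_real_ge_1, of "2 * pi * \<bar>Q (fst u)\<bar>" "2 * snd u"]
    by (cases u) (simp add: frequency_def damping_def abs_mult)
qed

definition series :: "complex \<Rightarrow> complex" where
  "series \<tau> = (\<Sum>\<^sub>\<infinity>n. C n * cis_2pi (Re \<tau> * Q n) * of_real (bessel_K0 (2 * pi * \<bar>Q n\<bar> * Im \<tau>)))"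

lemma phase_pair:
  "phase \<tau> (n, s) = \<i> * of_real (2 * pi * Q n * Re \<tau>) - of_real (2 * pi * \<bar>Q n\<bar> * cosh (2 * s) * Im \<tau>)"
  unfolding phase_def by (simp add: frequency_def damping_def)

lemma exp_phase:
  "exp (phase \<tau> (n, s)) = cis_2pi (Re \<tau> * Q n) * of_real (exp (- (2 * pi * \<bar>Q n\<bar> * Im \<tau>) * cosh (2 * s)))"
  by (simp add: phase_pair cis_2pi_conv_exp exp_diff exp_minus exp_of_real [symmetric] field_simps)

lemma has_bochner_integral_fibre:
  assumes "Im \<tau> > 0"
  shows "has_bochner_integral lborel (\<lambda>s. weight (n, s) * exp (phase \<tau> (n, s)))
      (C n * cis_2pi (Re \<tau> * Q n) * of_real (bessel_K0 (2 * pi * \<bar>Q n\<bar> * Im \<tau>)))" (is ?complex)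
    and "has_bochner_integral lborel (\<lambda>s. norm (weight (n, s) * exp (phase \<tau> (n, s))))
      (norm (C n) * bessel_K0 (2 * pi * \<bar>Q n\<bar> * Im \<tau>))" (is ?norm)
proof -
  have "?complex \<and> ?norm"
  proof (cases "C n = 0")
    case False
    then have "2 * pi * \<bar>Q n\<bar> * Im \<tau> > 0"
      using assms support by simp
    from has_bochner_integral_bessel_K0[OF this, of 0] show ?thesis
      unfolding exp_phase weight_def
      by (auto simp: norm_mult mult.assoc [symmetric] simp del: of_real_exp
          intro!: has_bochner_integral_mult_right has_bochner_integral_of_real)
  qed (simp add: weight_def has_bochner_integral_zero)
  then show ?complex ?norm
    by blast+
qed

lemma summable_norm_bessel:
  assumes "Im \<tau> > 0"
  shows "(\<lambda>n. norm (C n * cis_2pi (Re \<tau> * Q n) * of_real (bessel_K0 (2 * pi * \<bar>Q n\<bar> * Im \<tau>)))) summable_on UNIV"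
  using summable_bessel[OF assms] bessel_K0_nonneg by (simp add: norm_mult)

lemma admissible_weight: "admissible weight"
  unfolding admissible_def
proof (intro conjI allI impI)
  show weight [measurable]: "weight \<in> borel_measurable index_measure"
    by (rule borel_measurable_index_measure) (simp add: weight_def)
  fix y :: real
  assume y: "y > 0"
  define \<tau> where "\<tau> = Complex 0 y"
  have \<tau>: "Im \<tau> > 0"
    using y by (simp add: \<tau>_def)
  have "integrable index_measure (\<lambda>u. weight u * exp (phase \<tau> u))"
  proof (rule Fubini_integrable)
    have "integrable (count_space UNIV) (\<lambda>n. norm (C n * cis_2pi (Re \<tau> * Q n) * of_real (bessel_K0 (2 * pi * \<bar>Q n\<bar> * Im \<tau>))))"
      by (intro integrable_norm integral_count_space_infsum summable_norm_bessel \<tau>)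
    then show "integrable (count_space UNIV) (\<lambda>n. LINT s|lborel. norm (weight (n, s) * exp (phase \<tau> (n, s))))"
      using has_bochner_integral_integral_eq[OF has_bochner_integral_fibre(2)[OF \<tau>]] bessel_K0_nonneg
      by (simp add: norm_mult)
  qed (use has_bochner_integral_fibre(1)[OF \<tau>] in \<open>auto simp: AE_count_space has_bochner_integral_iff\<close>)
  then show "integrable index_measure (\<lambda>u. weight u * of_real (exp (- damping u * y)))"
    by (simp add: \<tau>_def phase_def exp_of_real [symmetric])
qed

lemma laplace_weight:
  assumes \<tau>: "Im \<tau> > 0"
  shows "laplace weight \<tau> = series \<tau>"
proof -
  have "laplace weight \<tau> = (LINT n|count_space UNIV. LINT s|lborel. weight (n, s) * exp (phase \<tau> (n, s)))"
    unfolding laplace_def using integral_fst'[OF admissible_integrable_phase[OF admissible_weight \<tau>]] by simp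
  also have "\<dots> = (LINT n|count_space UNIV. C n * cis_2pi (Re \<tau> * Q n) * of_real (bessel_K0 (2 * pi * \<bar>Q n\<bar> * Im \<tau>)))"
    using has_bochner_integral_integral_eq[OF has_bochner_integral_fibre(1)[OF \<tau>]] by simp
  also have "\<dots> = series \<tau>"
    unfolding series_def by (intro integral_count_space_infsum summable_norm_bessel \<tau>)
  finally show ?thesis .
qed

definition bessel_operator :: "real \<Rightarrow> 'n \<times> real \<Rightarrow> complex" where
  "bessel_operator y u = phase \<i> u + of_real y * ((phase 1 u)\<^sup>2 + (phase \<i> u)\<^sup>2)"

lemma bessel_operator_fibre:
  "bessel_operator y (n, s) = of_real (y * ((2 * pi * \<bar>Q n\<bar> * cosh (2 * s))\<^sup>2 - (2 * pi * \<bar>Q n\<bar>)\<^sup>2)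
    - 2 * pi * \<bar>Q n\<bar> * cosh (2 * s))"
proof -
  have "(complex_of_real \<bar>Q n\<bar>)\<^sup>2 = (of_real (Q n))\<^sup>2"
    by (simp only: of_real_power [symmetric] power2_abs)
  then show ?thesis
    by (simp add: bessel_operator_def phase_pair power_mult_distrib algebra_simps)
qed

lemma integral_bessel_operator_fibre:
  assumes \<tau>: "Im \<tau> > 0"
    and int: "integrable lborel (\<lambda>s. bessel_operator (Im \<tau>) (n, s) * weight (n, s) * exp (phase \<tau> (n, s)))"
  shows "(LINT s|lborel. bessel_operator (Im \<tau>) (n, s) * weight (n, s) * exp (phase \<tau> (n, s))) = 0"
proof (cases "C n = 0")
  case False
  define x where "x = 2 * pi * \<bar>Q n\<bar>"
  define f where "f = (\<lambda>s. (Im \<tau> * ((x * cosh (2 * s))\<^sup>2 - x\<^sup>2) - x * cosh (2 * s)) * exp (- (x * cosh (2 * s)) * Im \<tau>))"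
  define z where "z = C n * cis_2pi (Re \<tau> * Q n)"
  have integrand: "bessel_operator (Im \<tau>) (n, s) * weight (n, s) * exp (phase \<tau> (n, s)) = z * of_real (f s)" for s
    unfolding bessel_operator_fibre exp_phase weight_def f_def x_def z_def by (simp add: mult_ac)
  have "x > 0"
    using False support by (simp add: x_def)
  moreover have "integrable lborel f"
  proof -
    have "z \<noteq> 0"
      using False by (simp add: z_def cis_2pi_def)
    with integrable_mult_right[OF int[unfolded integrand], of "inverse z"] show ?thesis
      by (simp add: mult.assoc [symmetric] complex_of_real_integrable_eq)
  qed
  ultimately have "(LINT s|lborel. f s) = 0"
    using integral_bessel_equation[OF _ \<tau>] unfolding f_def by blast
  then show ?thesis
    unfolding integrand by simp
qed (simp add: weight_def)

lemma laplace_bessel_operator: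
  assumes \<tau>: "Im \<tau> > 0"
  shows "laplace (phase_mult \<i> weight) \<tau> + of_real (Im \<tau>) *
    (laplace (phase_mult 1 (phase_mult 1 weight)) \<tau> + laplace (phase_mult \<i> (phase_mult \<i> weight)) \<tau>) = 0"
proof -
  let ?f = "\<lambda>u. bessel_operator (Im \<tau>) u * weight u * exp (phase \<tau> u)"
  have int: "integrable index_measure (\<lambda>u. phase h u * weight u * exp (phase \<tau> u))"
    "integrable index_measure (\<lambda>u. phase h u * (phase h u * weight u) * exp (phase \<tau> u))" for h
    by (intro admissible_integrable_phase admissible_phase_mult admissible_weight \<tau>)+
  have f: "?f u = phase \<i> u * weight u * exp (phase \<tau> u) + of_real (Im \<tau>) *
      (phase 1 u * (phase 1 u * weight u) * exp (phase \<tau> u) + phase \<i> u * (phase \<i> u * weight u) * exp (phase \<tau> u))" for u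
    by (simp add: bessel_operator_def power2_eq_square algebra_simps)
  have int_f: "integrable index_measure ?f"
    unfolding f by (intro Bochner_Integration.integrable_add integrable_mult_right int)
  have "laplace (phase_mult \<i> weight) \<tau> + of_real (Im \<tau>) *
      (laplace (phase_mult 1 (phase_mult 1 weight)) \<tau> + laplace (phase_mult \<i> (phase_mult \<i> weight)) \<tau>)
      = (LINT u|index_measure. ?f u)"
    unfolding f laplace_def by (simp add: int)
  also have "\<dots> = (LINT n|count_space UNIV. LINT s|lborel. ?f (n, s))"
    using integral_fst'[OF int_f] by simp
  also have "\<dots> = 0"
    using AE_integrable_fst'[OF int_f] integral_bessel_operator_fibre[OF \<tau>] by (simp add: AE_count_space)
  finally show ?thesis .
qed

theorem maass_series:
  assumes F: "\<And>\<tau>. \<tau> \<in> upper_half_plane \<Longrightarrow> F \<tau> = of_real (sqrt (Im \<tau>)) * series \<tau>"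
  shows "Ck_upper 2 F" and "\<tau> \<in> upper_half_plane \<Longrightarrow> laplace0 F \<tau> = 1/4 * F \<tau>"
proof -
  have F': "power_laplace (1/2) weight \<tau> = F \<tau>" if "\<tau> \<in> upper_half_plane" for \<tau>
    using that F[OF that] by (simp add: power_laplace_def laplace_weight upper_half_plane_def powr_half_sqrt)
  show "Ck_upper 2 F"
    by (rule Ck_upper_power_laplace[OF admissible_weight F'])
  show "laplace0 F \<tau> = 1/4 * F \<tau>" if "\<tau> \<in> upper_half_plane"
    using laplace0_power_laplace[OF admissible_weight F' that] laplace_bessel_operator[of \<tau>] that
    by (simp add: upper_half_plane_def)
qed

end

context shift_cocycle
begin

definition total_coefficient :: "real \<Rightarrow> int \<times> int \<Rightarrow> complex" where
  "total_coefficient t n = (\<Sum>j\<in>J. m j n * of_real (crossing t (t + s j) n))"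

lemma has_sum_total_series:
  assumes "Im \<tau> > 0"
  shows "((\<lambda>n. total_coefficient t n * cis_2pi (Re \<tau> * qform n) * of_real (bessel_K0 (2 * pi * \<bar>qform n\<bar> * Im \<tau>)))
    has_sum total_series t \<tau>) UNIV"
proof -
  have "((\<lambda>n. \<Sum>j\<in>J. bessel_term (m j) \<tau> t (t + s j) n) has_sum total_series t \<tau>) UNIV"
    unfolding total_series_def bessel_series_def
    by (intro has_sum_sum finite_J has_sum_infsum summable_bessel_term anisotropic assms)
  then show ?thesis
    by (simp add: bessel_term_def total_coefficient_def sum_distrib_right)
qed

lemma bessel_expansion_total: "bessel_expansion (total_coefficient t) qform"
proof
  show "(\<lambda>n. norm (total_coefficient t n) * bessel_K0 (2 * pi * \<bar>qform n\<bar> * y)) summable_on UNIV" if "y > 0" for y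
  proof -
    have "(\<lambda>n. total_coefficient t n * of_real (bessel_K0 (2 * pi * \<bar>qform n\<bar> * y))) summable_on UNIV"
      using has_sum_imp_summable[OF has_sum_total_series[of "Complex 0 y" t]] that by simp
    then have "(\<lambda>n. norm (total_coefficient t n * of_real (bessel_K0 (2 * pi * \<bar>qform n\<bar> * y)))) summable_on UNIV"
      by (rule summable_on_iff_abs_summable_on_complex[THEN iffD1])
    then show ?thesis
      by (simp add: norm_mult bessel_K0_nonneg)
  qed
  show "qform n \<noteq> 0" if "total_coefficient t n \<noteq> 0" for n
  proof -
    from that obtain j where "j \<in> J" "m j n * of_real (crossing t (t + s j) n) \<noteq> 0"
      unfolding total_coefficient_def by (rule sum.not_neutral_contains_not_neutral)
    then show ?thesis
      using anisotropicD[OF anisotropic, of j n] by simp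
  qed
qed

theorem maass_form_total_series:
  assumes "L > 0" and "\<And>j. j \<in> J \<Longrightarrow> periodic L (m j)"
    and F: "\<And>\<tau>. \<tau> \<in> upper_half_plane \<Longrightarrow> F \<tau> = of_real (sqrt (Im \<tau>)) * total_series t \<tau>"
  shows "maass_form_wt0 (principal_congruence (theta_level L)) (theta_multiplier L) (1/4) F"
proof -
  interpret expansion: bessel_expansion "total_coefficient t" qform
    by (rule bessel_expansion_total)
  have "F \<tau> = of_real (sqrt (Im \<tau>)) * expansion.series \<tau>" if "\<tau> \<in> upper_half_plane" for \<tau>
    using F[OF that] infsumI[OF has_sum_total_series, of \<tau> t] that by (simp add: upper_half_plane_def expansion.series_def)
  note eigenfunction = expansion.maass_series[OF this]
  have "F (moebius M \<tau>) = theta_multiplier L M * F \<tau>"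
    if M: "M \<in> principal_congruence (theta_level L)" and \<tau>: "\<tau> \<in> upper_half_plane" for M \<tau>
    using total_series_modular[OF assms(1,2) M, of \<tau>] Im_moebius_pos[OF det_principal_congruence[OF M], of \<tau>] \<tau>
    by (simp add: upper_half_plane_def F)
  with eigenfunction show ?thesis
    unfolding maass_form_wt0_def by blast
qed

end

subsection \<open>The hyperbola and its automorphisms\<close>

lemma matrix_vector_mult_2: "(M *v v) $ i = M $ i $ 1 * v $ 1 + M $ i $ 2 * (v :: real^2) $ 2"
  by (simp add: matrix_vector_mult_def sum_2)

lemma
  fixes M :: "real^'n^'n"
  assumes "invertible M"
  shows matrix_inv_right: "M ** matrix_inv M = mat 1"
    and matrix_inv_left: "matrix_inv M ** M = mat 1"
  using someI_ex[OF assms[unfolded invertible_def]] by (simp_all add: matrix_inv_def)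

lemma diagonal_if_preserves_product:
  fixes N :: "real^2^2"
  assumes product: "\<And>u. (N *v u) $ 1 * (N *v u) $ 2 = u $ 1 * u $ 2" and det: "det N = 1"
  shows "N $ 1 $ 2 = 0" "N $ 2 $ 1 = 0" "N $ 1 $ 1 * N $ 2 $ 2 = 1"
proof -
  have N: "(N $ 1 $ 1 * x + N $ 1 $ 2 * y) * (N $ 2 $ 1 * x + N $ 2 $ 2 * y) = x * y" for x y
    using product[of "vector [x, y]"] by (simp add: matrix_vector_mult_2)
  have zero: "N $ 1 $ 1 * N $ 2 $ 1 = 0" "N $ 1 $ 2 * N $ 2 $ 2 = 0"
    using N[of 1 0] N[of 0 1] by simp_all
  then have "N $ 1 $ 1 * N $ 2 $ 2 + N $ 1 $ 2 * N $ 2 $ 1 = 1"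
    using N[of 1 1] by (simp add: distrib_left distrib_right zero)
  with det show "N $ 1 $ 1 * N $ 2 $ 2 = 1"
    by (simp add: det_2)
  with zero show "N $ 1 $ 2 = 0" "N $ 2 $ 1 = 0"
    by auto
qed

lemma sgn_exp_difference:
  fixes a b t :: real
  assumes "b \<noteq> 0"
  shows "sgn (b * exp t - a * exp (- t)) = sgn b * sgn (exp (2 * t) - a / b)"
proof -
  have "b * exp t - a * exp (- t) = b * (exp (- t) * (exp (2 * t) - a / b))"
    using assms exp_add[of "- t" "2 * t"] by (simp add: algebra_simps)
  then show ?thesis
    by (simp add: sgn_mult)
qed

lemma sgn_jump:
  fixes t1 t2 h :: real
  shows "sgn (t2 - t1) * (1 / 2 * (1 - sgn (t1 - h) * sgn (t2 - h))) = (sgn (t2 - h) - sgn (t1 - h)) / 2"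
  by (auto simp: sgn_real_def)

lemma crossing_weight:
  fixes \<sigma> :: real
  assumes ab: "a * b \<noteq> 0" and \<sigma>: "\<bar>\<sigma>\<bar> = 1"
  defines "f \<equiv> \<lambda>t. b * exp t - \<sigma> * a * exp (- t)"
  shows "sgn (t2 - t1) * (1 / 2 * (1 - sgn (f t1 * f t2)))
    = (if \<sigma> * (a * b) > 0 then (sgn (t2 - majorant_argmin a b) - sgn (t1 - majorant_argmin a b)) / 2 else 0)"
proof -
  define h where "h = majorant_argmin a b"
  have b: "b \<noteq> 0"
    using ab by simp
  have sgn_f: "sgn (f t) = sgn b * sgn (exp (2 * t) - \<sigma> * a / b)" for t
    unfolding f_def by (rule sgn_exp_difference[OF b])
  have "sgn b * (sgn b * x) = x" for x
    using b by (simp add: sgn_real_def)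
  then have product: "sgn (f t1 * f t2) = sgn (exp (2 * t1) - \<sigma> * a / b) * sgn (exp (2 * t2) - \<sigma> * a / b)"
    by (simp add: sgn_mult sgn_f mult_ac)
  have quotient: "\<sigma> * a / b = \<sigma> * (a * b) / (\<bar>b\<bar> * \<bar>b\<bar>)"
    using b by simp
  show ?thesis
  proof (cases "\<sigma> * (a * b) > 0")
    case True
    then have "\<sigma> * (a * b) = \<bar>a\<bar> * \<bar>b\<bar>"
      using abs_of_pos[OF True] \<sigma> by (simp only: abs_mult mult_1)
    then have "\<sigma> * a / b = exp (2 * h)"
      using b unfolding quotient by (simp add: h_def exp_majorant_argmin[OF ab] del: abs_mult_self_eq)
    then have "sgn (exp (2 * t) - \<sigma> * a / b) = sgn (t - h)" for t
      by (auto simp: sgn_real_def)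
    with True show ?thesis
      unfolding product by (simp only: sgn_jump h_def if_True)
  next
    case False
    then have "\<sigma> * a / b \<le> 0"
      unfolding quotient by (intro divide_nonpos_nonneg) auto
    then have "exp (2 * t) - \<sigma> * a / b > 0" for t
      using exp_gt_zero[of "2 * t"] by linarith
    with False show ?thesis
      unfolding product by simp
  qed
qed

definition of_int_vec :: "int \<times> int \<Rightarrow> real^2" where
  "of_int_vec n = vector [of_int (fst n), of_int (snd n)]"

lemma of_int_vec_nth [simp]: "of_int_vec n $ 1 = of_int (fst n)" "of_int_vec n $ 2 = of_int (snd n)"
  by (simp_all add: of_int_vec_def)

lemma of_int_vec_period: "of_int_vec (n + k *\<^sub>Z l) = of_int_vec n + of_int k *\<^sub>R of_int_vec l"
  by (simp add: vec_eq_iff forall_2 int_scale_def)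

lemma bij_betw_of_int_vec: "bij_betw of_int_vec UNIV lattice_Z2"
proof (rule bij_betw_imageI)
  show "inj of_int_vec"
    by (rule injI) (simp add: of_int_vec_def vec_eq_iff forall_2 prod_eq_iff)
  show "range of_int_vec = lattice_Z2"
  proof (intro equalityI subsetI)
    fix v
    assume "v \<in> lattice_Z2"
    then obtain x y where "v $ 1 = of_int x" "v $ 2 = of_int y"
      unfolding lattice_Z2_def by (auto elim!: Ints_cases simp: forall_2)
    then have "v = of_int_vec (x, y)"
      by (simp add: vec_eq_iff forall_2)
    then show "v \<in> range of_int_vec"
      by blast
  qed (auto simp: lattice_Z2_def forall_2)
qed

lemma of_int_vec_in_lattice [simp]: "of_int_vec n \<in> lattice_Z2"
  using bij_betw_of_int_vec by (auto simp: bij_betw_def)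

lemma common_period:
  assumes J: "finite J" and per: "\<And>j. j \<in> J \<Longrightarrow> periodic_Z2 (m j)"
  obtains L where "L > 0" "\<And>j. j \<in> J \<Longrightarrow> periodic L (m j \<circ> of_int_vec)"
proof -
  have "\<forall>j\<in>J. \<exists>l. l \<noteq> 0 \<and> periodic l (m j \<circ> of_int_vec)"
    using per unfolding periodic_Z2_def periodic_def o_def of_int_vec_period by (metis of_int_vec_in_lattice)
  then obtain l where l: "\<And>j. j \<in> J \<Longrightarrow> l j \<noteq> 0" "\<And>j. j \<in> J \<Longrightarrow> periodic (l j) (m j \<circ> of_int_vec)"
    by metis
  show thesis
  proof
    show "(\<Prod>j\<in>J. \<bar>l j\<bar>) > 0"
      using l(1) by (intro prod_pos) auto
    show "periodic (\<Prod>j\<in>J. \<bar>l j\<bar>) (m j \<circ> of_int_vec)" if "j \<in> J" for j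
      using periodic_dvd[OF l(2)[OF that]] dvd_prodI[OF J that, of "\<lambda>j. \<bar>l j\<bar>"] by simp
  qed
qed

locale hyperbola =
  fixes A P :: "real^2^2" and C :: "(real^2) set"
  assumes P_inv: "invertible P" and A_eq: "A = transpose P ** hyp_J ** P"
    and C_component: "C \<in> components {u. quad A u = -1}" and C_base: "matrix_inv P *v vector [1, -1] \<in> C"
begin

abbreviation \<xi> :: "real^2 \<Rightarrow> real" where
  "\<xi> v \<equiv> (P *v v) $ 1"

abbreviation \<eta> :: "real^2 \<Rightarrow> real" where
  "\<eta> v \<equiv> (P *v v) $ 2"

lemma A_entries: "A $ 1 $ 1 = 2 * (P $ 1 $ 1 * P $ 2 $ 1)" "A $ 1 $ 2 = P $ 1 $ 1 * P $ 2 $ 2 + P $ 1 $ 2 * P $ 2 $ 1"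
  "A $ 2 $ 1 = A $ 1 $ 2" "A $ 2 $ 2 = 2 * (P $ 1 $ 2 * P $ 2 $ 2)"
  unfolding A_eq by (simp_all add: matrix_matrix_mult_def sum_2 transpose_def hyp_J_def)

lemma quad_eq: "quad A v = \<xi> v * \<eta> v"
  by (simp add: quad_def inner_vec_def sum_2 matrix_vector_mult_2 A_entries algebra_simps)

lemma bil_eq: "bil A u v = \<xi> u * \<eta> v + \<eta> u * \<xi> v"
  by (simp add: bil_def inner_vec_def sum_2 matrix_vector_mult_2 A_entries algebra_simps)

lemma P_mult_inv: "P *v (matrix_inv P *v v) = v"
  using P_inv by (simp add: matrix_vector_mul_assoc matrix_inv_right)

lemma light_cone_eqI:
  assumes "\<xi> u = \<xi> v" "\<eta> u = \<eta> v"
  shows "u = v"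
proof -
  have "P *v u = P *v v"
    using assms by (simp add: vec_eq_iff forall_2)
  then have "matrix_inv P *v (P *v u) = matrix_inv P *v (P *v v)"
    by simp
  then show ?thesis
    using P_inv by (simp add: matrix_vector_mul_assoc matrix_inv_left)
qed

lemma light_cone_c_curve [simp]: "\<xi> (c_curve P t) = exp t" "\<eta> (c_curve P t) = - exp (- t)"
  "\<xi> (c_perp_curve P t) = exp t" "\<eta> (c_perp_curve P t) = exp (- t)"
  by (simp_all add: c_curve_def c_perp_curve_def P_mult_inv)

lemma t_param_c_curve [simp]: "t_param P (c_curve P t) = t"
  unfolding t_param_def by (rule the_equality) (auto dest: arg_cong[of _ _ \<xi>])

lemma bil_c_curve: "bil A v (c_curve P t) = \<eta> v * exp t - \<xi> v * exp (- t)"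
  by (simp add: bil_eq)

lemma bil_perp_c_curve: "bil A v (perp P (c_curve P t)) = \<eta> v * exp t + \<xi> v * exp (- t)"
  by (simp add: bil_eq perp_def)

lemma c_curve_0_in_C: "c_curve P 0 \<in> C"
  using C_base by (simp add: c_curve_def)

lemma C_subset: "C \<subseteq> {u. \<xi> u * \<eta> u = -1}"
  using in_components_subset[OF C_component] by (simp add: quad_eq)

lemma \<xi>_pos:
  assumes "v \<in> C"
  shows "\<xi> v > 0"
proof (rule ccontr)
  assume "\<not> \<xi> v > 0"
  then have "\<xi> v \<le> 0" "0 \<le> \<xi> (c_curve P 0)"
    by simp_all
  moreover have "connected (\<xi> ` C)"
    unfolding matrix_vector_mult_2
    by (intro connected_continuous_image in_components_connected[OF C_component] continuous_intros)
  ultimately have "0 \<in> \<xi> ` C"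
    using assms c_curve_0_in_C by (meson connectedD_interval imageI)
  then show False
    using C_subset by force
qed

lemma connected_range_c_curve: "connected (range (c_curve P))"
proof -
  have "c_curve P = (\<lambda>t. exp t *\<^sub>R (matrix_inv P *v vector [1, 0]) - exp (- t) *\<^sub>R (matrix_inv P *v vector [0, 1]))"
    by (simp add: c_curve_def fun_eq_iff vec_eq_iff matrix_vector_mult_2)
  then have "continuous_on UNIV (c_curve P)"
    by (simp only:) (intro continuous_intros)
  then show ?thesis
    by (intro connected_continuous_image) auto
qed

lemma C_eq_range: "C = range (c_curve P)"
proof
  show "C \<subseteq> range (c_curve P)"
  proof
    fix v
    assume v: "v \<in> C"
    then have "\<xi> v * \<eta> v = -1" "\<xi> v > 0"
      using C_subset \<xi>_pos by auto
    then have "v = c_curve P (ln (\<xi> v))"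
      by (intro light_cone_eqI) (simp_all add: exp_minus field_simps)
    then show "v \<in> range (c_curve P)"
      by blast
  qed
  show "range (c_curve P) \<subseteq> C"
  proof (rule components_maximal[OF C_component connected_range_c_curve])
    show "range (c_curve P) \<subseteq> {u. quad A u = -1}"
      by (auto simp: quad_eq exp_minus)
    show "C \<inter> range (c_curve P) \<noteq> {}"
      using c_curve_0_in_C by blast
  qed
qed

lemma Aut_plusD:
  assumes "\<gamma> \<in> Aut_plus A C"
  shows "invertible \<gamma>" "quad A (\<gamma> *v v) = quad A v" "(\<lambda>v. \<gamma> *v v) ` lattice_Z2 = lattice_Z2"
    "v \<in> C \<Longrightarrow> \<gamma> *v v \<in> C" "det \<gamma> = 1"
  using assms unfolding Aut_plus_def by blast+

definition translation :: "real^2^2 \<Rightarrow> real" where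
  "translation \<gamma> = t_param P (\<gamma> *v c_curve P 0)"

lemma light_cone_Aut_plus:
  assumes \<gamma>: "\<gamma> \<in> Aut_plus A C"
  shows "\<xi> (\<gamma> *v v) = exp (translation \<gamma>) * \<xi> v" "\<eta> (\<gamma> *v v) = exp (- translation \<gamma>) * \<eta> v"
proof -
  define N where "N = P ** \<gamma> ** matrix_inv P"
  have N: "P *v (\<gamma> *v v) = N *v (P *v v)" for v
    using P_inv by (simp add: N_def matrix_vector_mul_assoc matrix_mul_assoc [symmetric] matrix_inv_left)
  have "det P * det (matrix_inv P) = 1"
    unfolding det_mul [symmetric] using P_inv by (simp add: matrix_inv_right)
  then have "det N = 1"
    using Aut_plusD(5)[OF \<gamma>] by (simp add: N_def det_mul)
  moreover have "(N *v u) $ 1 * (N *v u) $ 2 = u $ 1 * u $ 2" for u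
    using Aut_plusD(2)[OF \<gamma>, of "matrix_inv P *v u"] by (simp add: quad_eq N P_mult_inv)
  ultimately have diagonal: "N $ 1 $ 2 = 0" "N $ 2 $ 1 = 0" "N $ 1 $ 1 * N $ 2 $ 2 = 1"
    using diagonal_if_preserves_product by blast+
  obtain t where t: "\<gamma> *v c_curve P 0 = c_curve P t"
    using Aut_plusD(4)[OF \<gamma> c_curve_0_in_C] C_eq_range by blast
  then have "translation \<gamma> = t"
    by (simp add: translation_def)
  moreover have "N $ 1 $ 1 = exp t"
    using arg_cong[OF t, of \<xi>] by (simp add: N matrix_vector_mult_2[of N] diagonal)
  moreover from this have "N $ 2 $ 2 = exp (- t)"
    using diagonal(3) by (simp add: exp_minus field_simps)
  ultimately show "\<xi> (\<gamma> *v v) = exp (translation \<gamma>) * \<xi> v" "\<eta> (\<gamma> *v v) = exp (- translation \<gamma>) * \<eta> v"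
    by (simp_all add: N matrix_vector_mult_2[of N] diagonal(1,2))
qed

lemma Aut_plus_c_curve:
  assumes "\<gamma> \<in> Aut_plus A C"
  shows "\<gamma> *v c_curve P t = c_curve P (t + translation \<gamma>)"
  by (rule light_cone_eqI) (simp_all add: light_cone_Aut_plus[OF assms] exp_add [symmetric] add.commute)

definition lattice_map :: "real^2^2 \<Rightarrow> int \<times> int \<Rightarrow> int \<times> int" where
  "lattice_map \<gamma> n = inv_into UNIV of_int_vec (\<gamma> *v of_int_vec n)"

lemma of_int_vec_lattice_map:
  assumes "\<gamma> \<in> Aut_plus A C"
  shows "of_int_vec (lattice_map \<gamma> n) = \<gamma> *v of_int_vec n"
proof -
  have "\<gamma> *v of_int_vec n \<in> range of_int_vec"
    using Aut_plusD(3)[OF assms] bij_betw_of_int_vec by (auto simp: bij_betw_def)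
  then show ?thesis
    unfolding lattice_map_def by (rule f_inv_into_f)
qed

lemma bij_lattice_map:
  assumes "\<gamma> \<in> Aut_plus A C"
  shows "bij (lattice_map \<gamma>)"
proof -
  have "inj ((*v) \<gamma>)"
    by (rule inj_matrix_vector_mult[OF Aut_plusD(1)[OF assms]])
  then have "bij_betw ((*v) \<gamma>) lattice_Z2 lattice_Z2"
    using Aut_plusD(3)[OF assms] by (auto simp: bij_betw_def inj_on_def)
  from bij_betw_trans[OF bij_betw_trans[OF bij_betw_of_int_vec this] bij_betw_inv_into[OF bij_betw_of_int_vec]]
  show ?thesis
    by (simp add: lattice_map_def[abs_def] o_def)
qed

end

locale hyperbolic_lattice = hyperbola A P C for A P C +
  fixes p q r :: int
  assumes integral: "A $ 1 $ 1 = of_int p" "A $ 1 $ 2 = of_int q" "A $ 2 $ 2 = of_int r"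
begin

sublocale hyperbolic_form p q r "(P $ 1 $ 1, P $ 1 $ 2)" "(P $ 2 $ 1, P $ 2 $ 2)"
proof
  have "det P \<noteq> 0"
    using P_inv by (simp add: invertible_det_nz)
  then show "fst (P $ 1 $ 1, P $ 1 $ 2) * snd (P $ 2 $ 1, P $ 2 $ 2) \<noteq> snd (P $ 1 $ 1, P $ 1 $ 2) * fst (P $ 2 $ 1, P $ 2 $ 2)"
    by (simp add: det_2)
qed (use A_entries integral in simp_all)

lemma light_cone_of_int_vec: "\<xi> (of_int_vec n) = \<alpha> n" "\<eta> (of_int_vec n) = \<beta> n"
  by (simp_all add: matrix_vector_mult_2 inner_prod_def)

lemma quad_of_int_vec: "quad A (of_int_vec n) = qform n"
  by (simp add: quad_eq light_cone_of_int_vec qform_factor)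

lemma hyperbolic_shift_lattice_map:
  assumes "\<gamma> \<in> Aut_plus A C"
  shows "hyperbolic_shift (lattice_map \<gamma>) (translation \<gamma>)"
  unfolding hyperbolic_shift_def light_cone_of_int_vec [symmetric] of_int_vec_lattice_map[OF assms]
  using bij_lattice_map[OF assms] light_cone_Aut_plus[OF assms] by blast

lemma Phi_summand_eq_bessel_term:
  fixes n :: "int \<times> int"
  assumes m: "anisotropic (m \<circ> of_int_vec)" and \<sigma>: "\<bar>\<sigma>\<bar> = 1"
    and f: "\<And>v t. f v t = \<eta> v * exp t - \<sigma> * \<xi> v * exp (- t)"
  defines "v \<equiv> of_int_vec n"
  shows "of_real (sgn (t2 - t1)) * (of_real ((1/2) * (1 - sgn (f v t1 * f v t2))) * m v *
      exp (2 * of_real pi * \<i> * of_real (quad A v) * of_real (Re \<tau>)) * of_real (bessel_K0 (\<sigma> * (2 * pi * quad A v * Im \<tau>))))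
    = (if \<sigma> * qform n > 0 then bessel_term (m \<circ> of_int_vec) \<tau> t1 t2 n else 0)"
proof (cases "m v = 0")
  case False
  define w where "w = (1/2) * (1 - sgn (f v t1 * f v t2))"
  define e where "e = exp (2 * of_real pi * \<i> * of_real (quad A v) * of_real (Re \<tau>))"
  define K where "K = bessel_K0 (\<sigma> * (2 * pi * quad A v * Im \<tau>))"
  have "\<alpha> n * \<beta> n \<noteq> 0"
    using anisotropicD[OF m, of n] False by (simp add: v_def qform_factor)
  from crossing_weight[OF this \<sigma>]
  have w: "sgn (t2 - t1) * w = (if \<sigma> * qform n > 0 then crossing t1 t2 n else 0)"
    by (simp add: w_def v_def f light_cone_of_int_vec crossing_def qform_factor)
  have e: "e = cis_2pi (Re \<tau> * qform n)"
    by (simp add: e_def v_def quad_of_int_vec cis_2pi_conv_exp mult_ac)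
  have K: "K = bessel_K0 (2 * pi * \<bar>qform n\<bar> * Im \<tau>)" if "\<sigma> * qform n > 0"
  proof -
    have "\<sigma> * (2 * pi * quad A v * Im \<tau>) = 2 * pi * (\<sigma> * qform n) * Im \<tau>"
      by (simp add: v_def quad_of_int_vec)
    also have "\<sigma> * qform n = \<bar>qform n\<bar>"
      using that \<sigma> by (auto simp: abs_if split: if_splits)
    finally show ?thesis
      unfolding K_def by (rule arg_cong)
  qed
  have "of_real (sgn (t2 - t1)) * (of_real w * m v * e * of_real K) = of_real (sgn (t2 - t1) * w) * m v * e * of_real K"
    by simp
  also have "\<dots> = (if \<sigma> * qform n > 0 then bessel_term (m \<circ> of_int_vec) \<tau> t1 t2 n else 0)"
    unfolding w e using K by (simp add: bessel_term_def v_def)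
  finally show ?thesis
    unfolding w_def e_def K_def .
qed (simp add: v_def bessel_term_def)

lemma Phi_half_eq_bessel_series:
  assumes "anisotropic (m \<circ> of_int_vec)" and "\<bar>\<sigma>\<bar> = 1"
    and "\<And>v t. f v t = \<eta> v * exp t - \<sigma> * \<xi> v * exp (- t)"
  shows "of_real (sgn (t2 - t1)) * (\<Sum>\<^sub>\<infinity>v\<in>lattice_Z2. of_real ((1/2) * (1 - sgn (f v t1 * f v t2))) * m v *
      exp (2 * of_real pi * \<i> * of_real (quad A v) * of_real (Re \<tau>)) * of_real (bessel_K0 (\<sigma> * (2 * pi * quad A v * Im \<tau>))))
    = infsum (bessel_term (m \<circ> of_int_vec) \<tau> t1 t2) {n. \<sigma> * qform n > 0}"
  unfolding infsum_reindex_bij_betw[OF bij_betw_of_int_vec, symmetric] infsum_cmult_right' [symmetric]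
    Phi_summand_eq_bessel_term[OF assms] by (rule infsum_cong_neutral) auto

lemma Phi_eq_bessel_series:
  assumes m: "anisotropic (m \<circ> of_int_vec)" and \<tau>: "Im \<tau> > 0"
  shows "Phi A P m (c_curve P t1) (c_curve P t2) \<tau> = of_real (sqrt (Im \<tau>)) * bessel_series (m \<circ> of_int_vec) \<tau> t1 t2"
proof -
  let ?b = "bessel_term (m \<circ> of_int_vec) \<tau> t1 t2"
  have halves: "?b summable_on {n. qform n > 0}" "?b summable_on {n. qform n < 0}"
    using summable_bessel_term[OF m \<tau>] summable_on_subset_banach by blast+
  have "Phi A P m (c_curve P t1) (c_curve P t2) \<tau>
      = of_real (sqrt (Im \<tau>)) * (infsum ?b {n. qform n > 0} + infsum ?b {n. qform n < 0})"
    using Phi_half_eq_bessel_series[OF m, of 1 "\<lambda>v t. bil A v (c_curve P t)" t2 t1 \<tau>]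
      Phi_half_eq_bessel_series[OF m, of "-1" "\<lambda>v t. bil A v (perp P (c_curve P t))" t2 t1 \<tau>]
    by (simp add: Phi_def bil_c_curve bil_perp_c_curve distrib_left mult_ac)
  also have "infsum ?b {n. qform n > 0} + infsum ?b {n. qform n < 0} = infsum ?b ({n. qform n > 0} \<union> {n. qform n < 0})"
    by (rule infsum_Un_disjoint[OF halves, symmetric]) auto
  also have "\<dots> = bessel_series (m \<circ> of_int_vec) \<tau> t1 t2"
    unfolding bessel_series_def using anisotropicD[OF m]
    by (intro infsum_cong_neutral) (force simp: bessel_term_def)+
  finally show ?thesis .
qed

end

locale lattice_cocycle = hyperbolic_lattice A P C p q r for A P C p q r +
  fixes J :: "'j set" and m :: "'j \<Rightarrow> real^2 \<Rightarrow> complex" and \<gamma> :: "'j \<Rightarrow> real^2^2"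
  assumes finite_J: "finite J" and periodic: "\<And>j. j \<in> J \<Longrightarrow> periodic_Z2 (m j)"
    and support: "\<And>j v. j \<in> J \<Longrightarrow> v \<in> lattice_Z2 \<Longrightarrow> m j v \<noteq> 0 \<Longrightarrow> quad A v \<noteq> 0"
    and Aut_plus: "\<And>j. j \<in> J \<Longrightarrow> \<gamma> j \<in> Aut_plus A C"
    and cocycle: "\<And>v. v \<in> lattice_Z2 \<Longrightarrow> (\<Sum>j\<in>J. m j v - m j (\<gamma> j *v v)) = 0"
begin

sublocale shift_cocycle p q r "(P $ 1 $ 1, P $ 1 $ 2)" "(P $ 2 $ 1, P $ 2 $ 2)" J
  "\<lambda>j. m j \<circ> of_int_vec" "\<lambda>j. lattice_map (\<gamma> j)" "\<lambda>j. translation (\<gamma> j)"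
proof
  show "anisotropic (m j \<circ> of_int_vec)" if j: "j \<in> J" for j
  proof -
    obtain L where "L \<noteq> 0" "periodic L (m j \<circ> of_int_vec)"
      using common_period[of "{j}" m] periodic[OF j] by force
    then obtain B where "norm ((m j \<circ> of_int_vec) n) \<le> B" for n
      using periodic_bounded by blast
    moreover have "qform n \<noteq> 0" if "(m j \<circ> of_int_vec) n \<noteq> 0" for n
      using support[OF j, of "of_int_vec n"] that by (simp add: quad_of_int_vec)
    ultimately show ?thesis
      unfolding anisotropic_def by blast
  qed
  show "(\<Sum>j\<in>J. (m j \<circ> of_int_vec) n - (m j \<circ> of_int_vec) (lattice_map (\<gamma> j) n)) = 0" for n
    using cocycle[of "of_int_vec n"] by (simp add: of_int_vec_lattice_map Aut_plus cong: sum.cong)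
qed (simp_all add: finite_J hyperbolic_shift_lattice_map Aut_plus)

lemma sum_Phi_eq_total_series:
  assumes "\<tau> \<in> upper_half_plane"
  shows "(\<Sum>j\<in>J. Phi A P (m j) (c_curve P t) (\<gamma> j *v c_curve P t) \<tau>) = of_real (sqrt (Im \<tau>)) * total_series t \<tau>"
  unfolding total_series_def sum_distrib_left
  using assms by (intro sum.cong refl)
    (simp add: Aut_plus_c_curve Aut_plus Phi_eq_bessel_series anisotropic upper_half_plane_def)

end

theorem theorem4:
  fixes A P :: "real^2^2" and C :: "(real^2) set" and c :: "real^2"
    and J :: "'j set" and m :: "'j \<Rightarrow> real^2 \<Rightarrow> complex" and \<gamma> :: "'j \<Rightarrow> real^2^2"
  assumes A_int: "\<forall>i j. A $ i $ j \<in> \<int>"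
    and A_sym: "transpose A = A"
    and A_sig: "has_signature A 1 1"
    and C_comp: "C \<in> components {u. quad A u = -1}"
    and P_inv: "invertible P"
    and P_A: "A = transpose P ** hyp_J ** P"
    and P_C: "matrix_inv P *v vector [1, -1] \<in> C"
    and c_C: "c \<in> C"
    and J_fin: "finite J"
    and m_per: "\<forall>j\<in>J. periodic_Z2 (m j)"
    and m_supp: "\<forall>j\<in>J. \<forall>\<nu>\<in>lattice_Z2. m j \<nu> \<noteq> 0 \<longrightarrow> quad A \<nu> \<noteq> 0"
    and \<gamma>_Aut: "\<forall>j\<in>J. \<gamma> j \<in> Aut_plus A C"
    and m_sum: "\<forall>\<nu>\<in>lattice_Z2. (\<Sum>j\<in>J. m j \<nu> - m j (\<gamma> j *v \<nu>)) = 0"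
  shows "(\<exists>\<Gamma> v. subgroup \<Gamma> SL2Z \<and> finite (rcosets\<^bsub>SL2Z\<^esub> \<Gamma>) \<and>
            maass_form_wt0 \<Gamma> v (1/4) (\<lambda>\<tau>. \<Sum>j\<in>J. Phi A P (m j) c (\<gamma> j *v c) \<tau>)) \<and>
         (\<forall>c'\<in>C. \<forall>\<tau>\<in>upper_half_plane.
            (\<Sum>j\<in>J. Phi A P (m j) c (\<gamma> j *v c) \<tau>) = (\<Sum>j\<in>J. Phi A P (m j) c' (\<gamma> j *v c') \<tau>))"
proof -
  obtain p q r where "A $ 1 $ 1 = of_int p" "A $ 1 $ 2 = of_int q" "A $ 2 $ 2 = of_int r"
    using A_int by (metis Ints_cases)
  then interpret lattice_cocycle A P C p q r J m \<gamma>
    using assms by unfold_locales auto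
  obtain L where L: "L > 0" "\<And>j. j \<in> J \<Longrightarrow> periodic L (m j \<circ> of_int_vec)"
    using common_period[of J m, OF finite_J periodic] by blast
  have sum_Phi: "(\<Sum>j\<in>J. Phi A P (m j) u (\<gamma> j *v u) \<tau>) = of_real (sqrt (Im \<tau>)) * total_series (t_param P u) \<tau>"
    if "u \<in> C" "\<tau> \<in> upper_half_plane" for u \<tau>
    using that sum_Phi_eq_total_series by (auto simp: C_eq_range)
  have "maass_form_wt0 (principal_congruence (theta_level L)) (theta_multiplier L) (1/4)
      (\<lambda>\<tau>. \<Sum>j\<in>J. Phi A P (m j) c (\<gamma> j *v c) \<tau>)"
    using L sum_Phi[OF c_C] by (rule maass_form_total_series)
  moreover have "subgroup (principal_congruence (theta_level L)) SL2Z"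
    by (rule subgroup_principal_congruence)
  moreover have "finite (rcosets\<^bsub>SL2Z\<^esub> (principal_congruence (theta_level L)))"
    using theta_level_nonzero[OF L(1)] by (rule finite_rcosets_principal_congruence)
  moreover have "(\<Sum>j\<in>J. Phi A P (m j) c (\<gamma> j *v c) \<tau>) = (\<Sum>j\<in>J. Phi A P (m j) c' (\<gamma> j *v c') \<tau>)"
    if "c' \<in> C" "\<tau> \<in> upper_half_plane" for c' \<tau>
    unfolding sum_Phi[OF c_C that(2)] sum_Phi[OF that]
    using that(2) total_series_independent[of \<tau> "t_param P c" "t_param P c'"] by (simp add: upper_half_plane_def)
  ultimately show ?thesis
    by blast
qed

end
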